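(* Let $B$ be an arbitrary positive number. For all $x$ with $|x|<B$: the function $Z^{(N)}(\lambda)$ built from the $N$-soliton Riemann–Hilbert problem (see context) converges, as $N\to\infty$, to the solution $Z(\lambda)$ of the limiting Riemann–Hilbert problem $$Z_+(\lambda)=Z_-(\lambda)\begin{cases}\begin{bmatrix}1&0\\ e^{2i\lambda x}\displaystyle\int_{i\eta_1}^{i\eta_2}\frac{2ir_1(\zeta)}{\zeta-\lambda}\frac{d\zeta}{2\pi i}&1\end{bmatrix}&\lambda\in\gamma_+\\[3mm]\begin{bmatrix}1&e^{-2i\lambda x}\displaystyle\int_{-i\eta_2}^{-i\eta_1}\frac{2ir_1(\zeta)}{\zeta-\lambda}\frac{d\zeta}{2\pi i}\\0&1\end{bmatrix}&\lambda\in\gamma_-\end{cases}\qquad Z(\lambda)=[1\;\;1]+\mathcal{O}(1/\lambda),\ \lambda\to\infty,$$ ($Z$ row-vector valued and analytic in $\mathbb{C}\setminus(\gamma_+\cup\gamma_-)$); and the $N$-soliton potential $u_N(x)$ converges, as $N\to\infty$, to the soliton gas potential $u(x)$.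
   Context: Let $0<\eta_1<\eta_2$. Let $r_1$ be analytic in a neighbourhood of the intervals $[i\eta_1,i\eta_2]$ and $[-i\eta_2,-i\eta_1]$, with $r_1(\bar\lambda)=r_1(\lambda)$ on these intervals, real, positive and non-vanishing there. For $N\ge1$ let $\lambda_j=i\left(\eta_1+\frac{j}{N}(\eta_2-\eta_1)\right)$ and $c_j=\frac{i(\eta_2-\eta_1)r_1(\lambda_j)}{\pi}$, $j=1,\dots,N$. $N$-soliton problem: $M=M^{(N)}(\lambda;x)$ is the unique row vector, meromorphic in $\mathbb{C}$ with simple poles only at $\lambda_j,\overline{\lambda_j}$, with $\operatorname{res}_{\lambda=\lambda_j}M=\lim_{\lambda\to\lambda_j}M(\lambda)\begin{bmatrix}0&0\\ \frac{c_je^{2i\lambda_jx}}{N}&0\end{bmatrix}$, $\operatorname{res}_{\lambda=\overline{\lambda_j}}M=\lim_{\lambda\to\overline{\lambda_j}}M(\lambda)\begin{bmatrix}0&-\frac{c_je^{-2i\overline{\lambda_j}x}}{N}\\0&0\end{bmatrix}$, $M(\lambda)=[1\;\;1]+\mathcal{O}(1/\lambda)$ as $\lambda\to\infty$, and $M(-\lambda)=M(\lambda)\begin{bmatrix}0&1\\1&0\end{bmatrix}$. The $N$-soliton potential is $u_N(x)=2\frac{d}{dx}\left(\lim_{\lambda\to\infty}\frac{\lambda}{i}(M_1(\lambda)-1)\right)$. $\gamma_+$ is a fixed simple closed curve in the upper half plane encircling $[i\eta_1,i\eta_2]$ counterclockwise, and $\gamma_-$ a fixed simple closed curve in the lower half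 plane encircling $[-i\eta_2,-i\eta_1]$ clockwise. Set $Z^{(N)}(\lambda)=M(\lambda)\begin{bmatrix}1&0\\-\frac1N\sum_{j=1}^N\frac{c_je^{2i\lambda x}}{\lambda-\lambda_j}&1\end{bmatrix}$ inside $\gamma_+$, $Z^{(N)}(\lambda)=M(\lambda)\begin{bmatrix}1&\frac1N\sum_{j=1}^N\frac{c_je^{-2i\lambda x}}{\lambda-\overline{\lambda_j}}\\0&1\end{bmatrix}$ inside $\gamma_-$, and $Z^{(N)}=M$ elsewhere. Convergence of $Z^{(N)}$ is meant for $\lambda\in\mathbb{C}\setminus(\gamma_+\cup\gamma_-)$. Subscripts $+/-$ denote boundary values from the left/right of an oriented contour. Soliton gas problem: with $(i\eta_1,i\eta_2)$ and $(-i\eta_2,-i\eta_1)$ oriented upwards, $X(\lambda;x)$ is the unique row vector, analytic off the closures of these two segments, with at most logarithmic singularities at their endpoints, such that $X_+=X_-\begin{bmatrix}1&0\\-2ir_1(\lambda)e^{2i\lambda x}&1\end{bmatrix}$ on $(i\eta_1,i\eta_2)$, $X_+=X_-\begin{bmatrix}1&2ir_1(\lambda)e^{-2i\lambda x}\\0&1\end{bmatrix}$ on $(-i\eta_2,-i\eta_1)$, $X=[1\;\;1]+\mathcal{O}(1/\lambda)$ at infinity, $X(-\lambda)=X(\lambda)\begin{bmatrix}0&1\\1&0\end{bmatrix}$; and $u(x)=2\frac{d}{dx}\left[\lim_{\lambda\to\infty}\frac{\lambda}{i}(X_1(\lambda;x)-1)\right]$.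
   Formalization: "The solution Z" means the one with the symmetry Z(−λ)=Z(λ)[0 1;1 0] outside the curves, proved unique in that class: the displayed problem alone has several solutions at exceptional x. The curves γ± are piecewise C^1; convergence is pointwise in λ and x. *)

theory Defs
  imports "HOL-Complex_Analysis.Complex_Analysis" "HOL-Library.Landau_Symbols"
begin

text \<open>
  Row vectors are elements of \<open>complex^2\<close> and matrices act on them from the right by \<open>v*\<close>.
  Values of a function on a jump contour or at a pole never carry meaning: every condition
  below is stated off the contour or in terms of limits.
\<close>

definition mat22 :: "complex \<Rightarrow> complex \<Rightarrow> complex \<Rightarrow> complex \<Rightarrow> complex^2^2" where
  "mat22 a b c d = vector [vector [a, b], vector [c, d]]"

definition row_holomorphic_on :: "(complex \<Rightarrow> complex^2) \<Rightarrow> complex set \<Rightarrow> bool" where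
  "row_holomorphic_on F S \<longleftrightarrow> (\<forall>i. (\<lambda>z. F z $ i) holomorphic_on S)"

definition normalized_at_infinity :: "(complex \<Rightarrow> complex^2) \<Rightarrow> bool" where
  "normalized_at_infinity F \<longleftrightarrow>
     (\<lambda>z. norm (F z - vector [1, 1])) \<in> O[at_infinity](\<lambda>z. 1 / norm z)"

definition swap_symmetric_on :: "complex set \<Rightarrow> (complex \<Rightarrow> complex^2) \<Rightarrow> bool" where
  "swap_symmetric_on S F \<longleftrightarrow> (\<forall>z\<in>S. - z \<in> S \<longrightarrow> F (- z) = F z v* mat22 0 1 1 0)"

text \<open>
  \<open>F\<^sub>+ = F\<^sub>- J\<close> at the contour point \<open>z\<close>, where \<open>L\<close> and \<open>R\<close> are the regions adjacent to \<open>z\<close> on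
  the left and on the right of the oriented contour.
\<close>

definition has_jump ::
  "(complex \<Rightarrow> complex^2) \<Rightarrow> complex set \<Rightarrow> complex set \<Rightarrow> complex^2^2 \<Rightarrow> complex \<Rightarrow> bool" where
  "has_jump F L R J z \<longleftrightarrow>
     (\<exists>Fplus Fminus. (F \<longlongrightarrow> Fplus) (at z within L) \<and> (F \<longlongrightarrow> Fminus) (at z within R)
        \<and> Fplus = Fminus v* J)"

definition upper_seg :: "real \<Rightarrow> real \<Rightarrow> complex set" where
  "upper_seg \<eta>1 \<eta>2 = closed_segment (\<i> * of_real \<eta>1) (\<i> * of_real \<eta>2)"

definition lower_seg :: "real \<Rightarrow> real \<Rightarrow> complex set" where
  "lower_seg \<eta>1 \<eta>2 = closed_segment (- \<i> * of_real \<eta>2) (- \<i> * of_real \<eta>1)"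

definition soliton_pole :: "real \<Rightarrow> real \<Rightarrow> nat \<Rightarrow> nat \<Rightarrow> complex" where
  "soliton_pole \<eta>1 \<eta>2 N j = \<i> * of_real (\<eta>1 + real j / real N * (\<eta>2 - \<eta>1))"

definition norming_const ::
  "real \<Rightarrow> real \<Rightarrow> (complex \<Rightarrow> complex) \<Rightarrow> nat \<Rightarrow> nat \<Rightarrow> complex" where
  "norming_const \<eta>1 \<eta>2 r1 N j =
     \<i> * of_real (\<eta>2 - \<eta>1) * r1 (soliton_pole \<eta>1 \<eta>2 N j) / of_real pi"

definition soliton_poles :: "real \<Rightarrow> real \<Rightarrow> nat \<Rightarrow> complex set" where
  "soliton_poles \<eta>1 \<eta>2 N =
     soliton_pole \<eta>1 \<eta>2 N ` {1..N} \<union> (cnj \<circ> soliton_pole \<eta>1 \<eta>2 N) ` {1..N}"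

definition at_most_simple_pole :: "(complex \<Rightarrow> complex) \<Rightarrow> complex \<Rightarrow> bool" where
  "at_most_simple_pole f p \<longleftrightarrow>
     isolated_singularity_at f p \<and> (\<exists>l. ((\<lambda>z. (z - p) * f z) \<longlongrightarrow> l) (at p))"

definition row_residue :: "(complex \<Rightarrow> complex^2) \<Rightarrow> complex \<Rightarrow> complex^2" where
  "row_residue F p = (\<chi> i. residue (\<lambda>z. F z $ i) p)"

text \<open>
  Poles are required to be at most simple. A coefficient that happens to vanish at some \<open>x\<close>
  makes the corresponding singularity removable.
\<close>

definition soliton_rhp ::
  "real \<Rightarrow> real \<Rightarrow> (complex \<Rightarrow> complex) \<Rightarrow> nat \<Rightarrow> real \<Rightarrow> (complex \<Rightarrow> complex^2) \<Rightarrow> bool" where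
  "soliton_rhp \<eta>1 \<eta>2 r1 N x M \<longleftrightarrow>
     row_holomorphic_on M (- soliton_poles \<eta>1 \<eta>2 N) \<and>
     (\<forall>p\<in>soliton_poles \<eta>1 \<eta>2 N. \<forall>i. at_most_simple_pole (\<lambda>z. M z $ i) p) \<and>
     (\<forall>j\<in>{1..N}. let p = soliton_pole \<eta>1 \<eta>2 N j; c = norming_const \<eta>1 \<eta>2 r1 N j in
        ((\<lambda>z. M z v* mat22 0 0 (c * exp (2 * \<i> * p * of_real x) / of_nat N) 0)
           \<longlongrightarrow> row_residue M p) (at p) \<and>
        ((\<lambda>z. M z v* mat22 0 (- (c * exp (- 2 * \<i> * cnj p * of_real x) / of_nat N)) 0 0)
           \<longlongrightarrow> row_residue M (cnj p)) (at (cnj p))) \<and>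
     normalized_at_infinity M \<and>
     swap_symmetric_on (- soliton_poles \<eta>1 \<eta>2 N) M"

text \<open>\<open>F x\<close> is the row vector function of the spectral variable at position \<open>x\<close>.\<close>

definition potential :: "(real \<Rightarrow> complex \<Rightarrow> complex^2) \<Rightarrow> real \<Rightarrow> complex" where
  "potential F x =
     2 * vector_derivative (\<lambda>y. Lim at_infinity (\<lambda>z. z / \<i> * (F y z $ 1 - 1))) (at x)"

text \<open>
  Inside the curves the triangular factors cancel the poles of \<open>M\<close>, so that the product has
  removable singularities at the poles; \<open>remove_sings\<close> assigns the limiting values there
  (for instance, \<open>\<i> \<eta>2\<close> is a pole of \<open>M\<close> for every \<open>N\<close>).
\<close>

definition soliton_Z ::
  "real \<Rightarrow> real \<Rightarrow> (complex \<Rightarrow> complex) \<Rightarrow> (real \<Rightarrow> complex) \<Rightarrow> (real \<Rightarrow> complex) \<Rightarrow>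
   nat \<Rightarrow> real \<Rightarrow> (complex \<Rightarrow> complex^2) \<Rightarrow> complex \<Rightarrow> complex^2" where
  "soliton_Z \<eta>1 \<eta>2 r1 \<gamma>p \<gamma>m N x M =
     (let p = soliton_pole \<eta>1 \<eta>2 N; c = norming_const \<eta>1 \<eta>2 r1 N;
          W = (\<lambda>z. if z \<in> inside (path_image \<gamma>p) then
                     M z v* mat22 1 0
                       (- (1 / of_nat N * (\<Sum>j=1..N. c j * exp (2 * \<i> * z * of_real x) / (z - p j)))) 1
                   else if z \<in> inside (path_image \<gamma>m) then
                     M z v* mat22 1
                       (1 / of_nat N * (\<Sum>j=1..N. c j * exp (- 2 * \<i> * z * of_real x) / (z - cnj (p j))))
                       0 1
                   else M z)
      in (\<lambda>z. \<chi> i. remove_sings (\<lambda>w. W w $ i) z))"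

text \<open>
  Left and right regions at the two contours: \<open>\<gamma>p\<close> is counterclockwise, so its left side is its
  inside; \<open>\<gamma>m\<close> is clockwise, so its left side is its outside.
\<close>

definition limit_rhp ::
  "real \<Rightarrow> real \<Rightarrow> (complex \<Rightarrow> complex) \<Rightarrow> (real \<Rightarrow> complex) \<Rightarrow> (real \<Rightarrow> complex) \<Rightarrow>
   real \<Rightarrow> (complex \<Rightarrow> complex^2) \<Rightarrow> bool" where
  "limit_rhp \<eta>1 \<eta>2 r1 \<gamma>p \<gamma>m x Z \<longleftrightarrow>
     row_holomorphic_on Z (- (path_image \<gamma>p \<union> path_image \<gamma>m)) \<and>
     (\<forall>z\<in>path_image \<gamma>p. has_jump Z (inside (path_image \<gamma>p)) (outside (path_image \<gamma>p))
        (mat22 1 0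
           (exp (2 * \<i> * z * of_real x) *
              contour_integral (linepath (\<i> * of_real \<eta>1) (\<i> * of_real \<eta>2))
                (\<lambda>\<zeta>. 2 * \<i> * r1 \<zeta> / (\<zeta> - z) / (2 * of_real pi * \<i>))) 1) z) \<and>
     (\<forall>z\<in>path_image \<gamma>m. has_jump Z (outside (path_image \<gamma>m)) (inside (path_image \<gamma>m))
        (mat22 1
           (exp (- 2 * \<i> * z * of_real x) *
              contour_integral (linepath (- \<i> * of_real \<eta>2) (- \<i> * of_real \<eta>1))
                (\<lambda>\<zeta>. 2 * \<i> * r1 \<zeta> / (\<zeta> - z) / (2 * of_real pi * \<i>))) 0 1) z) \<and>
     normalized_at_infinity Z"

text \<open>
  The solution of \<open>limit_rhp\<close> that is meant is the one with the symmetry inherited from \<open>M\<close>,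
  required where neither \<open>z\<close> nor \<open>- z\<close> is enclosed by a contour (the curves need not be
  reflections of each other). Without the symmetry \<open>limit_rhp\<close> is not uniquely solvable at
  those \<open>x\<close> for which the integral operator with kernel
  \<open>r1 (\<i> t) exp (- 2 t x) / (pi (s + t))\<close> on \<open>[\<eta>1, \<eta>2]\<close> has the eigenvalue 1.
\<close>

definition symmetric_limit_rhp ::
  "real \<Rightarrow> real \<Rightarrow> (complex \<Rightarrow> complex) \<Rightarrow> (real \<Rightarrow> complex) \<Rightarrow> (real \<Rightarrow> complex) \<Rightarrow>
   real \<Rightarrow> (complex \<Rightarrow> complex^2) \<Rightarrow> bool" where
  "symmetric_limit_rhp \<eta>1 \<eta>2 r1 \<gamma>p \<gamma>m x Z \<longleftrightarrow>
     limit_rhp \<eta>1 \<eta>2 r1 \<gamma>p \<gamma>m x Z \<and>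
     swap_symmetric_on (outside (path_image \<gamma>p) \<inter> outside (path_image \<gamma>m)) Z"

text \<open>
  The segments are oriented upwards, so the left side is the left half plane.
\<close>

definition soliton_gas_rhp ::
  "real \<Rightarrow> real \<Rightarrow> (complex \<Rightarrow> complex) \<Rightarrow> real \<Rightarrow> (complex \<Rightarrow> complex^2) \<Rightarrow> bool" where
  "soliton_gas_rhp \<eta>1 \<eta>2 r1 x X \<longleftrightarrow>
     (let \<Sigma> = upper_seg \<eta>1 \<eta>2 \<union> lower_seg \<eta>1 \<eta>2 in
        row_holomorphic_on X (- \<Sigma>) \<and>
        (\<forall>p\<in>{\<i> * of_real \<eta>1, \<i> * of_real \<eta>2, - \<i> * of_real \<eta>1, - \<i> * of_real \<eta>2}.
           (\<lambda>z. norm (X z)) \<in> O[at p within (- \<Sigma>)](\<lambda>z. ln (norm (z - p)))) \<and>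
        (\<forall>z\<in>open_segment (\<i> * of_real \<eta>1) (\<i> * of_real \<eta>2).
           has_jump X {w. Re w < 0} {w. Re w > 0}
             (mat22 1 0 (- 2 * \<i> * r1 z * exp (2 * \<i> * z * of_real x)) 1) z) \<and>
        (\<forall>z\<in>open_segment (- \<i> * of_real \<eta>2) (- \<i> * of_real \<eta>1).
           has_jump X {w. Re w < 0} {w. Re w > 0}
             (mat22 1 (2 * \<i> * r1 z * exp (- 2 * \<i> * z * of_real x)) 0 1) z) \<and>
        normalized_at_infinity X \<and>
        swap_symmetric_on (- \<Sigma>) X)"

end

theory Submission
  imports Defs
begin

text \<open>
  The residue conditions and the symmetry determine an \<open>N\<close>-soliton solution by the values
  \<open>\<psi>(s) = M\<^sub>2(i s)\<close>, which solve the Riemann-sum discretisation of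
  \<open>\<phi>(s) + \<integral> \<rho>(t) \<phi>(t) / (s + t) dt = 1\<close> on \<open>[\<eta>1, \<eta>2]\<close>, where \<open>\<rho>(t) = r1(i t) e\<^sup>-\<^sup>2\<^sup>t\<^sup>x / pi\<close>.
  Since \<open>\<rho>\<close> is nonnegative and the kernel \<open>1 / (s + t)\<close> is positive semidefinite, the discrete
  systems are stable uniformly in \<open>N\<close>. A solution of the limiting problem, once its triangular
  factors are undone, extends analytically across the curves and is the Cauchy transform of a
  solution \<open>\<phi>\<close> of the continuous equation, so it is the limit of the \<open>Z\<^sup>(\<^sup>N\<^sup>)\<close>; this also shows that
  it is unique. Dressing \<open>X\<close> with the triangular factors gives its existence.

  The potentials are derivatives of the masses \<open>m(x) = \<integral> \<rho>\<^sub>x \<phi>\<^sub>x\<close>. The symmetry of the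
  kernel gives \<open>m(y) - m(x) = \<integral> (\<rho>\<^sub>y - \<rho>\<^sub>x) \<phi>\<^sub>x \<phi>\<^sub>y\<close>, also for Riemann sums, hence
  \<open>m' = - 2 \<integral> t \<rho> \<phi>\<^sup>2\<close>, which again converges by stability.
\<close>

subsection \<open>Removable curves\<close>

text \<open>The jump conditions are pointwise: at each contour point only the two one-sided limits
  are given, with no uniformity, and the curves are merely simple and piecewise C1. Every
  deformation of contours therefore rests on one removability result: a function holomorphic off a
  simple path that has limits at the path extends across it. The segments fall under the same
  result. Their endpoints are harmless because logarithmic growth is weaker than a pole, and
  Plemelj's formula for the density is reduced to a constant density, whose Cauchy integral is a
  logarithm.

  The swap symmetry fixes a sign. With \<open>K\<close> the integral operator of kernel
  \<open>\<rho>(t) / (s + t)\<close>, it leads to the equation with \<open>1 + K\<close> instead of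
  \<open>1 - K\<close>. Positivity keeps the spectrum of \<open>K\<close> nonnegative, so
  \<open>1 + K\<close> is always injective, while \<open>1 - K\<close> may degenerate. The same
  positivity bounds the inverses of the discrete systems by a constant that involves only total mass
  and distance to the real axis, which is why nothing deteriorates as the number of poles
  grows.\<close>

definition rect_integral :: "(complex \<Rightarrow> complex) \<Rightarrow> real \<Rightarrow> real \<Rightarrow> real \<Rightarrow> real \<Rightarrow> complex" where
  "rect_integral f x x' y y' =
     contour_integral (linepath (Complex x y) (Complex x' y)) f
   + contour_integral (linepath (Complex x' y) (Complex x' y')) f
   - contour_integral (linepath (Complex x y') (Complex x' y')) f
   - contour_integral (linepath (Complex x y) (Complex x y')) f"

definition rect :: "real \<Rightarrow> real \<Rightarrow> real \<Rightarrow> real \<Rightarrow> complex set" where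
  "rect x x' y y' = {z. x \<le> Re z \<and> Re z \<le> x' \<and> y \<le> Im z \<and> Im z \<le> y'}"

lemma rect_eq_cbox: "rect x x' y y' = cbox (Complex x y) (Complex x' y')"
  by (auto simp: rect_def in_cbox_complex_iff)

lemma closed_segment_subset_rect:
  assumes "x \<le> x1" "x1 \<le> x'" "y \<le> y1" "y1 \<le> y'" "x \<le> x2" "x2 \<le> x'" "y \<le> y2" "y2 \<le> y'"
  shows "closed_segment (Complex x1 y1) (Complex x2 y2) \<subseteq> rect x x' y y'"
  unfolding rect_eq_cbox
  by (rule closed_segment_subset) (use assms in \<open>auto simp: in_cbox_complex_iff\<close>)

lemma Complex_in_closed_segment_horizontal:
  assumes "x \<le> u" "u \<le> x'"
  shows "Complex u y \<in> closed_segment (Complex x y) (Complex x' y)"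
  using assms by (simp add: closed_segment_same_Im closed_segment_eq_real_ivl)

lemma Complex_in_closed_segment_vertical:
  assumes "y \<le> u" "u \<le> y'"
  shows "Complex x u \<in> closed_segment (Complex x y) (Complex x y')"
  using assms by (simp add: closed_segment_same_Re closed_segment_eq_real_ivl)

lemma rect_integral_split_x:
  assumes "x \<le> u" "u \<le> x'" "y \<le> y'" "continuous_on (rect x x' y y') f"
  shows "rect_integral f x x' y y' = rect_integral f x u y y' + rect_integral f u x' y y'"
proof -
  have "contour_integral (linepath (Complex x v) (Complex x' v)) f =
     contour_integral (linepath (Complex x v) (Complex u v)) f
      + contour_integral (linepath (Complex u v) (Complex x' v)) f" if "y \<le> v" "v \<le> y'" for v
    using assms that
    by (intro contour_integral_split_linepath Complex_in_closed_segment_horizontal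
          continuous_on_subset[OF assms(4)] closed_segment_subset_rect) auto
  from this[of y] this[of y'] show ?thesis
    using assms by (simp add: rect_integral_def)
qed

lemma rect_integral_split_y:
  assumes "x \<le> x'" "y \<le> u" "u \<le> y'" "continuous_on (rect x x' y y') f"
  shows "rect_integral f x x' y y' = rect_integral f x x' y u + rect_integral f x x' u y'"
proof -
  have "contour_integral (linepath (Complex v y) (Complex v y')) f =
     contour_integral (linepath (Complex v y) (Complex v u)) f
      + contour_integral (linepath (Complex v u) (Complex v y')) f" if "x \<le> v" "v \<le> x'" for v
    using assms that
    by (intro contour_integral_split_linepath Complex_in_closed_segment_vertical
          continuous_on_subset[OF assms(4)] closed_segment_subset_rect) auto
  from this[of x] this[of x'] show ?thesis
    using assms by (simp add: rect_integral_def)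
qed

lemma rect_mono: "x1 \<le> x \<Longrightarrow> x' \<le> x2 \<Longrightarrow> y1 \<le> y \<Longrightarrow> y' \<le> y2 \<Longrightarrow> rect x x' y y' \<subseteq> rect x1 x2 y1 y2"
  by (auto simp: rect_def)

lemma rect_integral_sum_x:
  assumes "mono X" "y \<le> y'" "continuous_on (rect (X 0) (X n) y y') f"
  shows "rect_integral f (X 0) (X n) y y' = (\<Sum>i<n. rect_integral f (X i) (X (Suc i)) y y')"
  using assms(3)
proof (induction n)
  case 0
  then show ?case by (simp add: rect_integral_def)
next
  case (Suc n)
  have 1: "X 0 \<le> X n" "X n \<le> X (Suc n)" using \<open>mono X\<close> by (auto simp: mono_def)
  have "continuous_on (rect (X 0) (X n) y y') f"
    by (rule continuous_on_subset[OF Suc.prems]) (use 1 in \<open>auto simp: rect_def\<close>)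
  then show ?case
    using Suc rect_integral_split_x[OF 1 assms(2) Suc.prems] by simp
qed

lemma rect_integral_sum_y:
  assumes "mono Y" "x \<le> x'" "continuous_on (rect x x' (Y 0) (Y n)) f"
  shows "rect_integral f x x' (Y 0) (Y n) = (\<Sum>i<n. rect_integral f x x' (Y i) (Y (Suc i)))"
  using assms(3)
proof (induction n)
  case 0
  then show ?case by (simp add: rect_integral_def)
next
  case (Suc n)
  have 1: "Y 0 \<le> Y n" "Y n \<le> Y (Suc n)" using \<open>mono Y\<close> by (auto simp: mono_def)
  have "continuous_on (rect x x' (Y 0) (Y n)) f"
    by (rule continuous_on_subset[OF Suc.prems]) (use 1 in \<open>auto simp: rect_def\<close>)
  then show ?case
    using Suc rect_integral_split_y[OF assms(2) 1 Suc.prems] by simp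
qed

lemma rect_integral_sum_grid:
  assumes "mono X" "mono Y" "continuous_on (rect (X 0) (X n) (Y 0) (Y n)) f"
  shows "rect_integral f (X 0) (X n) (Y 0) (Y n) =
    (\<Sum>(i,j)\<in>{..<n}\<times>{..<n}. rect_integral f (X i) (X (Suc i)) (Y j) (Y (Suc j)))"
proof -
  have "rect_integral f (X i) (X (Suc i)) (Y 0) (Y n) =
      (\<Sum>j<n. rect_integral f (X i) (X (Suc i)) (Y j) (Y (Suc j)))" if "i < n" for i
  proof (rule rect_integral_sum_y)
    have "X 0 \<le> X i" "X (Suc i) \<le> X n" using \<open>mono X\<close> that by (auto simp: mono_def)
    then show "continuous_on (rect (X i) (X (Suc i)) (Y 0) (Y n)) f"
      by (intro continuous_on_subset[OF assms(3)] rect_mono) auto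
  qed (use assms in \<open>auto simp: mono_def\<close>)
  moreover have "Y 0 \<le> Y n" using assms by (auto simp: mono_def)
  ultimately show ?thesis
    using rect_integral_sum_x[OF assms(1) _ assms(3)]
    by (simp add: sum.cartesian_product)
qed

text \<open>Holomorphy is only relative to the closed rectangle. Convexity still yields a primitive
  there, so each side contributes a difference of corner values, and these cancel around the
  boundary.\<close>

lemma rect_integral_holomorphic:
  assumes "x \<le> x'" "y \<le> y'" "f holomorphic_on rect x x' y y'"
  shows "rect_integral f x x' y y' = 0"
proof -
  have cv: "convex (rect x x' y y')" by (simp add: rect_eq_cbox)
  have "f field_differentiable at z" if "z \<in> interior (rect x x' y y') - {}" for z
    using that holomorphic_on_imp_differentiable_at[OF holomorphic_on_subset[OF assms(3) interior_subset]]
    by simp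
  then obtain F where F: "\<And>z. z \<in> rect x x' y y' \<Longrightarrow> (F has_field_derivative f z) (at z within rect x x' y y')"
    using holomorphic_convex_primitive[OF cv finite.emptyI holomorphic_on_imp_continuous_on[OF assms(3)]]
    by metis
  have "contour_integral (linepath a b) f = F b - F a"
    if "closed_segment a b \<subseteq> rect x x' y y'" for a b
    using contour_integral_primitive[OF F, of "linepath a b"] that
    by (simp add: contour_integral_unique)
  then show ?thesis
    unfolding rect_integral_def using assms by (simp add: closed_segment_subset_rect)
qed

text \<open>A constant integrates to zero around a rectangle, so only the oscillation of
  \<open>f\<close> about \<open>c\<close> counts. The bound is \<open>e\<close> times the
  perimeter.\<close>

lemma norm_rect_integral_le:
  assumes "x \<le> x'" "y \<le> y'" "continuous_on (rect x x' y y') f"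
    and "\<And>z. z \<in> rect x x' y y' \<Longrightarrow> norm (f z - c) \<le> e" "0 \<le> e"
  shows "norm (rect_integral f x x' y y') \<le> 2 * e * ((x' - x) + (y' - y))"
proof -
  have *: "norm (contour_integral (linepath a b) f - c * (b - a)) \<le> e * norm (b - a)"
    if s: "closed_segment a b \<subseteq> rect x x' y y'" for a b
  proof -
    have "(f has_contour_integral contour_integral (linepath a b) f) (linepath a b)"
      by (intro has_contour_integral_integral contour_integrable_continuous_linepath
          continuous_on_subset[OF assms(3) s])
    then have "((\<lambda>z. f z - c) has_contour_integral
        (contour_integral (linepath a b) f - c * (b - a))) (linepath a b)"
      by (intro has_contour_integral_diff has_contour_integral_const_linepath)
    then show ?thesis
      by (rule has_contour_integral_bound_linepath) (use assms s in auto)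
  qed
  define A1 where "A1 = contour_integral (linepath (Complex x y) (Complex x' y)) f - c * (Complex x' y - Complex x y)"
  define A2 where "A2 = contour_integral (linepath (Complex x' y) (Complex x' y')) f - c * (Complex x' y' - Complex x' y)"
  define A3 where "A3 = contour_integral (linepath (Complex x y') (Complex x' y')) f - c * (Complex x' y' - Complex x y')"
  define A4 where "A4 = contour_integral (linepath (Complex x y) (Complex x y')) f - c * (Complex x y' - Complex x y)"
  have eq: "rect_integral f x x' y y' = A1 + A2 - A3 - A4"
    by (simp add: rect_integral_def A1_def A2_def A3_def A4_def algebra_simps)
  have "norm (A1 + A2 - A3 - A4) \<le> norm A1 + norm A2 + norm A3 + norm A4"
    by (intro order.trans[OF norm_triangle_ineq4] order.trans[OF norm_triangle_ineq] add_mono) auto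
  also have "\<dots> \<le> e * (x' - x) + e * (y' - y) + e * (x' - x) + e * (y' - y)"
    using assms *[OF closed_segment_subset_rect] unfolding A1_def A2_def A3_def A4_def
    by (intro add_mono; fastforce simp: cmod_def)
  also have "\<dots> = 2 * e * ((x' - x) + (y' - y))" by algebra
  finally show ?thesis by (simp only: eq)
qed

section \<open>Counting the grid cells met by a Lipschitz curve\<close>

lemma card_nat_near_le:
  assumes "0 \<le> A"
  shows "finite {i::nat. \<bar>real i - c\<bar> \<le> A}" "real (card {i::nat. \<bar>real i - c\<bar> \<le> A}) \<le> 2 * A + 1"
proof -
  let ?S = "{i::nat. \<bar>real i - c\<bar> \<le> A}"
  have sub: "int ` ?S \<subseteq> {\<lceil>c - A\<rceil>..\<lfloor>c + A\<rfloor>}"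
    by (auto simp: ceiling_le_iff le_floor_iff abs_le_iff)
  then have "finite (int ` ?S)" by (rule finite_subset) simp
  then show "finite ?S" by (simp add: finite_image_iff)
  have "card ?S = card (int ` ?S)" by (simp add: card_image)
  also have "\<dots> \<le> card {\<lceil>c - A\<rceil>..\<lfloor>c + A\<rfloor>}" by (rule card_mono) (use sub in auto)
  finally have "real (card ?S) \<le> real (nat (\<lfloor>c + A\<rfloor> - \<lceil>c - A\<rceil> + 1))" by simp
  also have "\<dots> \<le> 2 * A + 1"
  proof -
    have "real_of_int \<lfloor>c + A\<rfloor> \<le> c + A" "c - A \<le> real_of_int \<lceil>c - A\<rceil>" by auto
    then have "real_of_int (\<lfloor>c + A\<rfloor> - \<lceil>c - A\<rceil> + 1) \<le> 2 * A + 1" by linarith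
    then show ?thesis using assms by (cases "0 \<le> \<lfloor>c + A\<rfloor> - \<lceil>c - A\<rceil> + 1") auto
  qed
  finally show "real (card ?S) \<le> 2 * A + 1" .
qed

text \<open>Every parameter lies within \<open>(b - a) / n\<close> of one of \<open>n\<close>
  equidistant samples, so the curve point is at most \<open>L * (b - a) / n\<close> away from a
  sampled point. In units of the cell size this distance does not depend on \<open>n\<close>. All
  cells met near one sample therefore have indices in a window of bounded size, and \<open>n\<close>
  windows cover everything; the two factors are the window sizes in the two directions.\<close>

lemma card_grid_cells_le:
  fixes g :: "real \<Rightarrow> complex" and x0 y0 :: real
  assumes "0 < n" "0 < w" "0 < h" "a \<le> b" "0 \<le> L"
    and lip: "\<And>s t. s \<in> {a..b} \<Longrightarrow> t \<in> {a..b} \<Longrightarrow> norm (g s - g t) \<le> L * \<bar>s - t\<bar>"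
    and K: "K \<subseteq> g ` {a..b}"
  defines "C \<equiv> \<lambda>i j. rect (x0 + real i * w / real n) (x0 + real (Suc i) * w / real n)
                        (y0 + real j * h / real n) (y0 + real (Suc j) * h / real n)"
  shows "real (card {(i,j) \<in> {..<n} \<times> {..<n}. C i j \<inter> K \<noteq> {}}) \<le>
    real n * ((2 * (L * (b - a) / w + 1) + 1) * (2 * (L * (b - a) / h + 1) + 1))"
proof -
  define D where "D = L * (b - a)"
  define t where "t k = a + real k * (b - a) / real n" for k
  have D0: "0 \<le> D" using assms by (simp add: D_def)
  define I where "I k = {i::nat. \<bar>real i - real n * (Re (g (t k)) - x0) / w\<bar> \<le> D / w + 1}" for k
  define J where "J k = {j::nat. \<bar>real j - real n * (Im (g (t k)) - y0) / h\<bar> \<le> D / h + 1}" for k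
  let ?P = "2 * (D / w + 1) + 1" and ?Q = "2 * (D / h + 1) + 1"
  have cI: "finite (I k)" "real (card (I k)) \<le> ?P" for k
    unfolding I_def using card_nat_near_le[of "D / w + 1"] D0 \<open>0 < w\<close> by auto
  have cJ: "finite (J k)" "real (card (J k)) \<le> ?Q" for k
    unfolding J_def using card_nat_near_le[of "D / h + 1"] D0 \<open>0 < h\<close> by auto
  \<comment> \<open>In cell units the distance \<open>D / n\<close> becomes \<open>D / d\<close>;
    the \<open>+ 1\<close> accounts for the position inside a cell.\<close>
  have near: "\<bar>real i - real n * (p - x) / d\<bar> \<le> D / d + 1"
    if "0 < d" "x + real i * d / real n \<le> q" "q \<le> x + real (Suc i) * d / real n" "\<bar>q - p\<bar> \<le> D / real n"
    for x d p q :: real and i :: nat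
  proof -
    have n0: "real n > 0" using \<open>0 < n\<close> by simp
    have "real n * x + real i * d \<le> real n * q" "real n * q \<le> real n * x + real i * d + d"
      "\<bar>real n * q - real n * p\<bar> \<le> D"
      using that(2,3,4) n0
      by (auto simp: field_simps abs_le_iff)
    then have "\<bar>real i * d - real n * (p - x)\<bar> \<le> D + d"
      by (simp add: abs_le_iff algebra_simps)
    then show ?thesis using \<open>0 < d\<close> by (simp add: field_simps abs_le_iff)
  qed
  have sub: "{(i,j) \<in> {..<n} \<times> {..<n}. C i j \<inter> K \<noteq> {}} \<subseteq> (\<Union>k<n. I k \<times> J k)"
  proof
    fix p assume "p \<in> {(i,j) \<in> {..<n} \<times> {..<n}. C i j \<inter> K \<noteq> {}}"
    then obtain i j z where p: "p = (i, j)" and z: "z \<in> C i j" "z \<in> K" by auto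
    then obtain s where s: "s \<in> {a..b}" "z = g s" using K by auto
    have n0: "real n > 0" using \<open>0 < n\<close> by simp
    obtain k where k: "k < n" "\<bar>s - t k\<bar> \<le> (b - a) / real n" "t k \<in> {a..b}"
    proof (cases "b = a")
      case True
      then show ?thesis using that[of 0] s \<open>0 < n\<close> by (simp add: t_def)
    next
      case False
      then have ba: "b - a > 0" using \<open>a \<le> b\<close> by simp
      define u where "u = real n * (s - a) / (b - a)"
      have u: "0 \<le> u" "u \<le> real n" using s ba n0 by (auto simp: u_def field_simps)
      have su: "s = a + u * (b - a) / real n" using ba n0 by (simp add: u_def field_simps)
      \<comment> \<open>The minimum acts only at \<open>u = n\<close>, that is \<open>s = b\<close>,
        where the floor alone would give the excluded index \<open>n\<close>.\<close>
      define k where "k = min (nat \<lfloor>u\<rfloor>) (n - 1)"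
      have "real k \<le> u" "u \<le> real k + 1" "k < n"
        using u \<open>0 < n\<close> unfolding k_def by linarith+
      then have "0 \<le> (u - real k) * (b - a) / real n" "(u - real k) * (b - a) / real n \<le> (b - a) / real n"
        "0 \<le> real k * (b - a) / real n" "s - t k = (u - real k) * (b - a) / real n"
        using ba n0 divide_right_mono[OF mult_right_mono[of "u - real k" 1 "b - a"], of "real n"]
          divide_right_mono[OF mult_right_mono[of "real k" u "b - a"], of "real n"]
        by (auto simp: su t_def diff_divide_distrib left_diff_distrib)
      then have "\<bar>s - t k\<bar> \<le> (b - a) / real n" "t k \<in> {a..b}"
        using s by (auto simp: t_def)
      with \<open>k < n\<close> that show ?thesis by blast
    qed
    have "norm (z - g (t k)) \<le> L * \<bar>s - t k\<bar>" using lip s k by simp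
    also have "\<dots> \<le> L * ((b - a) / real n)" using k \<open>0 \<le> L\<close> by (intro mult_left_mono)
    finally have "norm (z - g (t k)) \<le> D / real n" by (simp add: D_def)
    then have "\<bar>Re z - Re (g (t k))\<bar> \<le> D / real n" "\<bar>Im z - Im (g (t k))\<bar> \<le> D / real n"
      using abs_Re_le_cmod[of "z - g (t k)"] abs_Im_le_cmod[of "z - g (t k)"] by auto
    then have "i \<in> I k" "j \<in> J k"
      unfolding I_def J_def using z assms(2,3) by (auto simp: C_def rect_def intro!: near)
    with \<open>k < n\<close> show "p \<in> (\<Union>k<n. I k \<times> J k)" by (auto simp: p)
  qed
  have "card {(i,j) \<in> {..<n} \<times> {..<n}. C i j \<inter> K \<noteq> {}} \<le> card (\<Union>k<n. I k \<times> J k)"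
    by (rule card_mono[OF _ sub]) (use cI cJ in auto)
  also have "\<dots> \<le> (\<Sum>k<n. card (I k \<times> J k))" by (rule card_UN_le) simp
  finally have "real (card {(i,j) \<in> {..<n} \<times> {..<n}. C i j \<inter> K \<noteq> {}}) \<le> real (\<Sum>k<n. card (I k \<times> J k))"
    by (simp only: of_nat_le_iff)
  also have "\<dots> = (\<Sum>k<n. real (card (I k)) * real (card (J k)))"
    by (simp add: card_cartesian_product)
  also have "\<dots> \<le> (\<Sum>k<n. ?P * ?Q)"
    using D0 assms by (intro sum_mono mult_mono cI cJ) auto
  finally show ?thesis by (simp add: D_def)
qed

text \<open>
  A Lipschitz curve meets only \<open>O(n)\<close> of the \<open>n\<^sup>2\<close> cells of a grid, each of perimeter \<open>O(1/n)\<close>; on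
  these cells \<open>f\<close> is nearly constant, so their total contribution tends to zero.
\<close>

lemma rect_integral_removable_curve:
  fixes g :: "real \<Rightarrow> complex"
  assumes "x < x'" "y < y'" "a \<le> b" "0 \<le> L"
    and lip: "\<And>s t. s \<in> {a..b} \<Longrightarrow> t \<in> {a..b} \<Longrightarrow> norm (g s - g t) \<le> L * \<bar>s - t\<bar>"
    and cont: "continuous_on (rect x x' y y') f"
    and hol: "f holomorphic_on (rect x x' y y' - g ` {a..b})"
  shows "rect_integral f x x' y y' = 0"
proof -
  define w where "w = x' - x"
  define h where "h = y' - y"
  define K where "K = g ` {a..b}"
  have wh: "0 < w" "0 < h" using assms by (auto simp: w_def h_def)
  define M where "M = (2 * (L * (b - a) / w + 1) + 1) * (2 * (L * (b - a) / h + 1) + 1)"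
  have M0: "0 \<le> M" using assms wh by (simp add: M_def)
  have "norm (rect_integral f x x' y y') \<le> M * (2 * (w + h)) * e" if e: "e > 0" for e
  proof -
    have "compact (rect x x' y y')" by (simp add: rect_eq_cbox)
    then have "uniformly_continuous_on (rect x x' y y') f"
      using cont compact_uniformly_continuous by blast
    then obtain d where d: "d > 0"
      "\<And>u v. u \<in> rect x x' y y' \<Longrightarrow> v \<in> rect x x' y y' \<Longrightarrow> dist u v < d \<Longrightarrow> dist (f u) (f v) < e"
      using e unfolding uniformly_continuous_on_def by metis
    \<comment> \<open>A cell has sides \<open>w / n\<close> and \<open>h / n\<close>; for this
      \<open>n\<close> any two of its points are closer than \<open>d\<close>.\<close>
    obtain n :: nat where "real n > (w + h) / d" using reals_Archimedean2 by blast
    moreover have "(w + h) / d > 0" using wh d by simp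
    ultimately have "0 < n" by (auto intro: gr0I)
    with \<open>real n > (w + h) / d\<close> have n: "0 < n" "(w + h) / real n < d"
      using d by (auto simp: field_simps)
    define X where "X i = x + real i * w / real n" for i
    define Y where "Y j = y + real j * h / real n" for j
    have mono: "mono X" "mono Y"
      unfolding mono_def X_def Y_def using wh by (auto intro!: divide_right_mono mult_right_mono)
    have ends: "X 0 = x" "X n = x'" "Y 0 = y" "Y n = y'"
      using n by (auto simp: X_def Y_def w_def h_def)
    have step: "X (Suc i) - X i = w / real n" "Y (Suc i) - Y i = h / real n" for i
      using n by (auto simp: X_def Y_def field_simps)
    define Bd where "Bd = {(i,j) \<in> {..<n} \<times> {..<n}. rect (X i) (X (Suc i)) (Y j) (Y (Suc j)) \<inter> K \<noteq> {}}"
    let ?R = "\<lambda>(i,j). rect_integral f (X i) (X (Suc i)) (Y j) (Y (Suc j))"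
    have cell: "rect (X i) (X (Suc i)) (Y j) (Y (Suc j)) \<subseteq> rect x x' y y'" if "i < n" "j < n" for i j
      using that mono monoD[OF mono(1), of 0 i] monoD[OF mono(2), of 0 j]
        monoD[OF mono(1), of "Suc i" n] monoD[OF mono(2), of "Suc j" n]
      by (intro rect_mono) (simp_all add: ends)
    have le: "X i \<le> X (Suc i)" "Y i \<le> Y (Suc i)" for i
      using mono by (auto simp: mono_def)
    have "rect_integral f x x' y y' = (\<Sum>p\<in>{..<n}\<times>{..<n}. ?R p)"
      using rect_integral_sum_grid[OF mono, of n f] cont by (simp add: ends)
    also have "\<dots> = (\<Sum>p\<in>Bd. ?R p)"
    proof (rule sum.mono_neutral_right)
      show "\<forall>p\<in>{..<n} \<times> {..<n} - Bd. ?R p = 0"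
      proof safe
        fix i j assume ij: "i < n" "j < n" "(i, j) \<notin> Bd"
        then have "rect (X i) (X (Suc i)) (Y j) (Y (Suc j)) \<subseteq> rect x x' y y' - g ` {a..b}"
          using cell[of i j] by (auto simp: Bd_def K_def)
        then show "rect_integral f (X i) (X (Suc i)) (Y j) (Y (Suc j)) = 0"
          by (intro rect_integral_holomorphic le holomorphic_on_subset[OF hol])
      qed
    qed (auto simp: Bd_def)
    finally have eq: "rect_integral f x x' y y' = (\<Sum>p\<in>Bd. ?R p)" .
    have "norm (rect_integral f x x' y y') \<le> (\<Sum>p\<in>Bd. norm (?R p))"
      unfolding eq by (rule norm_sum)
    also have "\<dots> \<le> (\<Sum>p\<in>Bd. 2 * e * ((w + h) / real n))"
    proof (rule sum_mono, safe)
      fix i j assume "(i, j) \<in> Bd"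
      then have ij: "i < n" "j < n" by (auto simp: Bd_def)
      define c where "c = Complex (X i) (Y j)"
      have c: "c \<in> rect (X i) (X (Suc i)) (Y j) (Y (Suc j))" using le by (simp add: c_def rect_def)
      have "norm (f z - f c) \<le> e" if z: "z \<in> rect (X i) (X (Suc i)) (Y j) (Y (Suc j))" for z
      proof -
        have "dist z c \<le> \<bar>Re (z - c)\<bar> + \<bar>Im (z - c)\<bar>" unfolding dist_norm by (rule cmod_le)
        also have "\<dots> \<le> w / real n + h / real n"
          using z step[of i] step[of j] by (intro add_mono) (auto simp: rect_def c_def)
        also have "\<dots> < d" using n by (simp add: add_divide_distrib)
        finally have "dist (f z) (f c) < e" using d(2) cell[OF ij] z c by blast
        then show ?thesis by (simp add: dist_norm)
      qed
      then have "norm (rect_integral f (X i) (X (Suc i)) (Y j) (Y (Suc j)))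
          \<le> 2 * e * ((X (Suc i) - X i) + (Y (Suc j) - Y j))"
        using e by (intro norm_rect_integral_le[where c = "f c"] le continuous_on_subset[OF cont cell[OF ij]]) auto
      then show "norm (rect_integral f (X i) (X (Suc i)) (Y j) (Y (Suc j))) \<le> 2 * e * ((w + h) / real n)"
        by (simp add: step add_divide_distrib)
    qed
    also have "\<dots> = real (card Bd) * (2 * e * ((w + h) / real n))" by simp
    also have "\<dots> \<le> (real n * M) * (2 * e * ((w + h) / real n))"
    proof (rule mult_right_mono)
      show "real (card Bd) \<le> real n * M"
        unfolding Bd_def M_def X_def Y_def
        by (rule card_grid_cells_le[OF n(1) wh assms(3,4) lip]) (auto simp: K_def)
    qed (use e wh in auto)
    also have "\<dots> = M * (2 * (w + h)) * e" using n by (simp add: field_simps)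
    finally show ?thesis .
  qed
  note * = this
  have "norm (rect_integral f x x' y y') \<le> 0"
  proof (rule field_le_epsilon)
    fix e :: real assume e: "e > 0"
    define A where "A = M * (2 * (w + h)) + 1"
    have A: "A > 0" "M * (2 * (w + h)) \<le> A" using M0 wh by (auto simp: A_def intro: add_nonneg_pos)
    have "norm (rect_integral f x x' y y') \<le> M * (2 * (w + h)) * (e / A)" using *[of "e / A"] e A by simp
    also have "\<dots> \<le> A * (e / A)" using A e by (intro mult_right_mono) auto
    finally show "norm (rect_integral f x x' y y') \<le> 0 + e" using A by simp
  qed
  then show ?thesis by simp
qed

section \<open>Morera's theorem for axis-parallel rectangles\<close>

text \<open>The point \<open>b\<close> need not lie between \<open>a\<close> and \<open>c\<close>:
  the other two orders reduce to the splitting rule after reversing segments.\<close>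

lemma contour_integral_linepath_collinear:
  assumes "collinear {a, b, c}" "convex S" "a \<in> S" "b \<in> S" "c \<in> S" "continuous_on S f"
  shows "contour_integral (linepath a c) f = contour_integral (linepath a b) f + contour_integral (linepath b c) f"
proof -
  have cont: "continuous_on (closed_segment u v) f" if "u \<in> S" "v \<in> S" for u v
    by (rule continuous_on_subset[OF assms(6) closed_segment_subset[OF that assms(2)]])
  note rev = contour_integral_reverse_linepath[OF cont]
  note split = contour_integral_split_linepath[OF cont]
  consider "b \<in> closed_segment a c" | "c \<in> closed_segment b a" | "a \<in> closed_segment c b"
    using assms(1) unfolding collinear_between_cases between_mem_segment by (metis closed_segment_commute)
  then show ?thesis
  proof cases
    case 1
    then show ?thesis by (rule split[OF assms(3,5)])
  next
    case 2
    then show ?thesis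
      using split[OF assms(4,3) 2] rev[OF assms(4,3)] rev[OF assms(3,5)] rev[OF assms(4,5)]
      by algebra
  next
    case 3
    then show ?thesis
      using split[OF assms(5,4) 3] rev[OF assms(4,5)] rev[OF assms(5,3)] rev[OF assms(3,4)]
      by algebra
  qed
qed

lemma collinear_horizontal: "collinear {Complex a y, Complex b y, Complex c y}"
  unfolding collinear_def by (rule exI[of _ 1]) (auto simp: complex_eq_iff)

lemma collinear_vertical: "collinear {Complex x a, Complex x b, Complex x c}"
  unfolding collinear_def by (rule exI[of _ \<i>]) (auto simp: complex_eq_iff)

text \<open>Rectangles are used rather than triangles because they subdivide along a grid.
  Integrating \<open>f\<close> along horizontal-then-vertical paths from a base point gives a
  primitive, and \<open>f\<close>, being the derivative of a holomorphic function, is holomorphic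
  itself.\<close>

lemma holomorphic_on_box_rect_integral:
  assumes cont: "continuous_on (box p q) f"
    and zero: "\<And>x x' y y'. x < x' \<Longrightarrow> y < y' \<Longrightarrow> rect x x' y y' \<subseteq> box p q \<Longrightarrow> rect_integral f x x' y y' = 0"
  shows "f holomorphic_on box p q"
proof -
  let ?B = "box p q"
  have cv: "convex ?B" by simp
  have cseg: "continuous_on (closed_segment u v) f" if "u \<in> ?B" "v \<in> ?B" for u v
    by (rule continuous_on_subset[OF cont closed_segment_subset[OF that cv]])
  note rev = contour_integral_reverse_linepath[OF cseg]
  have corner: "Complex x y' \<in> ?B" "Complex x' y \<in> ?B" if "Complex x y \<in> ?B" "Complex x' y' \<in> ?B" for x y x' y'
    using that by (auto simp: in_box_complex_iff)
  have lt: "rect_integral f x x' y y' = 0" if "Complex x y \<in> ?B" "Complex x' y' \<in> ?B" "x < x'" "y < y'" for x x' y y'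
    using that by (intro zero) (auto simp: rect_def in_box_complex_iff)
  \<comment> \<open>Exchanging opposite sides only changes the sign of the boundary integral. The
    corners may thus come in any order, which is needed because points may lie on any side of the
    base point.\<close>
  have lt2: "rect_integral f x x' y y' = 0" if B: "Complex x y \<in> ?B" "Complex x' y' \<in> ?B" "x < x'" for x x' y y'
  proof (cases y y' rule: linorder_cases)
    case less
    then show ?thesis using lt that by blast
  next
    case equal
    then show ?thesis by (simp add: rect_integral_def)
  next
    case greater
    then have "rect_integral f x x' y' y = 0" using lt corner[OF B(1,2)] that by blast
    then show ?thesis
      using rev[OF B(1) corner(1)[OF B(1,2)]] rev[OF corner(2)[OF B(1,2)] B(2)]
      unfolding rect_integral_def by algebra
  qed
  have all: "rect_integral f x x' y y' = 0" if B: "Complex x y \<in> ?B" "Complex x' y' \<in> ?B" for x x' y y'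
  proof (cases x x' rule: linorder_cases)
    case less
    then show ?thesis using lt2 that by blast
  next
    case equal
    then show ?thesis by (simp add: rect_integral_def)
  next
    case greater
    then have "rect_integral f x' x y y' = 0" using lt2 corner[OF B(1,2)] by blast
    then show ?thesis
      using rev[OF B(1) corner(2)[OF B(1,2)]] rev[OF corner(1)[OF B(1,2)] B(2)]
      unfolding rect_integral_def by algebra
  qed
  show ?thesis
  proof (cases "?B = {}")
    case False
    then obtain z0 where z0: "z0 \<in> ?B" by blast
    define x0 where "x0 = Re z0"
    define y0 where "y0 = Im z0"
    have z0': "Complex x0 y0 \<in> ?B" using z0 by (simp add: x0_def y0_def)
    define F where "F z = contour_integral (linepath (Complex x0 y0) (Complex (Re z) y0)) f
      + contour_integral (linepath (Complex (Re z) y0) z) f" for z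
    \<comment> \<open>The paths to \<open>z\<close> and to \<open>w\<close> differ by a rectangle
      reaching down or up to the height \<open>y0\<close> and by an L-shaped path from
      \<open>z\<close> to \<open>w\<close>; only the latter survives.\<close>
    have diff: "F w - F z = contour_integral (linepath z (Complex (Re w) (Im z))) f
        + contour_integral (linepath (Complex (Re w) (Im z)) w) f" if zw: "z \<in> ?B" "w \<in> ?B" for z w
    proof -
      obtain x y where z: "z = Complex x y" by (cases z)
      obtain x' y' where w: "w = Complex x' y'" by (cases w)
      have B: "Complex x y \<in> ?B" "Complex x' y' \<in> ?B" "Complex x y0 \<in> ?B" "Complex x' y0 \<in> ?B" "Complex x' y \<in> ?B"
        using zw z0' by (auto simp: z w in_box_complex_iff)
      have 1: "contour_integral (linepath (Complex x0 y0) (Complex x' y0)) f =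
          contour_integral (linepath (Complex x0 y0) (Complex x y0)) f + contour_integral (linepath (Complex x y0) (Complex x' y0)) f"
        by (rule contour_integral_linepath_collinear[OF collinear_horizontal cv z0' B(3,4) cont])
      have 2: "contour_integral (linepath (Complex x' y0) (Complex x' y')) f =
          contour_integral (linepath (Complex x' y0) (Complex x' y)) f + contour_integral (linepath (Complex x' y) (Complex x' y')) f"
        by (rule contour_integral_linepath_collinear[OF collinear_vertical cv B(4,5,2) cont])
      have 3: "rect_integral f x x' y0 y = 0" by (rule all) (use B in auto)
      show ?thesis
        using 1 2 3 by (simp add: F_def z w rect_integral_def algebra_simps)
    qed
    have der: "(F has_field_derivative f z) (at z)" if z: "z \<in> ?B" for z
      unfolding has_field_derivative_def has_derivative_at2
    proof (intro conjI)
      show "bounded_linear ((*) (f z))" by (rule bounded_linear_mult_right)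
      show "((\<lambda>y. (1 / norm (y - z)) *\<^sub>R (F y - (F z + f z * (y - z)))) \<longlongrightarrow> 0) (at z)"
        unfolding LIM_def
      proof (intro allI impI)
        fix e :: real assume e: "e > 0"
        \<comment> \<open>Both legs of the L are no longer than \<open>norm (w - z)\<close>, so an
          error rate \<open>e / 3\<close> on each leaves the total strictly below
          \<open>e * norm (w - z)\<close>.\<close>
        have "isCont f z" using cont z by (simp add: continuous_on_eq_continuous_at[OF open_box])
        then obtain d1 where d1: "d1 > 0" "\<And>u. dist u z < d1 \<Longrightarrow> dist (f u) (f z) < e / 3"
          using e unfolding continuous_at_eps_delta by (metis zero_less_divide_iff zero_less_numeral)
        obtain d2 where d2: "d2 > 0" "ball z d2 \<subseteq> ?B" using z open_box openE by blast
        define d where "d = min d1 d2"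
        have d0: "d > 0" using d1 d2 by (simp add: d_def)
        have "dist ((1 / norm (w - z)) *\<^sub>R (F w - (F z + f z * (w - z)))) 0 < e"
          if w: "w \<noteq> z" "dist w z < d" for w
        proof -
          let ?c = "Complex (Re w) (Im z)"
          have wB: "w \<in> ?B" using w d2 by (auto simp: d_def dist_commute)
          have cB: "?c \<in> ?B" using z wB by (auto simp: in_box_complex_iff)
          have nc: "norm (?c - z) = \<bar>Re (w - z)\<bar>" "norm (w - ?c) = \<bar>Im (w - z)\<bar>"
            by (auto simp: cmod_def)
          have "norm (?c - z) \<le> norm (w - z)" using nc abs_Re_le_cmod[of "w - z"] by simp
          then have "{z, ?c, w} \<subseteq> ball z d" using w d0 by (auto simp: dist_norm norm_minus_commute)
          then have seg: "closed_segment z ?c \<subseteq> ball z d" "closed_segment ?c w \<subseteq> ball z d"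
            by (intro closed_segment_subset; simp)+
          have est: "norm (contour_integral (linepath u v) f - f z * (v - u)) \<le> e / 3 * norm (v - u)"
            if uv: "u \<in> ?B" "v \<in> ?B" "closed_segment u v \<subseteq> ball z d" for u v
          proof -
            have "(f has_contour_integral contour_integral (linepath u v) f) (linepath u v)"
              by (intro has_contour_integral_integral contour_integrable_continuous_linepath cseg uv)
            then have "((\<lambda>t. f t - f z) has_contour_integral
                (contour_integral (linepath u v) f - f z * (v - u))) (linepath u v)"
              by (intro has_contour_integral_diff has_contour_integral_const_linepath)
            moreover have "norm (f t - f z) \<le> e / 3" if "t \<in> closed_segment u v" for t
            proof -
              have "dist t z < d1" using that uv by (auto simp: d_def dist_commute)
              then show ?thesis using d1(2)[of t] by (simp add: dist_norm)
            qed
            ultimately show ?thesis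
              using e by (intro has_contour_integral_bound_linepath) auto
          qed
          have "F w - (F z + f z * (w - z)) = (contour_integral (linepath z ?c) f - f z * (?c - z))
              + (contour_integral (linepath ?c w) f - f z * (w - ?c))"
            using diff[OF z wB] by (simp add: algebra_simps)
          also have "norm \<dots> \<le> e / 3 * norm (?c - z) + e / 3 * norm (w - ?c)"
            using seg z cB wB by (intro norm_triangle_mono est)
          also have "\<dots> \<le> e / 3 * norm (w - z) + e / 3 * norm (w - z)"
            unfolding nc using e abs_Re_le_cmod[of "w - z"] abs_Im_le_cmod[of "w - z"]
            by (intro add_mono mult_left_mono) auto
          also have "\<dots> < e * norm (w - z)" using e w by (simp add: field_simps)
          finally show ?thesis unfolding dist_norm diff_0_right norm_scaleR using w by (simp add: divide_less_eq)
        qed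
        then show "\<exists>s>0. \<forall>x. x \<noteq> z \<and> dist x z < s \<longrightarrow>
            dist ((1 / norm (x - z)) *\<^sub>R (F x - (F z + f z * (x - z)))) 0 < e" using d0 by blast
      qed
    qed
    then have "F holomorphic_on ?B"
      using holomorphic_on_open[OF open_box] by blast
    then have "deriv F holomorphic_on ?B" by (rule holomorphic_deriv[OF _ open_box])
    then show ?thesis
      by (rule holomorphic_transform) (use der DERIV_imp_deriv in blast)
  qed (simp add: holomorphic_on_def)
qed

section \<open>Removability of Lipschitz curves and of simple paths\<close>

text \<open>Holomorphy is local, so boxes inside \<open>S\<close> suffice; there continuity across
  the curve makes all rectangle integrals vanish and Morera's theorem applies.\<close>

lemma holomorphic_on_removable_Lipschitz_curve:
  fixes g :: "real \<Rightarrow> complex"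
  assumes "open S" "a \<le> b" "0 \<le> L"
    and lip: "\<And>s t. s \<in> {a..b} \<Longrightarrow> t \<in> {a..b} \<Longrightarrow> norm (g s - g t) \<le> L * \<bar>s - t\<bar>"
    and cont: "continuous_on S f"
    and hol: "f holomorphic_on (S - g ` {a..b})"
  shows "f holomorphic_on S"
proof (rule holomorphic_on_subset[OF _ subset_refl], subst holomorphic_on_open[OF assms(1)], clarify)
  fix z assume "z \<in> S"
  then obtain p q where pq: "z \<in> box p q" "box p q \<subseteq> S"
    using open_contains_box[OF assms(1)] by metis
  have "f holomorphic_on box p q"
  proof (rule holomorphic_on_box_rect_integral)
    fix x x' y y' :: real assume "x < x'" "y < y'" "rect x x' y y' \<subseteq> box p q"
    then show "rect_integral f x x' y y' = 0"
      using pq by (intro rect_integral_removable_curve[OF _ _ assms(2,3) lip]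
          continuous_on_subset[OF cont] holomorphic_on_subset[OF hol]) auto
  qed (use cont pq continuous_on_subset in blast)
  then show "\<exists>f'. (f has_field_derivative f') (at z)"
    using pq holomorphic_on_open[OF open_box] by blast
qed

text \<open>A valid path is only piecewise C1, so Lipschitz bounds are available near points that
  are neither images of breakpoints nor endpoints. Simplicity turns closeness of parameters into
  closeness in the plane: no other part of the path returns to such a point.\<close>

lemma finite_exceptions_locally_Lipschitz_path:
  assumes "valid_path \<gamma>" "simple_path \<gamma>"
  obtains E where "finite E"
    "\<And>z. z \<in> path_image \<gamma> - E \<Longrightarrow> \<exists>r>0. \<exists>a b L. a \<le> b \<and> 0 \<le> L \<and> ball z r \<inter> path_image \<gamma> \<subseteq> \<gamma> ` {a..b} 
        \<and> (\<forall>s\<in>{a..b}. \<forall>t\<in>{a..b}. norm (\<gamma> s - \<gamma> t) \<le> L * \<bar>s - t\<bar>)"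
proof -
  have cont: "continuous_on {0..1} \<gamma>"
    using assms(2) simple_path_imp_path path_def by blast
  obtain S where S: "finite S" "\<gamma> C1_differentiable_on ({0..1} - S)"
    using assms(1) unfolding valid_path_def piecewise_C1_differentiable_on_def by blast
  then obtain D where D: "\<And>t. t \<in> {0..1} - S \<Longrightarrow> (\<gamma> has_vector_derivative D t) (at t)"
    "continuous_on ({0..1} - S) D"
    unfolding C1_differentiable_on_def by blast
  show thesis
  proof (rule that[of "\<gamma> ` (S \<union> {0,1})"])
    show "finite (\<gamma> ` (S \<union> {0,1}))" using S by simp
    fix z assume z: "z \<in> path_image \<gamma> - \<gamma> ` (S \<union> {0,1})"
    then obtain t where t: "t \<in> {0..1}" "t \<notin> S \<union> {0,1}" "z = \<gamma> t" unfolding path_image_def by blast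
    have "open ({0<..<1} - S)" using S by (intro open_Diff finite_imp_closed) auto
    moreover have "t \<in> {0<..<1} - S" using t by auto
    ultimately obtain d where d: "d > 0" "cball t d \<subseteq> {0<..<1} - S"
      unfolding open_contains_cball by blast
    define a where "a = t - d"
    define b where "b = t + d"
    have ab: "{a..b} \<subseteq> {0<..<1} - S" using d by (simp add: cball_eq_atLeastAtMost a_def b_def)
    then have ab': "{a..b} \<subseteq> {0..1} - S" by auto
    have "compact (D ` {a..b})" by (intro compact_continuous_image continuous_on_subset[OF D(2) ab']) simp
    then obtain L where L: "L > 0" "\<And>s. s \<in> {a..b} \<Longrightarrow> norm (D s) \<le> L"
      using bounded_pos[of "D ` {a..b}"] compact_imp_bounded by blast
    have lip: "norm (\<gamma> s - \<gamma> u) \<le> L * \<bar>s - u\<bar>" if su: "s \<in> {a..b}" "u \<in> {a..b}" for s u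
    proof -
      have "norm (\<gamma> s - \<gamma> u) \<le> L * norm (s - u)"
      proof (rule differentiable_bound[of "{a..b}" \<gamma> "\<lambda>s h. h *\<^sub>R D s" L s u])
        show "(\<gamma> has_derivative (\<lambda>h. h *\<^sub>R D v)) (at v within {a..b})" if "v \<in> {a..b}" for v
          using D(1)[of v] ab' that has_derivative_at_withinI unfolding has_vector_derivative_def by blast
        show "onorm (\<lambda>h. h *\<^sub>R D v) \<le> L" if "v \<in> {a..b}" for v
          by (rule onorm_le) (use mult_left_mono[OF L(2)[OF that] abs_ge_zero] in \<open>simp add: mult.commute\<close>)
      qed (use su in auto)
      then show ?thesis by simp
    qed
    \<comment> \<open>The rest of the path is compact and misses \<open>z\<close>, because
      \<open>t\<close> is an interior parameter of a simple path; hence it misses a whole ball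
      around \<open>z\<close>.\<close>
    define K where "K = \<gamma> ` ({0..1} - {a<..<b})"
    have "compact ({0..1} - {a<..<b})" by (intro compact_diff) auto
    then have "compact K" unfolding K_def
      by (intro compact_continuous_image continuous_on_subset[OF cont]) auto
    moreover have "z \<notin> K"
    proof
      assume "z \<in> K"
      then obtain u where u: "u \<in> {0..1}" "u \<notin> {a<..<b}" "\<gamma> t = \<gamma> u" using t by (auto simp: K_def)
      have "t = u" using assms(2) u t unfolding simple_path_def loop_free_def by blast
      then show False using u d by (auto simp: a_def b_def)
    qed
    ultimately have "z \<in> - K" "open (- K)" by (auto simp: compact_imp_closed open_Compl)
    then obtain r where r: "r > 0" "ball z r \<subseteq> - K" unfolding open_contains_ball by blast
    have "ball z r \<inter> path_image \<gamma> \<subseteq> \<gamma> ` {a..b}"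
    proof
      fix w assume w: "w \<in> ball z r \<inter> path_image \<gamma>"
      then obtain u where u: "u \<in> {0..1}" "w = \<gamma> u" by (auto simp: path_image_def)
      have "w \<notin> K" using w r by blast
      then have "u \<in> {a<..<b}" using u unfolding K_def by blast
      then show "w \<in> \<gamma> ` {a..b}" using u by auto
    qed
    moreover have "a \<le> b" "0 \<le> L" using d L by (auto simp: a_def b_def)
    ultimately show "\<exists>r>0. \<exists>a b L. a \<le> b \<and> 0 \<le> L \<and> ball z r \<inter> path_image \<gamma> \<subseteq> \<gamma> ` {a..b}
        \<and> (\<forall>s\<in>{a..b}. \<forall>t\<in>{a..b}. norm (\<gamma> s - \<gamma> t) \<le> L * \<bar>s - t\<bar>)"
      using r(1) lip by blast
  qed
qed

text \<open>The finitely many exceptional points are isolated singularities at which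
  \<open>f\<close> is continuous, hence removable.\<close>

lemma holomorphic_on_removable_path:
  assumes "open S" "valid_path \<gamma>" "simple_path \<gamma>" "continuous_on S f"
    and hol: "f holomorphic_on (S - path_image \<gamma>)"
  shows "f holomorphic_on S"
proof -
  obtain E where E: "finite E"
    "\<And>z. z \<in> path_image \<gamma> - E \<Longrightarrow> \<exists>r>0. \<exists>a b L. a \<le> b \<and> 0 \<le> L \<and> ball z r \<inter> path_image \<gamma> \<subseteq> \<gamma> ` {a..b} 
        \<and> (\<forall>s\<in>{a..b}. \<forall>t\<in>{a..b}. norm (\<gamma> s - \<gamma> t) \<le> L * \<bar>s - t\<bar>)"
    using finite_exceptions_locally_Lipschitz_path[OF assms(2,3)] by metis
  have clP: "closed (path_image \<gamma>)" using assms(2) closed_valid_path_image by blast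
  have "\<exists>f'. (f has_field_derivative f') (at z)" if z: "z \<in> S - E" for z
  proof (cases "z \<in> path_image \<gamma>")
    case False
    have "open (S - path_image \<gamma>)" using assms clP by blast
    then show ?thesis using False z hol holomorphic_on_open by blast
  next
    case True
    with z have "z \<in> path_image \<gamma> - E" by blast
    from E(2)[OF this] obtain r a b L where r: "r > 0" "a \<le> b" "0 \<le> L" "ball z r \<inter> path_image \<gamma> \<subseteq> \<gamma> ` {a..b}"
      and lip: "\<forall>s\<in>{a..b}. \<forall>t\<in>{a..b}. norm (\<gamma> s - \<gamma> t) \<le> L * \<bar>s - t\<bar>"
      by blast
    have op: "open (ball z r \<inter> S)" using assms by blast
    have "f holomorphic_on (ball z r \<inter> S)"
      by (rule holomorphic_on_removable_Lipschitz_curve[OF op r(2,3), of \<gamma>])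
        (use r lip in \<open>auto intro!: continuous_on_subset[OF assms(4)] holomorphic_on_subset[OF hol]\<close>)
    then show ?thesis using z r holomorphic_on_open[OF op] by auto
  qed
  moreover have "open (S - E)" using assms E by (simp add: finite_imp_closed open_Diff)
  ultimately have "f holomorphic_on (S - E)" using holomorphic_on_open by blast
  then show ?thesis using no_isolated_singularity assms E by blast
qed

text \<open>Pointwise limits suffice because the extension by limits is automatically continuous:
  its value at a nearby curve point is itself a limit of nearby values off the curve, and so
  inherits their bounds. This is what allows \<open>has_jump\<close> to be stated point by
  point.\<close>

lemma holomorphic_extension_across_path:
  assumes "open S" "valid_path \<gamma>" "simple_path \<gamma>" 
    and hol: "f holomorphic_on (S - path_image \<gamma>)"
    and lim: "\<And>z. z \<in> S \<inter> path_image \<gamma> \<Longrightarrow> z islimpt (- path_image \<gamma>) \<and> (\<exists>l. (f \<longlongrightarrow> l) (at z within - path_image \<gamma>))"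
  obtains F where "F holomorphic_on S" "\<And>z. z \<in> S - path_image \<gamma> \<Longrightarrow> F z = f z"
proof -
  let ?P = "path_image \<gamma>"
  have clP: "closed ?P" using assms(2) closed_valid_path_image by blast
  define F where "F z = (if z \<in> ?P then Lim (at z within - ?P) f else f z)" for z
  have limF: "(f \<longlongrightarrow> F z) (at z within - ?P)" "at z within - ?P \<noteq> bot" if zi: "z \<in> S \<inter> ?P" for z
  proof -
    show nb: "at z within - ?P \<noteq> bot" using lim[OF zi] by (simp add: trivial_limit_within)
    obtain l where l: "(f \<longlongrightarrow> l) (at z within - ?P)" using lim[OF zi] by blast
    then have "F z = l" using tendsto_Lim[OF nb l] zi by (simp add: F_def)
    with l show "(f \<longlongrightarrow> F z) (at z within - ?P)" by simp
  qed
  have op: "open (S - ?P)" using assms clP by blast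
  have holF: "F holomorphic_on (S - ?P)"
    by (rule holomorphic_transform[OF hol]) (simp add: F_def)
  have "isCont F z" if z: "z \<in> S" for z
  proof (cases "z \<in> ?P")
    case False
    then show ?thesis
      using holomorphic_on_imp_continuous_on[OF holF] z op by (simp add: continuous_on_eq_continuous_at)
  next
    case True
    show ?thesis unfolding continuous_at_eps_delta
    proof (intro allI impI)
      fix e :: real assume e: "e > 0"
      have "eventually (\<lambda>w. dist (f w) (F z) < e / 2) (at z within - ?P)"
        using limF(1) True z e by (intro tendstoD) auto
      then obtain d1 where d1: "d1 > 0" "\<And>w. w \<in> - ?P \<Longrightarrow> w \<noteq> z \<Longrightarrow> dist w z < d1 \<Longrightarrow> dist (f w) (F z) < e / 2"
        unfolding eventually_at by blast
      obtain d2 where d2: "d2 > 0" "ball z d2 \<subseteq> S" using assms(1) z open_contains_ball by blast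
      have "dist (F w) (F z) < e" if w: "dist w z < min d1 d2" for w
      proof (cases "w \<in> ?P")
        case False
        then show ?thesis using d1(2)[of w] w True e by (force simp: F_def)
      next
        case wP: True
        then have wS: "w \<in> S \<inter> ?P" using w d2 by (auto simp: dist_commute)
        have "dist (f u) (F z) \<le> e / 2" if "u \<in> ball z d1" "u \<in> - ?P" for u
          using d1(2)[of u] that True by (fastforce simp: dist_commute)
        moreover have "w \<in> ball z d1" using w by (simp add: dist_commute)
        ultimately have "eventually (\<lambda>u. dist (f u) (F z) \<le> e / 2) (at w within - ?P)"
          unfolding eventually_at_topological using open_ball by blast
        then have "dist (F w) (F z) \<le> e / 2"
          using tendsto_upperbound[OF tendsto_dist[OF limF(1)[OF wS] tendsto_const]] limF(2)[OF wS] by blast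
        then show ?thesis using e by simp
      qed
      then show "\<exists>d>0. \<forall>x'. dist x' z < d \<longrightarrow> dist (F x') (F z) < e"
        using d1 d2 by (intro exI[of _ "min d1 d2"]) auto
    qed
  qed
  then have "continuous_on S F" by (simp add: continuous_at_imp_continuous_on)
  then have "F holomorphic_on S" by (rule holomorphic_on_removable_path[OF assms(1-3) _ holF])
  then show thesis using that by (simp add: F_def)
qed

subsection \<open>Positive Cauchy systems and their discretisations\<close>

lemma cauchy_kernel_nonneg:
  fixes s d :: "'a \<Rightarrow> real"
  assumes "finite J" "\<And>j. j \<in> J \<Longrightarrow> 0 < s j"
  shows "0 \<le> (\<Sum>j\<in>J. \<Sum>k\<in>J. d j * d k / (s j + s k))"
proof -
  define E where "E T = (\<Sum>j\<in>J. \<Sum>k\<in>J. d j * d k * (1 - exp (- (s j + s k) * T)) / (s j + s k))" for T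
  have pos: "0 < s j + s k" if "j \<in> J" "k \<in> J" for j k
    using assms(2)[OF that(1)] assms(2)[OF that(2)] by simp
  \<comment> \<open>\<open>1 / (s + t)\<close> is the Gram kernel \<open>\<integral> e\<^sup>-\<^sup>s\<^sup>u e\<^sup>-\<^sup>t\<^sup>u du\<close>; \<open>E T\<close> is the quadratic form truncated to \<open>u \<le> T\<close>.\<close>
  have "(E has_real_derivative (\<Sum>j\<in>J. d j * exp (- s j * T))\<^sup>2) (at T)" for T
  proof -
    have "(E has_real_derivative (\<Sum>j\<in>J. \<Sum>k\<in>J. (d j * exp (- s j * T)) * (d k * exp (- s k * T)))) (at T)"
      unfolding E_def
    proof (intro DERIV_sum)
      fix j k assume jk: "j \<in> J" "k \<in> J"
      define p where "p = s j + s k"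
      have "p > 0" "exp (- p * T) = exp (- s j * T) * exp (- s k * T)"
        using pos[OF jk] by (auto simp: p_def exp_add[symmetric] algebra_simps)
      moreover have "((\<lambda>T. (d j * d k / p) * (1 - exp (- p * T))) has_real_derivative (d j * d k / p) * (p * exp (- p * T))) (at T)"
        by (auto intro!: derivative_eq_intros)
      ultimately show "((\<lambda>T. d j * d k * (1 - exp (- (s j + s k) * T)) / (s j + s k)) has_real_derivative
          (d j * exp (- s j * T)) * (d k * exp (- s k * T))) (at T)"
        unfolding p_def[symmetric] by (simp add: mult_ac)
    qed
    then show ?thesis by (simp add: power2_eq_square sum_product)
  qed
  note der = this
  have "E 0 \<le> E T" if "0 \<le> T" for T
  proof (rule DERIV_nonneg_imp_nondecreasing[OF that])
    fix x
    show "\<exists>y. (E has_real_derivative y) (at x) \<and> 0 \<le> y"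
      using der[of x] zero_le_power2 by blast
  qed
  then have "0 \<le> E T" if "0 \<le> T" for T using that by (simp add: E_def)
  then have ev: "eventually (\<lambda>T. 0 \<le> E T) at_top" by (rule eventually_mono[OF eventually_ge_at_top])
  have "(E \<longlongrightarrow> (\<Sum>j\<in>J. \<Sum>k\<in>J. d j * d k * (1 - 0) / (s j + s k))) at_top"
    unfolding E_def
  proof (intro tendsto_sum)
    fix j k assume jk: "j \<in> J" "k \<in> J"
    have "((\<lambda>T. exp (- (s j + s k) * T)) \<longlongrightarrow> 0) at_top"
      using pos[OF jk] by (intro filterlim_compose[OF exp_at_bot] filterlim_tendsto_neg_mult_at_bot[OF tendsto_const] filterlim_ident) auto
    then show "((\<lambda>T. d j * d k * (1 - exp (- (s j + s k) * T)) / (s j + s k)) \<longlongrightarrow> d j * d k * (1 - 0) / (s j + s k)) at_top"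
      using pos[OF jk] by (intro tendsto_intros) auto
  qed
  then show ?thesis using tendsto_lowerbound[OF _ ev] by simp
qed

text \<open>Pairing the system with \<open>w * d\<close> turns the kernel term into the nonnegative
  form at \<open>w * d\<close>, so \<open>e\<close> controls the weighted l2 norm of
  \<open>d\<close>. This yields a weighted l1 bound, which the system itself converts into a
  pointwise one. The constant involves only the total weight and \<open>a\<close>, not the number of
  unknowns.\<close>

lemma cauchy_system_stable_real:
  fixes s w d e :: "'a \<Rightarrow> real"
  assumes "finite J" "0 < a" "\<And>j. j \<in> J \<Longrightarrow> a \<le> s j" "\<And>j. j \<in> J \<Longrightarrow> 0 \<le> w j"
    and eq: "\<And>j. j \<in> J \<Longrightarrow> d j + (\<Sum>k\<in>J. w k * d k / (s j + s k)) = e j"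
    and e: "\<And>j. j \<in> J \<Longrightarrow> \<bar>e j\<bar> \<le> E" and "0 < E" and "j \<in> J"
  shows "\<bar>d j\<bar> \<le> (1 + (\<Sum>k\<in>J. w k) / (2 * a)) * E"
proof -
  let ?W = "\<Sum>k\<in>J. w k"
  have "(\<Sum>j\<in>J. w j * d j * e j) = (\<Sum>j\<in>J. w j * d j * (d j + (\<Sum>k\<in>J. w k * d k / (s j + s k))))"
    by (intro sum.cong refl) (simp add: eq)
  also have "\<dots> = (\<Sum>j\<in>J. w j * (d j)\<^sup>2) + (\<Sum>j\<in>J. \<Sum>k\<in>J. (w j * d j) * (w k * d k) / (s j + s k))"
    by (simp add: ring_distribs sum.distrib sum_distrib_left power2_eq_square mult.assoc)
  finally have "(\<Sum>j\<in>J. w j * (d j)\<^sup>2) \<le> (\<Sum>j\<in>J. w j * d j * e j)"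
    using cauchy_kernel_nonneg[OF assms(1), of s "\<lambda>j. w j * d j"] assms(2,3) by fastforce
  \<comment> \<open>Young's inequality, so that half of the quadratic sum can be absorbed on the
    left.\<close>
  also have "\<dots> \<le> (\<Sum>j\<in>J. w j * (d j)\<^sup>2 / 2 + w j * E\<^sup>2 / 2)"
  proof (rule sum_mono)
    fix j assume j: "j \<in> J"
    have "(e j)\<^sup>2 \<le> E\<^sup>2" using e[OF j] abs_le_square_iff[of "e j" E] by simp
    moreover have "0 \<le> (d j - e j)\<^sup>2" by simp
    ultimately have "d j * e j \<le> (d j)\<^sup>2 / 2 + E\<^sup>2 / 2" by (simp add: power2_diff)
    then have "w j * (d j * e j) \<le> w j * ((d j)\<^sup>2 / 2 + E\<^sup>2 / 2)" using assms(4)[OF j] by (rule mult_left_mono)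
    then show "w j * d j * e j \<le> w j * (d j)\<^sup>2 / 2 + w j * E\<^sup>2 / 2" by (simp add: algebra_simps)
  qed
  also have "\<dots> = (\<Sum>j\<in>J. w j * (d j)\<^sup>2) / 2 + ?W * E\<^sup>2 / 2"
    by (simp add: sum.distrib sum_divide_distrib sum_distrib_right)
  finally have L2: "(\<Sum>j\<in>J. w j * (d j)\<^sup>2) \<le> ?W * E\<^sup>2" by simp
  \<comment> \<open>Passage from l2 to l1 through
    \<open>0 \<le> (\<bar>d k\<bar> - E)\<^sup>2\<close>; the common factor \<open>2 * E\<close> is
    cancelled at the end, which uses \<open>0 < E\<close>.\<close>
  have "2 * E * (\<Sum>k\<in>J. w k * \<bar>d k\<bar>) \<le> (\<Sum>k\<in>J. w k * (d k)\<^sup>2 + w k * E\<^sup>2)"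
    unfolding sum_distrib_left
  proof (rule sum_mono)
    fix k assume k: "k \<in> J"
    have "0 \<le> (\<bar>d k\<bar> - E)\<^sup>2" by simp
    then have "2 * E * \<bar>d k\<bar> \<le> (d k)\<^sup>2 + E\<^sup>2" by (simp add: power2_diff mult_ac)
    then have "w k * (2 * E * \<bar>d k\<bar>) \<le> w k * ((d k)\<^sup>2 + E\<^sup>2)" using assms(4)[OF k] by (rule mult_left_mono)
    then show "2 * E * (w k * \<bar>d k\<bar>) \<le> w k * (d k)\<^sup>2 + w k * E\<^sup>2" by (simp add: algebra_simps)
  qed
  also have "\<dots> \<le> ?W * E\<^sup>2 + ?W * E\<^sup>2"
    using L2 by (simp add: sum.distrib sum_distrib_right)
  also have "\<dots> = 2 * E * (?W * E)" by (simp add: power2_eq_square)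
  finally have L1: "(\<Sum>k\<in>J. w k * \<bar>d k\<bar>) \<le> ?W * E" using \<open>0 < E\<close> by simp
  have "\<bar>\<Sum>k\<in>J. w k * d k / (s j + s k)\<bar> \<le> (\<Sum>k\<in>J. w k * \<bar>d k\<bar> / (2 * a))"
  proof (rule order.trans[OF sum_abs sum_mono])
    fix k assume k: "k \<in> J"
    have "2 * a \<le> s j + s k" using assms(3)[OF k] assms(3)[OF \<open>j \<in> J\<close>] by simp
    then show "\<bar>w k * d k / (s j + s k)\<bar> \<le> w k * \<bar>d k\<bar> / (2 * a)"
      using assms(2) assms(4)[OF k] by (auto simp: abs_mult intro!: divide_left_mono)
  qed
  also have "\<dots> \<le> ?W * E / (2 * a)"
    using L1 assms(2) by (simp add: sum_divide_distrib[symmetric] divide_right_mono)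
  finally have "\<bar>d j\<bar> \<le> E + ?W * E / (2 * a)"
    using eq[OF \<open>j \<in> J\<close>] e[OF \<open>j \<in> J\<close>] by linarith
  then show ?thesis by (simp add: algebra_simps)
qed

text \<open>Weights and kernel are real, so real and imaginary parts solve separate real systems;
  the factor 2 comes from adding their bounds.\<close>

lemma cauchy_system_stable:
  fixes s w :: "'a \<Rightarrow> real" and d e :: "'a \<Rightarrow> complex"
  assumes "finite J" "0 < a" "\<And>j. j \<in> J \<Longrightarrow> a \<le> s j" "\<And>j. j \<in> J \<Longrightarrow> 0 \<le> w j"
    and eq: "\<And>j. j \<in> J \<Longrightarrow> d j + (\<Sum>k\<in>J. of_real (w k) * d k / of_real (s j + s k)) = e j"
    and e: "\<And>j. j \<in> J \<Longrightarrow> norm (e j) \<le> E" and "0 < E" and "j \<in> J"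
  shows "norm (d j) \<le> 2 * (1 + (\<Sum>k\<in>J. w k) / (2 * a)) * E"
proof -
  have "\<bar>Re (d j)\<bar> \<le> (1 + (\<Sum>k\<in>J. w k) / (2 * a)) * E"
  proof (rule cauchy_system_stable_real[where s = s and e = "\<lambda>j. Re (e j)", OF assms(1-4)])
    show "Re (d j) + (\<Sum>k\<in>J. w k * Re (d k) / (s j + s k)) = Re (e j)" if "j \<in> J" for j
      using arg_cong[OF eq[OF that], of Re] by (simp add: Re_divide_of_real flip: of_real_add)
    show "\<bar>Re (e j)\<bar> \<le> E" if "j \<in> J" for j using e[OF that] abs_Re_le_cmod order.trans by blast
  qed (use assms in auto)
  moreover have "\<bar>Im (d j)\<bar> \<le> (1 + (\<Sum>k\<in>J. w k) / (2 * a)) * E"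
  proof (rule cauchy_system_stable_real[where s = s and e = "\<lambda>j. Im (e j)", OF assms(1-4)])
    show "Im (d j) + (\<Sum>k\<in>J. w k * Im (d k) / (s j + s k)) = Im (e j)" if "j \<in> J" for j
      using arg_cong[OF eq[OF that], of Im] by (simp add: Im_divide_of_real flip: of_real_add)
    show "\<bar>Im (e j)\<bar> \<le> E" if "j \<in> J" for j using e[OF that] abs_Im_le_cmod order.trans by blast
  qed (use assms in auto)
  ultimately show ?thesis using cmod_le[of "d j"] by linarith
qed

section \<open>Riemann sums at right endpoints and their uniform limits\<close>

text \<open>For \<open>j = 1..N\<close> these are the right endpoints of a uniform partition and the
  imaginary parts of the numbers \<open>soliton_pole\<close>; index 0 gives \<open>a\<close>
  itself.\<close>

definition riemann_node :: "real \<Rightarrow> real \<Rightarrow> nat \<Rightarrow> nat \<Rightarrow> real" where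
  "riemann_node a b N j = a + real j / real N * (b - a)"

definition riemann_sum :: "real \<Rightarrow> real \<Rightarrow> nat \<Rightarrow> (real \<Rightarrow> complex) \<Rightarrow> complex" where
  "riemann_sum a b N f = (\<Sum>j=1..N. of_real ((b - a) / real N) * f (riemann_node a b N j))"

lemma riemann_node_in: "a \<le> b \<Longrightarrow> j \<le> N \<Longrightarrow> riemann_node a b N j \<in> {a..b}"
proof -
  assume "a \<le> b" "j \<le> N"
  moreover have "real j / real N \<le> 1" using \<open>j \<le> N\<close> by (cases "N = 0") (auto simp: divide_le_eq_1)
  ultimately have "0 \<le> real j / real N * (b - a)" "real j / real N * (b - a) \<le> 1 * (b - a)"
    using mult_right_mono[of "real j / real N" 1 "b - a"] by auto
  then show ?thesis by (simp add: riemann_node_def)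
qed

lemma norm_riemann_sum_le:
  assumes "a \<le> b" "0 \<le> B" "\<And>j. j \<in> {1..N} \<Longrightarrow> norm (f (riemann_node a b N j)) \<le> B"
  shows "norm (riemann_sum a b N f) \<le> (b - a) * B"
proof -
  have "norm (riemann_sum a b N f) \<le> (\<Sum>j=1..N. (b - a) / real N * B)"
    unfolding riemann_sum_def
    by (intro sum_norm_le, unfold norm_mult norm_of_real) (use assms in \<open>auto intro!: mult_mono divide_right_mono\<close>)
  also have "\<dots> \<le> (b - a) * B" using assms by simp
  finally show ?thesis .
qed

lemma riemann_sum_cong:
  "a \<le> b \<Longrightarrow> (\<And>t. t \<in> {a..b} \<Longrightarrow> f t = g t) \<Longrightarrow> riemann_sum a b N f = riemann_sum a b N g"
  unfolding riemann_sum_def by (intro sum.cong refl) (simp add: riemann_node_in[unfolded atLeastAtMost_iff])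

lemma riemann_sum_diff: "riemann_sum a b N (\<lambda>t. f t - g t) = riemann_sum a b N f - riemann_sum a b N g"
  by (simp add: riemann_sum_def sum_subtractf ring_distribs)

lemma riemann_sum_add: "riemann_sum a b N (\<lambda>t. f t + g t) = riemann_sum a b N f + riemann_sum a b N g"
  by (simp add: riemann_sum_def sum.distrib ring_distribs)

lemma riemann_sum_cmult: "riemann_sum a b N (\<lambda>t. c * f t) = c * riemann_sum a b N f"
  by (simp add: riemann_sum_def sum_distrib_left mult_ac)

text \<open>Uniformity in \<open>z\<close> comes from uniform continuity on the compact product: one
  mesh width serves all parameters.\<close>

lemma riemann_sum_uniform_limit:
  fixes F :: "'a::metric_space \<Rightarrow> real \<Rightarrow> complex"
  assumes "a \<le> b" "compact K" and cont: "continuous_on (K \<times> {a..b}) (\<lambda>(z, t). F z t)"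
  shows "uniform_limit K (\<lambda>N z. riemann_sum a b N (F z)) (\<lambda>z. integral {a..b} (F z)) sequentially"
proof (rule uniform_limitI)
  fix e :: real assume e: "e > 0"
  \<comment> \<open>The \<open>+ 1\<close> covers \<open>a = b\<close> and makes
    \<open>e' * (b - a) < e\<close> strict.\<close>
  define e' where "e' = e / (b - a + 1)"
  have e': "e' > 0" "e' * (b - a) < e" using e assms(1) by (auto simp: e'_def field_simps)
  have "uniformly_continuous_on (K \<times> {a..b}) (\<lambda>(z, t). F z t)"
    by (intro compact_uniformly_continuous cont compact_Times assms) simp
  then obtain d where d: "d > 0" and d': "\<And>p q. p \<in> K \<times> {a..b} \<Longrightarrow> q \<in> K \<times> {a..b} \<Longrightarrow> dist p q < d
      \<Longrightarrow> dist (case p of (z, t) \<Rightarrow> F z t) (case q of (z, t) \<Rightarrow> F z t) < e'"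
    using e'(1) unfolding uniformly_continuous_on_def by meson
  have near: "norm (F z t - F z t') < e'" if "z \<in> K" "t \<in> {a..b}" "t' \<in> {a..b}" "\<bar>t - t'\<bar> < d" for z t t'
    using d'[of "(z, t)" "(z, t')"] that by (simp add: dist_Pair_Pair dist_norm)
  obtain N0 :: nat where N0: "real N0 > (b - a) / d" using reals_Archimedean2 by blast
  have "dist (riemann_sum a b N (F z)) (integral {a..b} (F z)) < e" if N: "N \<ge> max 1 N0" and z: "z \<in> K" for N z
  proof -
    define x where "x = riemann_node a b N"
    have N1: "N > 0" "real N > (b - a) / d" using N N0 by auto
    have x0: "x 0 = a" "x N = b" using N1 by (auto simp: x_def riemann_node_def)
    have xs: "x (Suc j) - x j = (b - a) / real N" for j
      using N1 by (simp add: x_def riemann_node_def field_simps)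
    have xm: "x j \<le> x (Suc j)" for j using xs[of j] assms(1) N1 by (simp add: algebra_simps)
    have xin: "x j \<in> {a..b}" if "j \<le> N" for j using riemann_node_in[OF assms(1) that] by (simp add: x_def)
    have small: "(b - a) / real N < d" using N1 d by (simp add: field_simps)
    have cz: "continuous_on {a..b} (F z)"
    proof -
      have "continuous_on {a..b} (\<lambda>t. (z, t))" by (rule continuous_on_Pair[OF continuous_on_const continuous_on_id])
      from continuous_on_compose2[OF cont this] show ?thesis using z by auto
    qed
    have int: "F z integrable_on {u..v}" if "a \<le> u" "v \<le> b" for u v
      using that by (intro integrable_continuous_real continuous_on_subset[OF cz]) auto
    have sum: "integral {a..x n} (F z) = (\<Sum>j<n. integral {x j..x (Suc j)} (F z))" if "n \<le> N" for n
      using that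
    proof (induction n)
      case 0
      then show ?case by (simp add: x0)
    next
      case (Suc n)
      have "integral {a..x n} (F z) + integral {x n..x (Suc n)} (F z) = integral {a..x (Suc n)} (F z)"
        using xin[of n] xin[of "Suc n"] Suc.prems xm[of n] by (intro Henstock_Kurzweil_Integration.integral_combine int) auto
      then show ?case using Suc by simp
    qed
    \<comment> \<open>Shifted to start at 0, so that the sample with index \<open>j\<close> is the
      right endpoint of the subinterval from \<open>x j\<close> to \<open>x (Suc j)\<close>.\<close>
    have rs: "riemann_sum a b N (F z) = (\<Sum>j<N. of_real ((b - a) / real N) * F z (x (Suc j)))"
      unfolding riemann_sum_def x_def by (rule sum.reindex_bij_witness[of _ Suc "\<lambda>j. j - 1"]) auto
    have "norm (riemann_sum a b N (F z) - integral {a..b} (F z)) \<le>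
       (\<Sum>j<N. norm (of_real ((b - a) / real N) * F z (x (Suc j)) - integral {x j..x (Suc j)} (F z)))"
      using sum[of N] unfolding x0 rs by (simp add: sum_subtractf[symmetric] norm_sum)
    also have "\<dots> \<le> (\<Sum>j<N. e' * ((b - a) / real N))"
    proof (rule sum_mono)
      fix j assume "j \<in> {..<N}"
      then have j: "x j \<in> {a..b}" "x (Suc j) \<in> {a..b}" using xin by auto
      have "norm (integral {x j..x (Suc j)} (\<lambda>t. F z (x (Suc j)) - F z t)) \<le> e' * (x (Suc j) - x j)"
      proof (rule integral_bound[OF xm])
        show "continuous_on {x j..x (Suc j)} (\<lambda>t. F z (x (Suc j)) - F z t)"
          using j by (intro continuous_intros continuous_on_subset[OF cz]) auto
        show "norm (F z (x (Suc j)) - F z t) \<le> e'" if t: "t \<in> {x j..x (Suc j)}" for t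
          by (rule less_imp_le, rule near[OF z]) (use t j small xs[of j] in auto)
      qed
      also have "integral {x j..x (Suc j)} (\<lambda>t. F z (x (Suc j)) - F z t) =
          of_real ((b - a) / real N) * F z (x (Suc j)) - integral {x j..x (Suc j)} (F z)"
        using j int xm[of j] xs[of j] by (subst integral_diff) (auto simp: scaleR_conv_of_real)
      finally show "norm (of_real ((b - a) / real N) * F z (x (Suc j)) - integral {x j..x (Suc j)} (F z)) \<le> e' * ((b - a) / real N)"
        by (simp add: xs)
    qed
    also have "\<dots> = e' * (b - a)" using N1 by simp
    also have "\<dots> < e" by (rule e')
    finally show ?thesis by (simp add: dist_norm)
  qed
  then show "eventually (\<lambda>N. \<forall>z\<in>K. dist (riemann_sum a b N (F z)) (integral {a..b} (F z)) < e) sequentially"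
    unfolding eventually_sequentially by blast
qed

text \<open>The integrand may itself depend on \<open>N\<close>: a Riemann sum is at most
  \<open>b - a\<close> times the supremum of its integrand, so a uniformly small change of the
  integrand is harmless.\<close>

lemma riemann_sum_uniform_limit':
  fixes F :: "'a::metric_space \<Rightarrow> real \<Rightarrow> complex"
  assumes "a \<le> b" "compact K" and cont: "continuous_on (K \<times> {a..b}) (\<lambda>(z, t). F z t)"
    and lim: "uniform_limit (K \<times> {a..b}) (\<lambda>N (z, t). G N z t) (\<lambda>(z, t). F z t) sequentially"
  shows "uniform_limit K (\<lambda>N z. riemann_sum a b N (G N z)) (\<lambda>z. integral {a..b} (F z)) sequentially"
proof -
  have "uniform_limit K (\<lambda>N z. riemann_sum a b N (\<lambda>t. G N z t - F z t)) (\<lambda>z. 0) sequentially"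
  proof (rule uniform_limitI)
    fix e :: real assume e: "e > 0"
    define e' where "e' = e / (b - a + 1)"
    have e': "e' > 0" "(b - a) * e' < e" using e assms(1) by (auto simp: e'_def field_simps)
    have "eventually (\<lambda>N. \<forall>p\<in>K \<times> {a..b}. dist (case p of (z, t) \<Rightarrow> G N z t) (case p of (z, t) \<Rightarrow> F z t) < e') sequentially"
      using uniform_limitD[OF lim e'(1)] by (simp add: case_prod_unfold)
    then show "eventually (\<lambda>N. \<forall>z\<in>K. dist (riemann_sum a b N (\<lambda>t. G N z t - F z t)) 0 < e) sequentially"
    proof (rule eventually_mono, intro ballI)
      fix N z assume H: "\<forall>p\<in>K \<times> {a..b}. dist (case p of (z, t) \<Rightarrow> G N z t) (case p of (z, t) \<Rightarrow> F z t) < e'" and z: "z \<in> K"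
      have "norm (riemann_sum a b N (\<lambda>t. G N z t - F z t)) \<le> (b - a) * e'"
      proof (rule norm_riemann_sum_le[OF assms(1) less_imp_le[OF e'(1)]])
        fix j assume "j \<in> {1..N}"
        then have "riemann_node a b N j \<in> {a..b}" using riemann_node_in[OF assms(1)] by simp
        then show "norm (G N z (riemann_node a b N j) - F z (riemann_node a b N j)) \<le> e'"
          using H z by (auto simp: dist_norm intro: less_imp_le)
      qed
      then show "dist (riemann_sum a b N (\<lambda>t. G N z t - F z t)) 0 < e" using e' by (simp add: dist_norm)
    qed
  qed
  from uniform_limit_add[OF this riemann_sum_uniform_limit[OF assms(1-3)]]
  show ?thesis by (simp add: riemann_sum_diff)
qed

section \<open>Stability and convergence of the discretised integral equation\<close>

lemma integral_continuous_pos_denominator: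
  assumes "0 < a" "continuous_on {a..b} f"
  shows "continuous_on ({a..b} \<times> {a..b}) (\<lambda>(s, t). f t / of_real (s + t) :: complex)"
  unfolding case_prod_unfold
  by (intro continuous_intros continuous_on_compose2[OF assms(2)])
    (use assms(1) in \<open>auto simp flip: of_real_add\<close>)

text \<open>At the nodes the equation is a finite Cauchy system of total weight at most
  \<open>(b - a) * R\<close>, whatever \<open>N\<close> is, so the bound there does not depend on
  \<open>N\<close>. The equation then expresses \<open>d s\<close> at every other \<open>s\<close>
  through the node values.\<close>

lemma nystrom_stable:
  assumes "0 < a" "a \<le> b" "1 \<le> N" "\<And>t. t \<in> {a..b} \<Longrightarrow> 0 \<le> \<rho> t" "\<And>t. t \<in> {a..b} \<Longrightarrow> \<rho> t \<le> R" "0 \<le> R"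
    and eq: "\<And>s. s \<in> {a..b} \<Longrightarrow> d s + riemann_sum a b N (\<lambda>t. of_real (\<rho> t) * d t / of_real (s + t)) = e s"
    and e: "\<And>s. s \<in> {a..b} \<Longrightarrow> norm (e s) \<le> E" and "0 < E"
    and s: "s \<in> {a..b}"
  shows "norm (d s) \<le> (1 + (b - a) * R * (1 + (b - a) * R / (2 * a)) / a) * E"
proof -
  let ?C = "1 + (b - a) * R / (2 * a)"
  let ?x = "riemann_node a b N"
  define w where "w j = (b - a) / real N * \<rho> (?x j)" for j
  have xin: "?x j \<in> {a..b}" if "j \<in> {1..N}" for j using riemann_node_in[of a b j N] assms(2) that by auto
  have rsum: "riemann_sum a b N (\<lambda>t. of_real (\<rho> t) * d t / of_real (s + t)) =
      (\<Sum>k\<in>{1..N}. of_real (w k) * d (?x k) / of_real (s + ?x k))" for s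
    unfolding riemann_sum_def w_def by (intro sum.cong refl) (simp add: mult_ac)
  have W: "(\<Sum>k\<in>{1..N}. w k) \<le> (b - a) * R"
  proof -
    have "(\<Sum>k\<in>{1..N}. w k) \<le> (\<Sum>k\<in>{1..N}. (b - a) / real N * R)"
      unfolding w_def using assms xin by (intro sum_mono mult_left_mono) auto
    then show ?thesis using assms by simp
  qed
  have node: "norm (d (?x j)) \<le> 2 * ?C * E" if j: "j \<in> {1..N}" for j
  proof -
    have "norm (d (?x j)) \<le> 2 * (1 + (\<Sum>k\<in>{1..N}. w k) / (2 * a)) * E"
    proof (rule cauchy_system_stable[where s = ?x and e = "\<lambda>j. e (?x j)"])
      show "d (?x j) + (\<Sum>k\<in>{1..N}. of_real (w k) * d (?x k) / of_real (?x j + ?x k)) = e (?x j)"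
        if "j \<in> {1..N}" for j using eq[OF xin[OF that]] by (simp only: rsum)
      show "0 \<le> w j" if "j \<in> {1..N}" for j using assms xin[OF that] by (auto simp: w_def)
    qed (use assms xin e j in auto)
    also have "\<dots> \<le> 2 * ?C * E"
      using W assms by (intro mult_right_mono mult_left_mono add_left_mono divide_right_mono) auto
    finally show ?thesis .
  qed
  have "norm (riemann_sum a b N (\<lambda>t. of_real (\<rho> t) * d t / of_real (s + t))) \<le> (b - a) * (R * (2 * ?C * E) / (2 * a))"
  proof (rule norm_riemann_sum_le[OF assms(2)])
    fix j assume j: "j \<in> {1..N}"
    have "2 * a \<le> s + ?x j" using s xin[OF j] by auto
    then show "norm (of_real (\<rho> (?x j)) * d (?x j) / of_real (s + ?x j)) \<le> R * (2 * ?C * E) / (2 * a)"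
      unfolding norm_divide norm_mult norm_of_real
      using node[OF j] assms xin[OF j] by (intro frac_le mult_mono) auto
  qed (use assms in auto)
  then have "norm (d s) \<le> E + (b - a) * (R * (2 * ?C * E) / (2 * a))"
    using eq[OF s] e[OF s] norm_triangle_ineq4[of "e s" "riemann_sum a b N (\<lambda>t. of_real (\<rho> t) * d t / of_real (s + t))"]
    by (simp add: eq_diff_eq[symmetric])
  also have "\<dots> = (1 + (b - a) * R * ?C / a) * E" using assms(1) by (simp add: field_simps)
  finally show ?thesis .
qed

text \<open>The error \<open>\<phi> - \<psi> N\<close> solves the discrete equation with the
  quadrature error of the continuous one on the right-hand side. That quadrature error tends to zero
  uniformly, and stability passes this on.\<close>

lemma nystrom_uniform_limit:
  assumes "0 < a" "a \<le> b" "continuous_on {a..b} \<rho>" "\<And>t. t \<in> {a..b} \<Longrightarrow> 0 \<le> \<rho> t"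
    and cont: "continuous_on {a..b} \<phi>"
    and eq: "\<And>s. s \<in> {a..b} \<Longrightarrow> \<phi> s + integral {a..b} (\<lambda>t. of_real (\<rho> t) * \<phi> t / of_real (s + t)) = 1"
    and eqN: "\<And>N s. 1 \<le> N \<Longrightarrow> s \<in> {a..b} \<Longrightarrow>
        \<psi> N s + riemann_sum a b N (\<lambda>t. of_real (\<rho> t) * \<psi> N t / of_real (s + t)) = 1"
  shows "uniform_limit {a..b} \<psi> \<phi> sequentially"
proof -
  have "bounded (\<rho> ` {a..b})" using assms(3) compact_continuous_image compact_imp_bounded by blast
  then obtain R where R: "R > 0" "\<And>t. t \<in> {a..b} \<Longrightarrow> \<bar>\<rho> t\<bar> \<le> R" unfolding bounded_pos by auto
  define C where "C = 1 + (b - a) * R * (1 + (b - a) * R / (2 * a)) / a"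
  have C: "C > 0" unfolding C_def using assms(1,2) R by (intro add_pos_nonneg) auto
  define err where "err N s = riemann_sum a b N (\<lambda>t. of_real (\<rho> t) * \<phi> t / of_real (s + t))
      - integral {a..b} (\<lambda>t. of_real (\<rho> t) * \<phi> t / of_real (s + t))" for N s
  have lim: "uniform_limit {a..b} (\<lambda>N s. riemann_sum a b N (\<lambda>t. of_real (\<rho> t) * \<phi> t / of_real (s + t)))
     (\<lambda>s. integral {a..b} (\<lambda>t. of_real (\<rho> t) * \<phi> t / of_real (s + t))) sequentially"
    by (intro riemann_sum_uniform_limit integral_continuous_pos_denominator continuous_intros assms(1-3) cont compact_Icc)
  show ?thesis
  proof (rule uniform_limitI)
    fix e :: real assume e: "e > 0"
    have "eventually (\<lambda>N. \<forall>s\<in>{a..b}. norm (err N s) < e / (2 * C)) sequentially"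
      using uniform_limitD[OF lim, of "e / (2 * C)"] e C by (simp add: err_def dist_norm)
    moreover have "eventually (\<lambda>N. 1 \<le> N) sequentially" by (rule eventually_ge_at_top)
    ultimately show "eventually (\<lambda>N. \<forall>s\<in>{a..b}. dist (\<psi> N s) (\<phi> s) < e) sequentially"
    proof (eventually_elim, intro ballI)
      fix N s assume small: "\<forall>s\<in>{a..b}. norm (err N s) < e / (2 * C)" and N: "1 \<le> N" and s: "s \<in> {a..b}"
      have "norm (\<phi> s - \<psi> N s) \<le> C * (e / (2 * C))" unfolding C_def
      proof (rule nystrom_stable[where \<rho> = \<rho> and e = "err N", OF assms(1,2) N assms(4) _ _ _ _ _ s])
        fix s assume s: "s \<in> {a..b}"
        show "\<phi> s - \<psi> N s + riemann_sum a b N (\<lambda>t. of_real (\<rho> t) * (\<phi> t - \<psi> N t) / of_real (s + t)) = err N s"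
          using eq[OF s] eqN[OF N s]
          by (simp add: err_def right_diff_distrib diff_divide_distrib riemann_sum_diff algebra_simps)
        show "norm (err N s) \<le> e / (2 * (1 + (b - a) * R * (1 + (b - a) * R / (2 * a)) / a))"
          using small s by (auto simp: C_def intro: less_imp_le)
      qed (use R e C in \<open>auto simp: C_def abs_le_iff\<close>)
      also have "\<dots> < e" using C e by simp
      finally show "dist (\<psi> N s) (\<phi> s) < e" by (simp add: dist_norm norm_minus_commute)
    qed
  qed
qed

section \<open>Dependence of the masses on the position x\<close>

text \<open>Weighting the equation for \<open>\<phi>\<close> with \<open>\<sigma> * \<psi>\<close>
  and the one for \<open>\<psi>\<close> with \<open>\<rho> * \<phi>\<close> produces the same double
  sum, because \<open>1 / (s + t)\<close> is symmetric. Only local terms remain, so a change of mass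
  is expressed without differentiating the solution of a linear system.\<close>

lemma nystrom_perturbation_identity:
  assumes "a \<le> b"
    and 1: "\<And>s. s \<in> {a..b} \<Longrightarrow> \<phi> s + riemann_sum a b N (\<lambda>t. \<rho> t * \<phi> t / of_real (s + t)) = 1"
    and 2: "\<And>s. s \<in> {a..b} \<Longrightarrow> \<psi> s + riemann_sum a b N (\<lambda>t. \<sigma> t * \<psi> t / of_real (s + t)) = 1"
  shows "riemann_sum a b N (\<lambda>t. \<sigma> t * \<psi> t) - riemann_sum a b N (\<lambda>t. \<rho> t * \<phi> t)
    = riemann_sum a b N (\<lambda>t. (\<sigma> t - \<rho> t) * \<phi> t * \<psi> t)"
proof -
  let ?S = "riemann_sum a b N"
  have "?S (\<lambda>s. \<sigma> s * \<psi> s) = ?S (\<lambda>s. \<sigma> s * \<psi> s * (\<phi> s + ?S (\<lambda>t. \<rho> t * \<phi> t / of_real (s + t))))"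
    by (rule riemann_sum_cong[OF assms(1)]) (simp add: 1 del: of_real_add)
  also have "\<dots> = ?S (\<lambda>s. \<sigma> s * \<psi> s * \<phi> s) + ?S (\<lambda>s. ?S (\<lambda>t. \<sigma> s * \<psi> s * (\<rho> t * \<phi> t) / of_real (s + t)))"
    by (simp add: ring_distribs riemann_sum_add riemann_sum_cmult[symmetric])
  finally have A: "?S (\<lambda>s. \<sigma> s * \<psi> s) = ?S (\<lambda>s. \<sigma> s * \<psi> s * \<phi> s) + ?S (\<lambda>s. ?S (\<lambda>t. \<sigma> s * \<psi> s * (\<rho> t * \<phi> t) / of_real (s + t)))" .
  have "?S (\<lambda>s. \<rho> s * \<phi> s) = ?S (\<lambda>s. \<rho> s * \<phi> s * (\<psi> s + ?S (\<lambda>t. \<sigma> t * \<psi> t / of_real (s + t))))"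
    by (rule riemann_sum_cong[OF assms(1)]) (simp add: 2 del: of_real_add)
  also have "\<dots> = ?S (\<lambda>s. \<rho> s * \<phi> s * \<psi> s) + ?S (\<lambda>s. ?S (\<lambda>t. \<rho> s * \<phi> s * (\<sigma> t * \<psi> t) / of_real (s + t)))"
    by (simp add: ring_distribs riemann_sum_add riemann_sum_cmult[symmetric])
  \<comment> \<open>Exchanging the order of summation, together with \<open>s + t = t + s\<close>,
    identifies the two double sums.\<close>
  also have "?S (\<lambda>s. ?S (\<lambda>t. \<rho> s * \<phi> s * (\<sigma> t * \<psi> t) / of_real (s + t)))
     = ?S (\<lambda>s. ?S (\<lambda>t. \<sigma> s * \<psi> s * (\<rho> t * \<phi> t) / of_real (s + t)))"
    unfolding riemann_sum_def sum_distrib_left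
    by (subst sum.swap) (simp add: mult_ac add.commute)
  finally show ?thesis
    using A by (simp add: algebra_simps riemann_sum_add riemann_sum_diff)
qed

lemma abs_exp_minus_one_le: "\<bar>exp u - 1\<bar> \<le> \<bar>u\<bar> * exp \<bar>u\<bar>" for u :: real
proof (cases "0 \<le> u")
  case True
  have "1 - u \<le> exp (- u)" using exp_ge_add_one_self[of "- u"] by simp
  then have "exp u * (1 - u) \<le> exp u * exp (- u)" by (intro mult_left_mono) auto
  then have "exp u - 1 \<le> u * exp u" by (simp add: exp_minus algebra_simps)
  with True show ?thesis by simp
next
  case False
  have "1 \<le> exp \<bar>u\<bar>" by simp
  then have "\<bar>u\<bar> * 1 \<le> \<bar>u\<bar> * exp \<bar>u\<bar>" by (rule mult_left_mono) simp
  moreover have "1 + u \<le> exp u" "exp u \<le> 1" using exp_ge_add_one_self[of u] False by auto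
  ultimately have "\<bar>exp u - 1\<bar> \<le> \<bar>u\<bar>" using False by linarith
  also have "\<dots> \<le> \<bar>u\<bar> * exp \<bar>u\<bar>" using \<open>\<bar>u\<bar> * 1 \<le> \<bar>u\<bar> * exp \<bar>u\<bar>\<close> by simp
  finally show ?thesis .
qed

lemma abs_exp_minus_one_minus_le: "\<bar>exp u - 1 - u\<bar> \<le> u\<^sup>2 * exp \<bar>u\<bar>" for u :: real
proof -
  have "1 - u \<le> exp (- u)" using exp_ge_add_one_self[of "- u"] by simp
  then have "exp u * (1 - u) \<le> exp u * exp (- u)" by (intro mult_left_mono) auto
  then have "exp u - 1 - u \<le> u * (exp u - 1)" by (simp add: exp_minus algebra_simps)
  also have "\<dots> \<le> \<bar>u\<bar> * \<bar>exp u - 1\<bar>" using abs_ge_self abs_mult by metis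
  also have "\<dots> \<le> \<bar>u\<bar> * (\<bar>u\<bar> * exp \<bar>u\<bar>)" by (intro mult_left_mono abs_exp_minus_one_le) auto
  also have "\<dots> = u\<^sup>2 * exp \<bar>u\<bar>" by (simp add: power2_eq_square)
  finally show ?thesis using exp_ge_add_one_self[of u] by linarith
qed

text \<open>Differentiability in this form passes to limits: an inequality with a fixed
  \<open>C\<close> survives pointwise convergence of \<open>f\<close> and \<open>d\<close>, whereas
  pointwise convergence alone says nothing about derivatives.\<close>

lemma has_vector_derivative_quadratic_remainder:
  fixes f :: "real \<Rightarrow> 'a::real_normed_vector"
  assumes "\<And>y. \<bar>y - x\<bar> \<le> 1 \<Longrightarrow> norm (f y - f x - (y - x) *\<^sub>R d) \<le> C * (y - x)\<^sup>2"
  shows "(f has_vector_derivative d) (at x)"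
  unfolding has_vector_derivative_def has_derivative_at2
proof (intro conjI)
  show "bounded_linear (\<lambda>h. h *\<^sub>R d)" by (rule bounded_linear_scaleR_left)
  have "((\<lambda>y. \<bar>C\<bar> * \<bar>y - x\<bar>) \<longlongrightarrow> \<bar>C\<bar> * \<bar>x - x\<bar>) (at x)" by (intro tendsto_intros)
  then have "((\<lambda>y. \<bar>C\<bar> * \<bar>y - x\<bar>) \<longlongrightarrow> 0) (at x)" by simp
  moreover have "eventually (\<lambda>y. norm ((1 / norm (y - x)) *\<^sub>R (f y - (f x + (y - x) *\<^sub>R d))) \<le> \<bar>C\<bar> * \<bar>y - x\<bar>) (at x)"
    unfolding eventually_at
  proof (intro exI[of _ 1] conjI ballI impI)
    fix y assume y: "y \<noteq> x \<and> dist y x < 1"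
    then have "norm (f y - (f x + (y - x) *\<^sub>R d)) \<le> \<bar>C\<bar> * (y - x)\<^sup>2"
      using assms[of y] order.trans[OF _ mult_right_mono[OF abs_ge_self[of C] zero_le_power2[of "y - x"]]]
      by (simp add: dist_real_def algebra_simps)
    then have "norm (f y - (f x + (y - x) *\<^sub>R d)) / \<bar>y - x\<bar> \<le> \<bar>C\<bar> * (y - x)\<^sup>2 / \<bar>y - x\<bar>"
      by (rule divide_right_mono) simp
    also have "\<bar>C\<bar> * (y - x)\<^sup>2 / \<bar>y - x\<bar> = \<bar>C\<bar> * \<bar>y - x\<bar>" using y by (auto simp: power2_eq_square abs_if nonzero_divide_eq_eq algebra_simps)
    finally show "norm ((1 / norm (y - x)) *\<^sub>R (f y - (f x + (y - x) *\<^sub>R d))) \<le> \<bar>C\<bar> * \<bar>y - x\<bar>" using y by simp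
  qed simp
  ultimately show "((\<lambda>y. (1 / norm (y - x)) *\<^sub>R (f y - (f x + (y - x) *\<^sub>R d))) \<longlongrightarrow> 0) (at x)"
    by (rule Lim_null_comparison[rotated])
qed

text \<open>The constant must not depend on \<open>N\<close>. In the exact formula for the
  difference of two masses the density changes by order \<open>y - x\<close>. Replacing the solution
  at \<open>y\<close> by the one at \<open>x\<close> costs another such factor, by stability, and
  linearising the exponential costs a quadratic remainder.\<close>

lemma nystrom_mass_quadratic_remainder:
  fixes \<psi> :: "nat \<Rightarrow> real \<Rightarrow> real \<Rightarrow> complex" and R :: "real \<Rightarrow> real" and x :: real
  assumes "0 < a" "a \<le> b" "continuous_on {a..b} R" "\<And>t. t \<in> {a..b} \<Longrightarrow> 0 \<le> R t"
    and eqN: "\<And>N x s. 1 \<le> N \<Longrightarrow> s \<in> {a..b} \<Longrightarrow>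
        \<psi> N x s + riemann_sum a b N (\<lambda>t. of_real (R t * exp (- 2 * t * x)) * \<psi> N x t / of_real (s + t)) = 1"
  obtains C where "\<And>N y. 1 \<le> N \<Longrightarrow> \<bar>y - x\<bar> \<le> 1 \<Longrightarrow>
      norm (riemann_sum a b N (\<lambda>t. of_real (R t * exp (- 2 * t * y)) * \<psi> N y t)
          - riemann_sum a b N (\<lambda>t. of_real (R t * exp (- 2 * t * x)) * \<psi> N x t)
          - (y - x) *\<^sub>R (- 2 * riemann_sum a b N (\<lambda>t. of_real (t * (R t * exp (- 2 * t * x))) * (\<psi> N x t)\<^sup>2)))
        \<le> C * (y - x)\<^sup>2"
proof -
  define \<rho> where "\<rho> y t = R t * exp (- 2 * t * y)" for y t
  have "continuous_on {a..b} (\<rho> x)" unfolding \<rho>_def by (intro continuous_intros assms(3))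
  then have "bounded (\<rho> x ` {a..b})" using compact_continuous_image compact_imp_bounded by blast
  then obtain P where P: "P > 0" "\<And>t. t \<in> {a..b} \<Longrightarrow> \<bar>\<rho> x t\<bar> \<le> P" unfolding bounded_pos by auto
  have \<rho>0: "0 \<le> \<rho> y t" if "t \<in> {a..b}" for y t using assms(4)[OF that] by (simp add: \<rho>_def)
  \<comment> \<open>Bounds every factor \<open>exp \<bar>- 2 * t * h\<bar>\<close> with
    \<open>t \<in> {a..b}\<close> and \<open>\<bar>h\<bar> \<le> 1\<close>.\<close>
  define X where "X = exp (2 * b)"
  have X: "X \<ge> 1" using assms(1,2) by (simp add: X_def)
  have \<rho>y: "\<rho> y t = \<rho> x t * exp (- 2 * t * (y - x))" for y t
    by (simp add: \<rho>_def exp_add[symmetric] algebra_simps)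
  have expX: "exp \<bar>- 2 * t * h\<bar> \<le> X" "\<bar>- 2 * t * h\<bar> \<le> 2 * b * \<bar>h\<bar>" if "t \<in> {a..b}" "\<bar>h\<bar> \<le> 1" for t h
  proof -
    show *: "\<bar>- 2 * t * h\<bar> \<le> 2 * b * \<bar>h\<bar>" using that assms(1) by (simp add: abs_mult mult_right_mono)
    also have "\<dots> \<le> 2 * b * 1" using that assms(1,2) by (intro mult_left_mono) auto
    finally show "exp \<bar>- 2 * t * h\<bar> \<le> X" by (simp add: X_def)
  qed
  define Q where "Q = P * X"
  have Q: "Q > 0" using P X by (simp add: Q_def)
  have \<rho>Q: "\<rho> y t \<le> Q" if "t \<in> {a..b}" "\<bar>y - x\<bar> \<le> 1" for y t
  proof -
    have "exp (- 2 * t * (y - x)) \<le> X" using expX(1)[OF that] abs_ge_self[of "- 2 * t * (y - x)"]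
      by (meson exp_le_cancel_iff order.trans)
    then show ?thesis unfolding \<rho>y[of y] Q_def using P(2)[OF that(1)] P(1) by (intro mult_mono) auto
  qed
  have d1: "\<bar>exp (- 2 * t * h) - 1\<bar> \<le> 2 * b * \<bar>h\<bar> * X" if "t \<in> {a..b}" "\<bar>h\<bar> \<le> 1" for t h
    by (rule order.trans[OF abs_exp_minus_one_le mult_mono[OF expX(2,1)[OF that]]]) (use assms in auto)
  have d2: "\<bar>exp (- 2 * t * h) - 1 - (- 2 * t * h)\<bar> \<le> (2 * b * \<bar>h\<bar>)\<^sup>2 * X" if "t \<in> {a..b}" "\<bar>h\<bar> \<le> 1" for t h
  proof -
    have "(- 2 * t * h)\<^sup>2 \<le> (2 * b * \<bar>h\<bar>)\<^sup>2" using power_mono[OF expX(2)[OF that], of 2] by (simp only: power2_abs abs_ge_zero)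
    then show ?thesis
      by (rule order.trans[OF abs_exp_minus_one_minus_le mult_mono[OF _ expX(1)[OF that]]]) auto
  qed
  \<comment> \<open>The stability constant for densities up to \<open>Q\<close>; with right-hand
    side 1 it bounds the solutions themselves, for all \<open>N\<close> and all \<open>y\<close>
    within distance 1 of \<open>x\<close>.\<close>
  define C0 where "C0 = 1 + (b - a) * Q * (1 + (b - a) * Q / (2 * a)) / a"
  have C0: "C0 > 0" unfolding C0_def using assms(1,2) Q by (intro add_pos_nonneg) auto
  have \<psi>0: "norm (\<psi> N y s) \<le> C0" if "1 \<le> N" "\<bar>y - x\<bar> \<le> 1" "s \<in> {a..b}" for N y s
  proof -
    have "norm (\<psi> N y s) \<le> C0 * 1" unfolding C0_def
      by (rule nystrom_stable[where \<rho> = "\<rho> y" and e = "\<lambda>_. 1", OF assms(1,2) that(1)])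
        (use that eqN \<rho>0 \<rho>Q Q in \<open>auto simp: \<rho>_def\<close>)
    then show ?thesis by simp
  qed
  \<comment> \<open>Lipschitz constant of the right-hand side below. The \<open>+ 1\<close> keeps it
    positive, since \<open>nystrom_stable\<close> asks for a positive error level; for the same
    reason \<open>y = x\<close> is treated separately.\<close>
  define C1 where "C1 = (b - a) * (P * (2 * b * X) * C0 / (2 * a)) + 1"
  have C1: "C1 > 0" unfolding C1_def using assms(1,2) P X C0 by (intro add_nonneg_pos) auto
  have \<psi>1: "norm (\<psi> N y s - \<psi> N x s) \<le> C0 * (C1 * \<bar>y - x\<bar>)" if N: "1 \<le> N" and y: "\<bar>y - x\<bar> \<le> 1" and s: "s \<in> {a..b}" for N y s
  proof (cases "y = x")
    case False
    \<comment> \<open>Subtracting the equations at \<open>y\<close> and \<open>x\<close> leaves the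
      equation with the density at \<open>y\<close> for the difference of the solutions, driven by
      the change of density.\<close>
    define e where "e s = - riemann_sum a b N (\<lambda>t. of_real (\<rho> y t - \<rho> x t) * \<psi> N x t / of_real (s + t))" for s
    show ?thesis unfolding C0_def
    proof (rule nystrom_stable[where \<rho> = "\<rho> y" and e = e, OF assms(1,2) N])
      fix s assume s: "s \<in> {a..b}"
      show "\<psi> N y s - \<psi> N x s + riemann_sum a b N (\<lambda>t. of_real (\<rho> y t) * (\<psi> N y t - \<psi> N x t) / of_real (s + t)) = e s"
        using eqN[OF N s, of y] eqN[OF N s, of x] unfolding e_def \<rho>_def[symmetric]
        by (simp add: left_diff_distrib right_diff_distrib diff_divide_distrib riemann_sum_diff algebra_simps)
      have "norm (riemann_sum a b N (\<lambda>t. of_real (\<rho> y t - \<rho> x t) * \<psi> N x t / of_real (s + t)))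
          \<le> (b - a) * (P * (2 * b * \<bar>y - x\<bar> * X) * C0 / (2 * a))"
      proof (rule norm_riemann_sum_le[OF assms(2)])
        fix j assume "j \<in> {1..N}"
        then have t: "riemann_node a b N j \<in> {a..b}" using riemann_node_in[OF assms(2)] by simp
        let ?t = "riemann_node a b N j"
        have "\<rho> y ?t - \<rho> x ?t = \<rho> x ?t * (exp (- 2 * ?t * (y - x)) - 1)" unfolding \<rho>y[of y] by (simp add: algebra_simps)
        then have "\<bar>\<rho> y ?t - \<rho> x ?t\<bar> \<le> P * (2 * b * \<bar>y - x\<bar> * X)"
          unfolding abs_mult using P t d1[OF t y] by (simp only: abs_mult) (intro mult_mono, auto)
        moreover have "2 * a \<le> \<bar>s + ?t\<bar>" using s t by auto
        ultimately show "norm (of_real (\<rho> y ?t - \<rho> x ?t) * \<psi> N x ?t / of_real (s + ?t)) \<le> P * (2 * b * \<bar>y - x\<bar> * X) * C0 / (2 * a)"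
          unfolding norm_divide norm_mult norm_of_real
          using \<psi>0[OF N _ t, of x] assms(1,2) P X C0 by (intro frac_le mult_mono) auto
      qed (use assms P X C0 in auto)
      also have "\<dots> \<le> C1 * \<bar>y - x\<bar>" using assms(1) by (simp add: C1_def field_simps)
      finally show "norm (e s) \<le> C1 * \<bar>y - x\<bar>" by (simp add: e_def)
    qed (use \<rho>0 \<rho>Q Q y C1 False s in auto)
  qed simp
  define C where "C = (b - a) * (P * ((2 * b * X) * (C0 * C1) * C0 + (2 * b)\<^sup>2 * X * C0\<^sup>2))"
  show thesis
  proof (rule that[of C])
    fix N :: nat and y :: real assume N: "1 \<le> N" and y: "\<bar>y - x\<bar> \<le> 1"
    let ?S = "riemann_sum a b N"
    define h where "h = y - x"
    have hy: "\<bar>h\<bar> \<le> 1" using y by (simp add: h_def)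
    have id: "?S (\<lambda>t. of_real (\<rho> y t) * \<psi> N y t) - ?S (\<lambda>t. of_real (\<rho> x t) * \<psi> N x t)
        = ?S (\<lambda>t. (of_real (\<rho> y t) - of_real (\<rho> x t)) * \<psi> N x t * \<psi> N y t)"
      by (rule nystrom_perturbation_identity[OF assms(2)]) (use eqN[OF N] in \<open>auto simp: \<rho>_def\<close>)
    have sc: "(y - x) *\<^sub>R (- 2 * ?S (\<lambda>t. of_real (t * \<rho> x t) * (\<psi> N x t)\<^sup>2))
       = ?S (\<lambda>t. of_real (- 2 * t * h * \<rho> x t) * (\<psi> N x t)\<^sup>2)"
      by (simp add: scaleR_conv_of_real h_def[symmetric] riemann_sum_def sum_distrib_left mult_ac)
    \<comment> \<open>The two summands are the second-order errors: change of density times change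
      of solution, and the Taylor remainder of the exponential.\<close>
    have "?S (\<lambda>t. of_real (\<rho> y t) * \<psi> N y t) - ?S (\<lambda>t. of_real (\<rho> x t) * \<psi> N x t)
       - (y - x) *\<^sub>R (- 2 * ?S (\<lambda>t. of_real (t * \<rho> x t) * (\<psi> N x t)\<^sup>2))
      = ?S (\<lambda>t. of_real (\<rho> x t) * (of_real (exp (- 2 * t * h) - 1) * (\<psi> N y t - \<psi> N x t) * \<psi> N x t
            + of_real (exp (- 2 * t * h) - 1 - (- 2 * t * h)) * (\<psi> N x t)\<^sup>2))"
      unfolding id unfolding sc riemann_sum_diff[symmetric] unfolding \<rho>y[of y] h_def[symmetric]
      by (rule arg_cong[where f = ?S]) (simp add: algebra_simps power2_eq_square)
    also have "norm \<dots> \<le> (b - a) * (P * ((2 * b * \<bar>h\<bar> * X) * (C0 * (C1 * \<bar>h\<bar>)) * C0 + (2 * b * \<bar>h\<bar>)\<^sup>2 * X * C0\<^sup>2))"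
    proof (rule norm_riemann_sum_le[OF assms(2)])
      fix j assume "j \<in> {1..N}"
      then have t: "riemann_node a b N j \<in> {a..b}" using riemann_node_in[OF assms(2)] by simp
      let ?t = "riemann_node a b N j"
      have \<psi>x: "norm (\<psi> N x ?t) \<le> C0" using \<psi>0[OF N _ t, of x] by simp
      have \<psi>d: "norm (\<psi> N y ?t - \<psi> N x ?t) \<le> C0 * (C1 * \<bar>h\<bar>)" using \<psi>1[OF N y t] by (simp add: h_def)
      have "norm (of_real (exp (- 2 * ?t * h) - 1) * (\<psi> N y ?t - \<psi> N x ?t) * \<psi> N x ?t) \<le> (2 * b * \<bar>h\<bar> * X) * (C0 * (C1 * \<bar>h\<bar>)) * C0"
        unfolding norm_mult norm_of_real using d1[OF t hy] \<psi>x \<psi>d C0 C1 X assms(1,2) by (intro mult_mono) auto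
      moreover have "norm (of_real (exp (- 2 * ?t * h) - 1 - (- 2 * ?t * h)) * (\<psi> N x ?t)\<^sup>2) \<le> (2 * b * \<bar>h\<bar>)\<^sup>2 * X * C0\<^sup>2"
        unfolding norm_mult norm_of_real norm_power using d2[OF t hy] \<psi>x C0 X by (intro mult_mono power_mono) auto
      ultimately show "norm (of_real (\<rho> x ?t) * (of_real (exp (- 2 * ?t * h) - 1) * (\<psi> N y ?t - \<psi> N x ?t) * \<psi> N x ?t
            + of_real (exp (- 2 * ?t * h) - 1 - (- 2 * ?t * h)) * (\<psi> N x ?t)\<^sup>2))
          \<le> P * ((2 * b * \<bar>h\<bar> * X) * (C0 * (C1 * \<bar>h\<bar>)) * C0 + (2 * b * \<bar>h\<bar>)\<^sup>2 * X * C0\<^sup>2)"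
        unfolding norm_mult[of "of_real (\<rho> x ?t)"] norm_of_real
        by (intro mult_mono P(2)[OF t] order.trans[OF norm_triangle_ineq] add_mono) (use P in auto)
    qed (use assms P X C0 C1 in auto)
    also have "\<dots> = C * (y - x)\<^sup>2"
    proof -
      have "h\<^sup>2 = \<bar>h\<bar> * \<bar>h\<bar>" by (simp add: power2_eq_square)
      then show ?thesis unfolding C_def h_def[symmetric] by algebra
    qed
    finally show "norm (?S (\<lambda>t. of_real (R t * exp (- 2 * t * y)) * \<psi> N y t)
          - ?S (\<lambda>t. of_real (R t * exp (- 2 * t * x)) * \<psi> N x t)
          - (y - x) *\<^sub>R (- 2 * ?S (\<lambda>t. of_real (t * (R t * exp (- 2 * t * x))) * (\<psi> N x t)\<^sup>2)))
        \<le> C * (y - x)\<^sup>2"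
      unfolding \<rho>_def .
  qed
qed

lemma uniform_limit_imp_Times_snd:
  assumes "uniform_limit T f g F"
  shows "uniform_limit (S \<times> T) (\<lambda>n p. f n (snd p)) (\<lambda>p. g (snd p)) F"
  using assms unfolding uniform_limit_iff by (auto elim!: eventually_mono)

text \<open>The quadratic remainder has one constant for all \<open>N\<close>, so it persists as
  \<open>N\<close> grows with \<open>y\<close> fixed. Hence the limiting mass is differentiable, and
  its derivative is the limit of the discrete ones.\<close>

lemma nystrom_mass_derivative:
  fixes \<psi> :: "nat \<Rightarrow> real \<Rightarrow> real \<Rightarrow> complex" and R :: "real \<Rightarrow> real" and x :: real
  assumes "0 < a" "a \<le> b" "continuous_on {a..b} R" "\<And>t. t \<in> {a..b} \<Longrightarrow> 0 \<le> R t"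
    and eqN: "\<And>N x s. 1 \<le> N \<Longrightarrow> s \<in> {a..b} \<Longrightarrow>
        \<psi> N x s + riemann_sum a b N (\<lambda>t. of_real (R t * exp (- 2 * t * x)) * \<psi> N x t / of_real (s + t)) = 1"
    and cont: "\<And>x. continuous_on {a..b} (\<phi> x)"
    and eq: "\<And>x s. s \<in> {a..b} \<Longrightarrow>
        \<phi> x s + integral {a..b} (\<lambda>t. of_real (R t * exp (- 2 * t * x)) * \<phi> x t / of_real (s + t)) = 1"
  shows "\<exists>D d. (\<forall>N\<ge>1. ((\<lambda>y. riemann_sum a b N (\<lambda>t. of_real (R t * exp (- 2 * t * y)) * \<psi> N y t)) has_vector_derivative D N) (at x))
     \<and> ((\<lambda>y. integral {a..b} (\<lambda>t. of_real (R t * exp (- 2 * t * y)) * \<phi> y t)) has_vector_derivative d) (at x)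
     \<and> D \<longlonglongrightarrow> d"
proof -
  define \<rho> where "\<rho> y t = R t * exp (- 2 * t * y)" for y t
  have c\<rho>: "continuous_on {a..b} (\<rho> y)" for y unfolding \<rho>_def by (intro continuous_intros assms(3))
  have ul: "uniform_limit {a..b} (\<lambda>N. \<psi> N y) (\<phi> y) sequentially" for y
    by (rule nystrom_uniform_limit[OF assms(1,2) c\<rho>[of y]]) (use assms(4) cont eqN eq in \<open>auto simp: \<rho>_def\<close>)
  have bd: "bounded (f ` {a..b})" if "continuous_on {a..b} f" for f :: "real \<Rightarrow> complex"
    using that compact_continuous_image compact_imp_bounded by blast
  have riem: "(\<lambda>N. riemann_sum a b N (\<lambda>t. g t * F N t)) \<longlonglongrightarrow> integral {a..b} (\<lambda>t. g t * f t)"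
    if g: "continuous_on {a..b} g" and f: "continuous_on {a..b} f" and F: "uniform_limit {a..b} F f sequentially" for g f :: "real \<Rightarrow> complex" and F
  proof -
    have "uniform_limit {a..b} (\<lambda>N t. g t * F N t) (\<lambda>t. g t * f t) sequentially"
      by (rule uniform_lim_mult[OF uniform_limit_const F bd[OF g] bd[OF f]])
    \<comment> \<open>The parametrised limit theorem is applied with the one-point parameter set
      \<open>{0}\<close>.\<close>
    then have 1: "uniform_limit ({0::real} \<times> {a..b}) (\<lambda>N p. g (snd p) * F N (snd p)) (\<lambda>p. g (snd p) * f (snd p)) sequentially"
      by (rule uniform_limit_imp_Times_snd)
    have 2: "continuous_on ({0::real} \<times> {a..b}) (\<lambda>p. g (snd p) * f (snd p))"
      by (intro continuous_intros continuous_on_compose2[OF g] continuous_on_compose2[OF f]) auto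
    show ?thesis
      using riemann_sum_uniform_limit'[OF assms(2), of "{0::real}" "\<lambda>_ t. g t * f t" "\<lambda>N _ t. g t * F N t"] 1 2
      by (simp add: case_prod_unfold uniform_limit_singleton)
  qed
  have ul2: "uniform_limit {a..b} (\<lambda>N t. (\<psi> N x t)\<^sup>2) (\<lambda>t. (\<phi> x t)\<^sup>2) sequentially"
    unfolding power2_eq_square by (rule uniform_lim_mult[OF ul ul bd[OF cont] bd[OF cont]])
  define D where "D N = - 2 * riemann_sum a b N (\<lambda>t. of_real (t * \<rho> x t) * (\<psi> N x t)\<^sup>2)" for N
  define d where "d = - 2 * integral {a..b} (\<lambda>t. of_real (t * \<rho> x t) * (\<phi> x t)\<^sup>2)"
  have Dd: "D \<longlonglongrightarrow> d" unfolding D_def d_def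
    by (intro tendsto_mult tendsto_const riem ul2 continuous_intros c\<rho> cont)
  have m: "(\<lambda>N. riemann_sum a b N (\<lambda>t. of_real (\<rho> y t) * \<psi> N y t)) \<longlonglongrightarrow> integral {a..b} (\<lambda>t. of_real (\<rho> y t) * \<phi> y t)" for y
    by (intro riem ul continuous_intros c\<rho> cont)
  obtain C where C: "\<And>N y. 1 \<le> N \<Longrightarrow> \<bar>y - x\<bar> \<le> 1 \<Longrightarrow>
      norm (riemann_sum a b N (\<lambda>t. of_real (\<rho> y t) * \<psi> N y t)
          - riemann_sum a b N (\<lambda>t. of_real (\<rho> x t) * \<psi> N x t) - (y - x) *\<^sub>R D N) \<le> C * (y - x)\<^sup>2"
    by (rule nystrom_mass_quadratic_remainder[OF assms(1-4) eqN, of x, folded \<rho>_def, folded D_def]) blast+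
  have "((\<lambda>y. riemann_sum a b N (\<lambda>t. of_real (\<rho> y t) * \<psi> N y t)) has_vector_derivative D N) (at x)" if "1 \<le> N" for N
    by (rule has_vector_derivative_quadratic_remainder) (rule C[OF that])
  moreover have "((\<lambda>y. integral {a..b} (\<lambda>t. of_real (\<rho> y t) * \<phi> y t)) has_vector_derivative d) (at x)"
  proof (rule has_vector_derivative_quadratic_remainder)
    fix y assume y: "\<bar>y - x\<bar> \<le> 1"
    show "norm (integral {a..b} (\<lambda>t. of_real (\<rho> y t) * \<phi> y t) - integral {a..b} (\<lambda>t. of_real (\<rho> x t) * \<phi> x t) - (y - x) *\<^sub>R d) \<le> C * (y - x)\<^sup>2"
    proof (rule tendsto_upperbound)
      show "(\<lambda>N. norm (riemann_sum a b N (\<lambda>t. of_real (\<rho> y t) * \<psi> N y t)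
          - riemann_sum a b N (\<lambda>t. of_real (\<rho> x t) * \<psi> N x t) - (y - x) *\<^sub>R D N)) \<longlonglongrightarrow>
        norm (integral {a..b} (\<lambda>t. of_real (\<rho> y t) * \<phi> y t) - integral {a..b} (\<lambda>t. of_real (\<rho> x t) * \<phi> x t) - (y - x) *\<^sub>R d)"
        by (intro tendsto_intros m Dd)
      show "eventually (\<lambda>N. norm (riemann_sum a b N (\<lambda>t. of_real (\<rho> y t) * \<psi> N y t)
          - riemann_sum a b N (\<lambda>t. of_real (\<rho> x t) * \<psi> N x t) - (y - x) *\<^sub>R D N) \<le> C * (y - x)\<^sup>2) sequentially"
        using C y by (intro eventually_sequentiallyI[of 1]) auto
    qed simp
  qed
  ultimately show ?thesis using Dd unfolding \<rho>_def by blast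
qed

subsection \<open>Cauchy integrals along the segments\<close>

lemma upper_seg_eq: "a \<le> b \<Longrightarrow> upper_seg a b = {z. Re z = 0 \<and> Im z \<in> {a..b}}"
  using closed_segment_same_Re[of "\<i> * of_real a" "\<i> * of_real b"]
  by (simp add: upper_seg_def closed_segment_eq_real_ivl)

lemma lower_seg_eq:
  assumes "a \<le> b"
  shows "lower_seg a b = {z. Re z = 0 \<and> - Im z \<in> {a..b}}"
proof -
  have "closed_segment (- \<i> * of_real b) (- \<i> * of_real a)
      = {z. Re z = 0 \<and> Im z \<in> closed_segment (- b) (- a)}"
    using closed_segment_same_Re[of "- \<i> * of_real b" "- \<i> * of_real a"] by simp
  also have "\<dots> = {z. Re z = 0 \<and> - Im z \<in> {a..b}}"
    using assms by (auto simp: closed_segment_eq_real_ivl)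
  finally show ?thesis by (simp only: lower_seg_def)
qed

lemma lower_seg_iff: "a \<le> b \<Longrightarrow> z \<in> lower_seg a b \<longleftrightarrow> - z \<in> upper_seg a b"
  by (simp add: upper_seg_eq lower_seg_eq)

lemma compact_upper_seg [simp]: "compact (upper_seg a b)" and convex_upper_seg [simp]: "convex (upper_seg a b)"
  and compact_lower_seg [simp]: "compact (lower_seg a b)" and convex_lower_seg [simp]: "convex (lower_seg a b)"
  by (simp_all add: upper_seg_def lower_seg_def)

lemma closed_upper_seg [simp]: "closed (upper_seg a b)" and closed_lower_seg [simp]: "closed (lower_seg a b)"
  by (simp_all add: compact_imp_closed)

lemma ii_in_upper_seg: "t \<in> {a..b} \<Longrightarrow> \<i> * of_real t \<in> upper_seg a b"
  by (cases "a \<le> b") (auto simp: upper_seg_eq)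

lemma not_upper_seg_imp_neq: "z \<notin> upper_seg a b \<Longrightarrow> t \<in> {a..b} \<Longrightarrow> z - \<i> * of_real t \<noteq> 0"
  using ii_in_upper_seg[of t a b] by (metis eq_iff_diff_eq_0)

lemma islimpt_off_upper_seg:
  assumes "Re z = 0" "a \<le> b"
  shows "z islimpt {w. 0 < Re w}" "z islimpt {w. Re w < 0}" "z islimpt - upper_seg a b"
proof -
  show 1: "z islimpt {w. 0 < Re w}" unfolding islimpt_approachable
  proof (intro allI impI)
    fix e :: real assume "e > 0"
    then show "\<exists>x'\<in>{w. 0 < Re w}. x' \<noteq> z \<and> dist x' z < e"
      using assms(1) by (intro bexI[of _ "z + of_real (e / 2)"]) (auto simp: dist_norm)
  qed
  show "z islimpt {w. Re w < 0}" unfolding islimpt_approachable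
  proof (intro allI impI)
    fix e :: real assume "e > 0"
    then show "\<exists>x'\<in>{w. Re w < 0}. x' \<noteq> z \<and> dist x' z < e"
      using assms(1) by (intro bexI[of _ "z - of_real (e / 2)"]) (auto simp: dist_norm)
  qed
  show "z islimpt - upper_seg a b"
    by (rule islimpt_subset[OF 1]) (use assms in \<open>auto simp: upper_seg_eq\<close>)
qed

lemma norm_le_of_limit_point:
  fixes f :: "complex \<Rightarrow> complex"
  assumes "isCont f z" "open U" "z \<in> U" "z islimpt S" "\<And>w. w \<in> U \<inter> S \<Longrightarrow> norm (f w) \<le> e"
  shows "norm (f z) \<le> e"
proof (rule tendsto_upperbound)
  show "((\<lambda>w. norm (f w)) \<longlongrightarrow> norm (f z)) (at z within S)"
    by (rule tendsto_norm[OF Lim_at_imp_Lim_at_within[OF assms(1)[unfolded isCont_def]]])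
  show "eventually (\<lambda>w. norm (f w) \<le> e) (at z within S)"
    unfolding eventually_at_topological
  proof (intro exI[of _ U] conjI ballI impI assms(2,3))
    fix w assume "w \<in> U" "w \<in> S"
    then show "norm (f w) \<le> e" by (intro assms(5)) blast
  qed
  show "at z within S \<noteq> bot" using assms(4) by (simp add: trivial_limit_within)
qed

text \<open>Riemann's theorem, one point at a time. The induction generalises over \<open>f\<close>,
  since removing a singularity replaces the function; near the remaining points the old and the new
  function agree, so the limit conditions are inherited.\<close>

lemma holomorphic_extension_finite:
  assumes "finite E" "open S" "E \<subseteq> S" "f holomorphic_on (S - E)"
    and "\<And>p. p \<in> E \<Longrightarrow> ((\<lambda>w. (w - p) * f w) \<longlongrightarrow> 0) (at p)"
  shows "\<exists>F. F holomorphic_on S \<and> (\<forall>z\<in>S - E. F z = f z)"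
proof -
  have "\<forall>f. E \<subseteq> S \<longrightarrow> f holomorphic_on (S - E) \<longrightarrow> (\<forall>p\<in>E. ((\<lambda>w. (w - p) * f w) \<longlongrightarrow> 0) (at p))
      \<longrightarrow> (\<exists>F. F holomorphic_on S \<and> (\<forall>z\<in>S - E. F z = f z))"
    using assms(1)
  proof (induction E rule: finite_induct)
    case empty
    show ?case
    proof (intro allI impI)
      fix f assume "f holomorphic_on (S - {})"
      then show "\<exists>F. F holomorphic_on S \<and> (\<forall>z\<in>S - {}. F z = f z)"
        by (intro exI[of _ f]) simp
    qed
  next
    case (insert p E)
    show ?case
    proof (intro allI impI)
      fix f assume sub: "insert p E \<subseteq> S" and hol: "f holomorphic_on (S - insert p E)"
        and lim: "\<forall>q\<in>insert p E. ((\<lambda>w. (w - q) * f w) \<longlongrightarrow> 0) (at q)"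
      have op: "open (S - E)" by (rule open_Diff[OF assms(2) finite_imp_closed[OF insert.hyps(1)]])
      have hol': "f holomorphic_on (S - E) - {p}"
        by (rule holomorphic_on_subset[OF hol]) blast
      have int: "p \<in> interior (S - E)"
        unfolding interior_open[OF op] using insert.hyps(2) sub by blast
      have "((\<lambda>w. (w - p) * f w) \<longlongrightarrow> 0) (at p)" using lim by simp
      from iffD2[OF holomorphic_on_extend_lim[OF hol' int] this]
      obtain g where g: "g holomorphic_on (S - E)" "\<forall>z\<in>S - E - {p}. g z = f z" by (elim exE conjE)
      have g_lim: "((\<lambda>w. (w - q) * g w) \<longlongrightarrow> 0) (at q)" if q: "q \<in> E" for q
      proof (rule Lim_transform_within_open)
        show "((\<lambda>w. (w - q) * f w) \<longlongrightarrow> 0) (at q)" using lim q by simp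
        show "open (S - (insert p E - {q}))"
          by (rule open_Diff[OF assms(2) finite_imp_closed]) (use insert.hyps(1) in simp)
        show "q \<in> S - (insert p E - {q})" using sub q by blast
        show "(w - q) * f w = (w - q) * g w" if w: "w \<in> S - (insert p E - {q})" "w \<noteq> q" for w
          using g(2) w by simp
      qed
      have "E \<subseteq> S" using sub by simp
      with insert.IH g(1) g_lim obtain F where F: "F holomorphic_on S" "\<forall>z\<in>S - E. F z = g z"
        by meson
      show "\<exists>F. F holomorphic_on S \<and> (\<forall>z\<in>S - insert p E. F z = f z)"
        by (rule exI[of _ F]) (use F g(2) in simp)
    qed
  qed
  then show ?thesis using assms(3-5) by meson
qed

lemma holomorphic_on_cauchy_integral:
  assumes "continuous_on {a..b} h"
  shows "(\<lambda>z. integral {a..b} (\<lambda>t. h t / (z - \<i> * of_real t))) holomorphic_on (- upper_seg a b)"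
proof -
  have op: "open (- upper_seg a b)" by (simp add: open_Compl)
  have "\<exists>f'. ((\<lambda>z. integral {a..b} (\<lambda>t. h t / (z - \<i> * of_real t))) has_field_derivative f') (at z)"
    if z: "z \<in> - upper_seg a b" for z
  proof -
    obtain e where e: "e > 0" "ball z e \<subseteq> - upper_seg a b" using op z openE by blast
    have nz: "w - \<i> * of_real t \<noteq> 0" if "w \<in> ball z e" "t \<in> {a..b}" for w t
      using not_upper_seg_imp_neq[of w a b t] e that by blast
    have "(\<lambda>w. integral (cbox a b) (\<lambda>t. h t / (w - \<i> * of_real t))) holomorphic_on ball z e"
    proof (rule leibniz_rule_holomorphic)
      fix w t assume wt: "w \<in> ball z e" "t \<in> cbox a b"
      then have "w - \<i> * of_real t \<noteq> 0" using nz by simp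
      then have "((\<lambda>w. h t / (w - \<i> * of_real t)) has_field_derivative - h t / (w - \<i> * of_real t)\<^sup>2) (at w)"
        by (auto intro!: derivative_eq_intros simp: power2_eq_square)
      then show "((\<lambda>w. h t / (w - \<i> * of_real t)) has_field_derivative - h t / (w - \<i> * of_real t)\<^sup>2) (at w within ball z e)"
        by (rule has_field_derivative_at_within)
    next
      fix w assume w: "w \<in> ball z e"
      have "continuous_on {a..b} (\<lambda>t. h t / (w - \<i> * of_real t))"
        using nz[OF w] by (intro continuous_intros assms) blast
      then show "(\<lambda>t. h t / (w - \<i> * of_real t)) integrable_on cbox a b"
        by (simp add: integrable_continuous_real)
    next
      show "continuous_on (ball z e \<times> cbox a b) (\<lambda>(w, t). - h t / (w - \<i> * of_real t)\<^sup>2)"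
        unfolding case_prod_unfold using nz
        by (intro continuous_intros continuous_on_compose2[OF assms]) (auto simp: mem_Times_iff)
    qed simp
    then show ?thesis using holomorphic_on_open[OF open_ball] e by (simp add: centre_in_ball)
  qed
  then show ?thesis using holomorphic_on_open[OF op] by blast
qed

lemma tendsto_cauchy_integral_at_infinity:
  assumes "continuous_on {a..b} h" "0 \<le> a" "a \<le> b"
  shows "((\<lambda>z. integral {a..b} (\<lambda>t. h t / (z - \<i> * of_real t))) \<longlongrightarrow> 0) at_infinity"
proof -
  have "bounded (h ` {a..b})" using assms(1) compact_continuous_image compact_imp_bounded by blast
  then obtain B where B: "B > 0" "\<And>t. t \<in> {a..b} \<Longrightarrow> norm (h t) \<le> B" unfolding bounded_pos by auto
  have "filterlim (\<lambda>z::complex. - b + norm z) at_top at_infinity"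
    by (intro filterlim_tendsto_add_at_top[OF tendsto_const] filterlim_norm_at_top)
  then have "((\<lambda>z::complex. B * (b - a) / (- b + norm z)) \<longlongrightarrow> 0) at_infinity"
    by (intro tendsto_divide_0[OF tendsto_const] filterlim_at_top_imp_at_infinity)
  moreover have "eventually (\<lambda>z. norm (integral {a..b} (\<lambda>t. h t / (z - \<i> * of_real t))) \<le> B * (b - a) / (- b + norm z)) at_infinity"
    unfolding eventually_at_infinity
  proof (intro exI[of _ "b + 1"] allI impI)
    fix z :: complex assume z: "b + 1 \<le> norm z"
    have le: "norm z - b \<le> norm (z - \<i> * of_real t)" if "t \<in> {a..b}" for t
      using norm_triangle_ineq2[of z "\<i> * of_real t"] that assms(2) by (simp add: norm_mult)
    have "norm (integral {a..b} (\<lambda>t. h t / (z - \<i> * of_real t))) \<le> B / (norm z - b) * (b - a)"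
    proof (rule integral_bound[OF assms(3)])
      have "z - \<i> * of_real t \<noteq> 0" if "t \<in> {a..b}" for t using le[OF that] z by auto
      then show "continuous_on {a..b} (\<lambda>t. h t / (z - \<i> * of_real t))"
        by (intro continuous_intros assms) blast
      fix t assume t: "t \<in> {a..b}"
      show "norm (h t / (z - \<i> * of_real t)) \<le> B / (norm z - b)"
        unfolding norm_divide using B(2)[OF t] le[OF t] z B(1) by (intro frac_le) auto
    qed
    then show "norm (integral {a..b} (\<lambda>t. h t / (z - \<i> * of_real t))) \<le> B * (b - a) / (- b + norm z)"
      by simp
  qed
  ultimately show ?thesis by (rule Lim_null_comparison[rotated])
qed

text \<open>Since \<open>z / (z - q) = 1 + q / (z - q)\<close> with \<open>q = \<i> * t\<close>, the
  product is the integral of \<open>h\<close> plus another Cauchy integral, which vanishes at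
  infinity.\<close>

lemma tendsto_cauchy_integral_moment_at_infinity:
  assumes h: "continuous_on {a..b} h" and ab: "0 \<le> a" "a \<le> b"
  shows "((\<lambda>z. z * integral {a..b} (\<lambda>t. h t / (z - \<i> * of_real t))) \<longlongrightarrow> integral {a..b} h) at_infinity"
proof (rule Lim_transform_eventually)
  have "((\<lambda>z. integral {a..b} h + integral {a..b} (\<lambda>t. h t * (\<i> * of_real t) / (z - \<i> * of_real t))) \<longlongrightarrow> integral {a..b} h + 0) at_infinity"
    by (intro tendsto_add tendsto_const tendsto_cauchy_integral_at_infinity ab continuous_intros h)
  then show "((\<lambda>z. integral {a..b} h + integral {a..b} (\<lambda>t. h t * (\<i> * of_real t) / (z - \<i> * of_real t))) \<longlongrightarrow> integral {a..b} h) at_infinity"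
    by simp
  show "eventually (\<lambda>z. integral {a..b} h + integral {a..b} (\<lambda>t. h t * (\<i> * of_real t) / (z - \<i> * of_real t))
      = z * integral {a..b} (\<lambda>t. h t / (z - \<i> * of_real t))) at_infinity"
    unfolding eventually_at_infinity
  proof (intro exI[of _ "b + 1"] allI impI)
    fix z :: complex assume z: "b + 1 \<le> norm z"
    have nz: "z - \<i> * of_real t \<noteq> 0" if t: "t \<in> {a..b}" for t
    proof
      assume "z - \<i> * of_real t = 0"
      then have "norm z = norm (\<i> * of_real t)" by simp
      then show False using t z ab by (simp add: norm_mult)
    qed
    have "integral {a..b} h + integral {a..b} (\<lambda>t. h t * (\<i> * of_real t) / (z - \<i> * of_real t))
        = integral {a..b} (\<lambda>t. h t + h t * (\<i> * of_real t) / (z - \<i> * of_real t))"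
      using nz by (intro integral_add[symmetric] integrable_continuous_real continuous_intros h) blast
    also have "\<dots> = integral {a..b} (\<lambda>t. z * (h t / (z - \<i> * of_real t)))"
    proof (rule integral_cong)
      fix t assume "t \<in> {a..b}"
      then have "h t = h t * (z - \<i> * of_real t) / (z - \<i> * of_real t)" using nz by simp
      also have "h t * (z - \<i> * of_real t) = z * h t - h t * (\<i> * of_real t)" by (simp add: algebra_simps)
      finally show "h t + h t * (\<i> * of_real t) / (z - \<i> * of_real t) = z * (h t / (z - \<i> * of_real t))"
        by (simp add: diff_divide_distrib eq_diff_eq)
    qed
    also have "\<dots> = z * integral {a..b} (\<lambda>t. h t / (z - \<i> * of_real t))" by (rule integral_mult_right)
    finally show "integral {a..b} h + integral {a..b} (\<lambda>t. h t * (\<i> * of_real t) / (z - \<i> * of_real t))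
      = z * integral {a..b} (\<lambda>t. h t / (z - \<i> * of_real t))" .
  qed
qed

section \<open>Continuation across the segment\<close>

lemma simple_linepath_upper_seg:
  assumes "a < b"
  shows "path_image (linepath (\<i> * of_real a) (\<i> * of_real b)) = upper_seg a b"
    "valid_path (linepath (\<i> * of_real a) (\<i> * of_real b))"
    "simple_path (linepath (\<i> * of_real a) (\<i> * of_real b))"
  using assms by (auto simp: upper_seg_def intro!: arc_imp_simple_path arc_linepath)

lemma has_integral_deriv_segment:
  assumes "convex S" "open S" "g holomorphic_on S" "w \<in> S" "z \<in> S"
  shows "((\<lambda>u. deriv g (w + of_real u * (z - w)) * (z - w)) has_integral g z - g w) {0..1}"
proof -
  have "(g has_field_derivative deriv g x) (at x within S)" if "x \<in> S" for x
    using holomorphic_derivI[OF assms(3,2) that] .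
  moreover have "path_image (linepath w z) \<subseteq> S"
    using closed_segment_subset[OF assms(4,5,1)] by simp
  ultimately have "(deriv g has_contour_integral (g (pathfinish (linepath w z)) - g (pathstart (linepath w z)))) (linepath w z)"
    by (intro contour_integral_primitive[where S = S]) auto
  then have "((\<lambda>u. deriv g (linepath w z u) * (z - w)) has_integral (g z - g w)) {0..1}"
    unfolding has_contour_integral_linepath by simp
  moreover have "linepath w z u = w + of_real u * (z - w)" for u
    by (simp add: linepath_def scaleR_conv_of_real algebra_simps)
  ultimately show ?thesis by simp
qed

text \<open>The commutator of multiplication by \<open>g\<close> with a Cauchy integral has no
  singularity on the segment: the difference quotient of \<open>g\<close> is continuous there, so
  the integral is continuous on \<open>S\<close>, holomorphic off the segment, and the segment is
  removable. It permits freezing a density \<open>g (\<i> * t)\<close> at \<open>g z\<close> up to a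
  holomorphic error.\<close>

lemma difference_quotient_integral_extension:
  assumes "a < b" "convex S" "open S" "upper_seg a b \<subseteq> S" "g holomorphic_on S" "continuous_on {a..b} c"
  shows "\<exists>K. K holomorphic_on S \<and>
    (\<forall>z\<in>S - upper_seg a b. K z = integral {a..b} (\<lambda>t. c t * (g z - g (\<i> * of_real t)) / (z - \<i> * of_real t)))"
proof -
  \<comment> \<open>The difference quotient of \<open>g\<close> between \<open>\<i> * t\<close> and
    \<open>z\<close>, written as an average of the derivative so that it stays meaningful and
    continuous for \<open>z\<close> on the segment. Convexity of \<open>S\<close> keeps the
    averaging path inside.\<close>
  define Q where "Q z t = integral {0..1} (\<lambda>u. deriv g (\<i> * of_real t + of_real u * (z - \<i> * of_real t)))" for z and t :: real
  define K where "K z = integral {a..b} (\<lambda>t. c t * Q z t)" for z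
  have it: "\<i> * of_real t \<in> S" if "t \<in> {a..b}" for t
    using ii_in_upper_seg[OF that] assms(4) by blast
  have mem: "\<i> * of_real t + of_real u * (z - \<i> * of_real t) \<in> S" if "z \<in> S" "t \<in> {a..b}" "u \<in> {0..1}" for z t u
  proof -
    have "(1 - u) *\<^sub>R (\<i> * of_real t) + u *\<^sub>R z \<in> S"
      using convexD[OF assms(2) it[OF that(2)] that(1), of "1 - u" u] that(3) by simp
    then show ?thesis by (simp add: scaleR_conv_of_real algebra_simps)
  qed
  have cdg: "continuous_on S (deriv g)"
    using holomorphic_deriv[OF assms(5,3)] holomorphic_on_imp_continuous_on by blast
  have cQ0: "continuous_on ((S \<times> {a..b}) \<times> cbox 0 1)
      (\<lambda>(p, u). deriv g (\<i> * of_real (snd p) + of_real u * (fst p - \<i> * of_real (snd p))))"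
    unfolding case_prod_unfold
    by (intro continuous_on_compose2[OF cdg] continuous_intros) (auto intro!: mem)
  have cQ: "continuous_on (S \<times> {a..b}) (\<lambda>p. Q (fst p) (snd p))"
    using integral_continuous_on_param[OF cQ0] by (simp add: Q_def)
  have "continuous_on (S \<times> cbox a b) (\<lambda>(z, t). c t * Q z t)"
    unfolding case_prod_unfold
    by (intro continuous_on_mult continuous_on_compose2[OF assms(6)] continuous_intros)
      (use cQ in auto)
  then have cK: "continuous_on S K"
    using integral_continuous_on_param[of S a b "\<lambda>z t. c t * Q z t"] by (simp add: K_def)
  have Kz: "K z = integral {a..b} (\<lambda>t. c t * (g z - g (\<i> * of_real t)) / (z - \<i> * of_real t))" if z: "z \<in> S - upper_seg a b" for z
    unfolding K_def
  proof (rule integral_cong)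
    fix t assume t: "t \<in> {a..b}"
    have nz: "z - \<i> * of_real t \<noteq> 0" using not_upper_seg_imp_neq z t by blast
    have "integral {0..1} (\<lambda>u. deriv g (\<i> * of_real t + of_real u * (z - \<i> * of_real t)) * (z - \<i> * of_real t)) = g z - g (\<i> * of_real t)"
      using has_integral_deriv_segment[OF assms(2,3,5) it[OF t], of z] z by (intro integral_unique) blast
    then have "Q z t * (z - \<i> * of_real t) = g z - g (\<i> * of_real t)"
      unfolding Q_def by (simp only: integral_mult_left)
    then show "c t * Q z t = c t * (g z - g (\<i> * of_real t)) / (z - \<i> * of_real t)"
      using nz by (metis nonzero_mult_div_cancel_right mult.assoc)
  qed
  have cont_it: "continuous_on {a..b} (\<lambda>t. g (\<i> * of_real t))"
    by (intro continuous_on_compose2[OF holomorphic_on_imp_continuous_on[OF assms(5)]] continuous_intros) (use it in blast)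
  \<comment> \<open>Off the segment the integral splits into \<open>g\<close> times one Cauchy
    integral minus another, both holomorphic.\<close>
  have "(\<lambda>z. g z * integral {a..b} (\<lambda>t. c t / (z - \<i> * of_real t))
      - integral {a..b} (\<lambda>t. (c t * g (\<i> * of_real t)) / (z - \<i> * of_real t))) holomorphic_on (S - upper_seg a b)"
    by (intro holomorphic_on_diff holomorphic_on_mult holomorphic_on_subset[OF holomorphic_on_cauchy_integral]
        holomorphic_on_subset[OF assms(5)] continuous_intros assms(6) cont_it) blast+
  then have "K holomorphic_on (S - upper_seg a b)"
  proof (rule holomorphic_transform)
    fix z assume z: "z \<in> S - upper_seg a b"
    have nz: "z - \<i> * of_real t \<noteq> 0" if "t \<in> {a..b}" for t using not_upper_seg_imp_neq z that by blast
    have "g z * integral {a..b} (\<lambda>t. c t / (z - \<i> * of_real t))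
        - integral {a..b} (\<lambda>t. (c t * g (\<i> * of_real t)) / (z - \<i> * of_real t))
      = integral {a..b} (\<lambda>t. g z * (c t / (z - \<i> * of_real t)) - (c t * g (\<i> * of_real t)) / (z - \<i> * of_real t))"
      unfolding integral_mult_right[symmetric] using nz
      by (intro integral_diff[symmetric] integrable_continuous_real continuous_intros assms(6) cont_it) blast+
    also have "\<dots> = K z" unfolding Kz[OF z]
      by (intro integral_cong) (simp add: diff_divide_distrib right_diff_distrib mult.commute)
    finally show "g z * integral {a..b} (\<lambda>t. c t / (z - \<i> * of_real t))
        - integral {a..b} (\<lambda>t. (c t * g (\<i> * of_real t)) / (z - \<i> * of_real t)) = K z" .
  qed
  then have "K holomorphic_on S"
    using holomorphic_on_removable_path[OF assms(3) simple_linepath_upper_seg(2,3)[OF assms(1)] cK]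
      simple_linepath_upper_seg(1)[OF assms(1)] by simp
  then show ?thesis using Kz by blast
qed

lemma tendsto_off_upper_seg_if_sides:
  fixes f :: "complex \<Rightarrow> complex"
  assumes "a < t" "t < b"
    and "(f \<longlongrightarrow> l) (at (\<i> * of_real t) within {w. Re w < 0})" "(f \<longlongrightarrow> l) (at (\<i> * of_real t) within {w. 0 < Re w})"
  shows "(f \<longlongrightarrow> l) (at (\<i> * of_real t) within - upper_seg a b)"
proof (rule Lim_transform_within_set)
  show "(f \<longlongrightarrow> l) (at (\<i> * of_real t) within {w. Re w < 0} \<union> {w. 0 < Re w})"
    using assms(3,4) by (rule Lim_Un)
  \<comment> \<open>In a ball of this radius the imaginary axis belongs to the segment, so the
    complement of the segment consists of the two open half-planes.\<close>
  define r where "r = min (t - a) (b - t)"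
  have r: "r > 0" using assms by (simp add: r_def)
  have "w \<in> {w. Re w < 0} \<union> {w. 0 < Re w} \<longleftrightarrow> w \<in> - upper_seg a b" if "w \<in> ball (\<i> * of_real t) r" for w
  proof -
    have "\<bar>Im (\<i> * of_real t - w)\<bar> < r"
      using that abs_Im_le_cmod[of "\<i> * of_real t - w"] by (simp add: dist_norm)
    then have "a \<le> Im w" "Im w \<le> b" by (auto simp: r_def)
    then show ?thesis using assms by (auto simp: upper_seg_eq)
  qed
  then show "eventually (\<lambda>w. w \<in> {w. Re w < 0} \<union> {w. 0 < Re w} \<longleftrightarrow> w \<in> - upper_seg a b) (at (\<i> * of_real t))"
    unfolding eventually_at_topological
    by (intro exI[of _ "ball (\<i> * of_real t) r"]) (use r in \<open>simp del: mem_ball add: centre_in_ball\<close>)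
qed

text \<open>Matching side limits remove the interior of the segment, and growth weaker than a simple
  pole makes the endpoints removable. The endpoint hypothesis controls \<open>f\<close> only off the
  segment, whereas Riemann's theorem needs a full punctured neighbourhood; the bound has to be
  carried over to the extension on the segment.\<close>

lemma holomorphic_extension_across_upper_seg:
  assumes ab: "a < b" and S: "open S" "upper_seg a b \<subseteq> S" and hol: "f holomorphic_on (S - upper_seg a b)"
    and jump: "\<And>t. t \<in> {a<..<b} \<Longrightarrow> \<exists>l. (f \<longlongrightarrow> l) (at (\<i> * of_real t) within {w. Re w < 0})
          \<and> (f \<longlongrightarrow> l) (at (\<i> * of_real t) within {w. 0 < Re w})"
    and ends: "\<And>p. p \<in> {\<i> * of_real a, \<i> * of_real b} \<Longrightarrow>
          ((\<lambda>w. (w - p) * f w) \<longlongrightarrow> 0) (at p within - upper_seg a b)"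
  shows "\<exists>F. F holomorphic_on S \<and> (\<forall>z\<in>S - upper_seg a b. F z = f z)"
proof -
  let ?E = "{\<i> * of_real a, \<i> * of_real b} :: complex set"
  let ?U = "upper_seg a b"
  define S0 where "S0 = S - ?E"
  have opS0: "open S0" using S by (simp add: S0_def finite_imp_closed open_Diff)
  have Esub: "?E \<subseteq> ?U" using ab by (auto intro!: ii_in_upper_seg)
  have z_eq: "z = \<i> * of_real (Im z) \<and> Im z \<in> {a..b}" if "z \<in> ?U" for z
    using that ab by (auto simp: upper_seg_eq complex_eq_iff)
  have hol0: "f holomorphic_on S0 - ?U" by (rule holomorphic_on_subset[OF hol]) (auto simp: S0_def)
  have lim0: "z islimpt - ?U \<and> (\<exists>l. (f \<longlongrightarrow> l) (at z within - ?U))" if z: "z \<in> S0 \<inter> ?U" for z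
  proof -
    define t where "t = Im z"
    have t: "z = \<i> * of_real t" "t \<in> {a..b}" using z_eq z by (auto simp: t_def)
    have "t \<noteq> a" "t \<noteq> b" using z t by (auto simp: S0_def)
    then have t': "t \<in> {a<..<b}" using t by auto
    obtain l where "(f \<longlongrightarrow> l) (at (\<i> * of_real t) within {w. Re w < 0})" "(f \<longlongrightarrow> l) (at (\<i> * of_real t) within {w. 0 < Re w})"
      using jump[OF t'] by (elim exE conjE)
    then have "(f \<longlongrightarrow> l) (at z within - ?U)"
      unfolding t(1) using t' by (intro tendsto_off_upper_seg_if_sides) auto
    moreover have "z islimpt - ?U" by (rule islimpt_off_upper_seg(3)) (use ab t in auto)
    ultimately show "z islimpt - ?U \<and> (\<exists>l. (f \<longlongrightarrow> l) (at z within - ?U))" by (intro conjI exI)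
  qed
  obtain F0 where F0: "F0 holomorphic_on S0" "\<And>z. z \<in> S0 - ?U \<Longrightarrow> F0 z = f z"
    using holomorphic_extension_across_path[OF opS0 simple_linepath_upper_seg(2,3)[OF ab],
        unfolded simple_linepath_upper_seg(1)[OF ab], OF hol0 lim0] by metis
  have lim: "((\<lambda>w. (w - p) * F0 w) \<longlongrightarrow> 0) (at p)" if p: "p \<in> ?E" for p
  proof (rule LIM_I)
    fix e :: real assume e: "0 < e"
    have "p \<in> S" using p Esub S(2) by auto
    then obtain d2 where d2: "d2 > 0" "ball p d2 \<subseteq> S" using S(1) open_contains_ball by metis
    have "eventually (\<lambda>w. dist ((w - p) * f w) 0 < e / 2) (at p within - ?U)"
      using tendstoD[OF ends[OF p], of "e / 2"] e by simp
    then obtain d1 where d1: "d1 > 0" "\<And>w. w \<in> - ?U \<Longrightarrow> w \<noteq> p \<Longrightarrow> dist w p < d1 \<Longrightarrow> dist ((w - p) * f w) 0 < e / 2"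
      unfolding eventually_at by auto
    \<comment> \<open>\<open>d \<le> b - a\<close> keeps the other endpoint out of the ball.\<close>
    define d where "d = min (min d1 d2) (b - a)"
    have d: "d > 0" "d \<le> d1" "d \<le> d2" "d \<le> b - a" using d1 d2 ab by (auto simp: d_def)
    have inS0: "w \<in> S0" if w: "w \<noteq> p" "dist w p < d" for w
    proof -
      have "dist (\<i> * of_real a) (\<i> * of_real b :: complex) = b - a"
        using ab by (simp add: dist_norm norm_mult right_diff_distrib[symmetric] of_real_diff[symmetric] del: of_real_diff)
      then have "w \<notin> ?E" using w d p by (auto simp: dist_commute)
      moreover have "w \<in> S" using w d d2 by (auto simp: dist_commute)
      ultimately show ?thesis by (simp add: S0_def)
    qed
    have off: "norm ((w - p) * F0 w) \<le> e / 2" if w: "w \<noteq> p" "dist w p < d" "w \<in> - ?U" for w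
      using d1(2)[of w] F0(2)[of w] inS0[OF w(1,2)] w d by simp
    have "norm ((w - p) * F0 w - 0) < e" if w: "w \<noteq> p" "norm (w - p) < d" for w
    proof -
      have wd: "dist w p < d" using w by (simp add: dist_norm)
      have "norm ((w - p) * F0 w) \<le> e / 2"
      proof (cases "w \<in> ?U")
        case False
        then show ?thesis using off w wd by simp
      next
        case True
        \<comment> \<open>On the segment the extension is a limit of values off it, so the bound
          persists in non-strict form.\<close>
        show ?thesis
        proof (rule norm_le_of_limit_point[where f = "\<lambda>v. (v - p) * F0 v" and U = "ball p d - {p}" and S = "- ?U"])
          have "F0 holomorphic_on S0" "w \<in> S0" using F0 inS0 w wd by auto
          then have "isCont F0 w"
            using holomorphic_on_imp_continuous_on continuous_on_eq_continuous_at[OF opS0] by blast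
          then show "isCont (\<lambda>w. (w - p) * F0 w) w" by (intro continuous_intros)
          show "open (ball p d - {p})" by (simp add: open_delete)
          show "w \<in> ball p d - {p}" using w wd by (simp add: dist_commute)
          show "w islimpt - ?U" by (rule islimpt_off_upper_seg(3)) (use z_eq[OF True] ab in \<open>auto simp: complex_eq_iff\<close>)
          show "norm ((v - p) * F0 v) \<le> e / 2" if "v \<in> (ball p d - {p}) \<inter> - ?U" for v
            using off[of v] that by (simp add: dist_commute)
        qed
      qed
      then show ?thesis using e by simp
    qed
    then show "\<exists>s>0. \<forall>x. x \<noteq> p \<and> norm (x - p) < s \<longrightarrow> norm ((x - p) * F0 x - 0) < e"
      using d(1) by (intro exI[of _ d]) simp
  qed
  obtain F where F: "F holomorphic_on S" "\<forall>z\<in>S - ?E. F z = F0 z"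
    using holomorphic_extension_finite[of ?E S F0] S Esub F0(1) lim unfolding S0_def by auto
  have "F z = f z" if "z \<in> S - ?U" for z
  proof -
    have z: "z \<in> S - ?E" using that Esub by blast
    then have "F z = F0 z" using F(2) by (rule bspec[rotated])
    also have "\<dots> = f z" by (rule F0(2)) (use z that in \<open>simp add: S0_def\<close>)
    finally show ?thesis .
  qed
  with F(1) show ?thesis by blast
qed

section \<open>The Cauchy integral of a constant density\<close>

lemma tendsto_norm_mult_ln_norm:
  fixes p :: complex
  shows "((\<lambda>z. norm (z - p) * ln (norm (z - p))) \<longlongrightarrow> 0) (at p)"
proof -
  have "((\<lambda>x::real. ln (inverse x) / inverse x) \<longlongrightarrow> 0) (at_right 0)"
    by (rule filterlim_compose[OF ln_x_over_x_tendsto_0 filterlim_inverse_at_top_right])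
  then have "((\<lambda>x::real. - (ln (inverse x) / inverse x)) \<longlongrightarrow> - 0) (at_right 0)" by (rule tendsto_minus)
  moreover have "eventually (\<lambda>x::real. - (ln (inverse x) / inverse x) = x * ln x) (at_right 0)"
    unfolding eventually_at_right_field by (intro exI[of _ 1]) (auto simp: ln_inverse divide_inverse)
  ultimately have "((\<lambda>x::real. x * ln x) \<longlongrightarrow> 0) (at_right 0)"
    using Lim_transform_eventually by fastforce
  moreover have "filterlim (\<lambda>z. norm (z - p)) (at_right 0) (at p)"
    unfolding filterlim_at
  proof (intro conjI)
    have "((\<lambda>z. norm (z - p)) \<longlongrightarrow> norm (p - p)) (at p)" by (intro tendsto_intros)
    then show "((\<lambda>z. norm (z - p)) \<longlongrightarrow> 0) (at p)" by simp
    show "eventually (\<lambda>z. norm (z - p) \<in> {0<..} \<and> norm (z - p) \<noteq> 0) (at p)"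
      by (auto simp: eventually_at_filter)
  qed
  ultimately show ?thesis by (rule filterlim_compose)
qed

text \<open>For \<open>a < b\<close> this is a Moebius map that carries the segment onto the branch
  cut of \<open>Ln\<close>, with \<open>\<i> * b\<close> going to 0 and \<open>\<i> * a\<close> to
  infinity.\<close>

definition seg_ratio :: "real \<Rightarrow> real \<Rightarrow> complex \<Rightarrow> complex" where
  "seg_ratio a b z = (\<i> * of_real b - z) / (\<i> * of_real a - z)"

text \<open>The antiderivative in \<open>t\<close> is minus the logarithm of the same ratio with
  upper endpoint \<open>\<i> * t\<close>; the principal branch is legitimate for all
  \<open>t\<close> at once.\<close>

lemma integral_segment_kernel:
  assumes "a < b" "z \<notin> upper_seg a b"
  shows "integral {a..b} (\<lambda>t. \<i> / (z - \<i> * of_real t)) = - Ln (seg_ratio a b z)"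
proof -
  have nz: "z - \<i> * of_real t \<noteq> 0" if "t \<in> {a..b}" for t using not_upper_seg_imp_neq assms that by blast
  have az: "\<i> * of_real a - z \<noteq> 0" using nz[of a] assms(1) by auto
  \<comment> \<open>A value on the cut would make \<open>z\<close> a convex combination of
    \<open>\<i> * a\<close> and \<open>\<i> * t\<close>, hence a point of the segment.\<close>
  have cut: "(\<i> * of_real t - z) / (\<i> * of_real a - z) \<notin> \<real>\<^sub>\<le>\<^sub>0" if t: "t \<in> {a..b}" for t
  proof
    assume "(\<i> * of_real t - z) / (\<i> * of_real a - z) \<in> \<real>\<^sub>\<le>\<^sub>0"
    then obtain k where k: "k \<le> 0" "(\<i> * of_real t - z) / (\<i> * of_real a - z) = of_real k"
      by (elim nonpos_Reals_cases)
    then have eq: "\<i> * of_real t - z = of_real k * (\<i> * of_real a - z)" using az by (simp add: divide_eq_eq)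
    have "- Re z = - k * Re z" "t - Im z = k * (a - Im z)"
      using arg_cong[OF eq, of Re] arg_cong[OF eq, of Im] by auto
    then have "(1 - k) * Re z = 0" "(1 - k) * Im z = t - k * a" by (auto simp: algebra_simps)
    then have re: "Re z = 0" and im: "Im z = (t - k * a) / (1 - k)" using k(1) by (auto simp: field_simps)
    have "a * (1 - k) \<le> t - k * a" "t - k * a \<le> b * (1 - k)"
      using t k(1) assms(1) mult_right_mono_neg[of a b k] by (auto simp: algebra_simps)
    then have "a \<le> Im z" "Im z \<le> b" unfolding im using k(1) by (auto simp: pos_le_divide_eq pos_divide_le_eq)
    then show False using assms re by (simp add: upper_seg_eq)
  qed
  have "((\<lambda>t. \<i> / (z - \<i> * of_real t)) has_integral
     (- Ln ((\<i> * of_real b - z) / (\<i> * of_real a - z)) - - Ln ((\<i> * of_real a - z) / (\<i> * of_real a - z)))) {a..b}"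
  proof (rule fundamental_theorem_of_calculus)
    fix t assume t: "t \<in> {a..b}"
    have "((\<lambda>w. (\<i> * w - z) / (\<i> * of_real a - z)) has_field_derivative \<i> / (\<i> * of_real a - z)) (at (of_real t))"
      using az by (auto intro!: derivative_eq_intros)
    from DERIV_minus[OF DERIV_chain2[OF has_field_derivative_Ln[OF cut[OF t]] this]]
    have "((\<lambda>w. - Ln ((\<i> * w - z) / (\<i> * of_real a - z))) has_field_derivative
        - (inverse ((\<i> * of_real t - z) / (\<i> * of_real a - z)) * (\<i> / (\<i> * of_real a - z)))) (at (of_real t))" .
    also have "inverse ((\<i> * of_real t - z) / (\<i> * of_real a - z)) * (\<i> / (\<i> * of_real a - z)) = \<i> / (\<i> * of_real t - z)"
      using az by simp
    also have "- (\<i> / (\<i> * of_real t - z)) = \<i> / (z - \<i> * of_real t)" using minus_divide_right[of "\<i>" "\<i> * of_real t - z"] by simp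
    finally show "((\<lambda>t. - Ln ((\<i> * of_real t - z) / (\<i> * of_real a - z))) has_vector_derivative \<i> / (z - \<i> * of_real t)) (at t within {a..b})"
      by (rule has_vector_derivative_real_field)
  qed (use assms in auto)
  then show ?thesis using az by (simp add: integral_unique seg_ratio_def)
qed

lemma Im_seg_ratio:
  assumes "a < b"
  shows "Re z < 0 \<Longrightarrow> 0 < Im (seg_ratio a b z)" "0 < Re z \<Longrightarrow> Im (seg_ratio a b z) < 0"
proof -
  have "Im (seg_ratio a b z) = - Re z * (b - a) / ((Re z)\<^sup>2 + (a - Im z)\<^sup>2)"
    by (simp add: seg_ratio_def Im_divide algebra_simps)
  moreover have "0 < (Re z)\<^sup>2 + (a - Im z)\<^sup>2" if "Re z \<noteq> 0" using that by (simp add: add_pos_nonneg)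
  ultimately show "Re z < 0 \<Longrightarrow> 0 < Im (seg_ratio a b z)" "0 < Re z \<Longrightarrow> Im (seg_ratio a b z) < 0"
    using assms by (auto intro!: divide_pos_pos divide_neg_pos mult_neg_pos mult_pos_pos simp del: mult_minus_left minus_mult_left)
qed

text \<open>Plemelj's formula for a constant density. At interior points of the segment
  \<open>- seg_ratio\<close> is positive, so \<open>Ln (- seg_ratio a b z)\<close> is continuous
  across it. It differs from \<open>Ln (seg_ratio a b z)\<close> by \<open>\<i> * pi\<close> with a
  sign given by the imaginary part, that is, by the side of the segment.\<close>

lemma segment_kernel_boundary_values:
  assumes "a < t" "t < b"
  obtains l where
    "((\<lambda>z. integral {a..b} (\<lambda>s. \<i> / (z - \<i> * of_real s))) \<longlongrightarrow> l - \<i> * of_real pi) (at (\<i> * of_real t) within {w. Re w < 0})"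
    "((\<lambda>z. integral {a..b} (\<lambda>s. \<i> / (z - \<i> * of_real s))) \<longlongrightarrow> l + \<i> * of_real pi) (at (\<i> * of_real t) within {w. 0 < Re w})"
proof -
  let ?p = "\<i> * of_real t :: complex"
  have ab: "a < b" using assms by simp
  have "seg_ratio a b ?p = (\<i> * of_real (b - t)) / (\<i> * of_real (a - t))"
    by (simp add: seg_ratio_def right_diff_distrib)
  also have "\<dots> = of_real ((b - t) / (a - t))" by simp
  also have "(b - t) / (a - t) = - ((b - t) / (t - a))" using minus_divide_right[of "b - t" "t - a"] by simp
  finally have "- seg_ratio a b ?p = of_real ((b - t) / (t - a))" by simp
  then have "- seg_ratio a b ?p \<notin> \<real>\<^sub>\<le>\<^sub>0" using assms by (simp add: divide_le_0_iff del: of_real_divide)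
  moreover have "\<i> * of_real a - ?p \<noteq> 0" using assms by simp
  ultimately have "isCont (\<lambda>z. - Ln (- seg_ratio a b z)) ?p"
    unfolding seg_ratio_def by (intro continuous_intros) auto
  then have lim: "((\<lambda>z. - Ln (- seg_ratio a b z)) \<longlongrightarrow> - Ln (- seg_ratio a b ?p)) (at ?p within S)" for S
    unfolding isCont_def by (rule Lim_at_imp_Lim_at_within)
  have off: "z \<notin> upper_seg a b" if "Re z \<noteq> 0" for z using that ab by (simp add: upper_seg_eq)
  have L: "integral {a..b} (\<lambda>s. \<i> / (z - \<i> * of_real s)) = - Ln (- seg_ratio a b z) - \<i> * of_real pi" if "Re z < 0" for z
    using Im_seg_ratio(1)[OF ab that] Ln_minus[of "- seg_ratio a b z"] integral_segment_kernel[OF ab off[of z]] that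
    by (cases "seg_ratio a b z = 0") auto
  have R: "integral {a..b} (\<lambda>s. \<i> / (z - \<i> * of_real s)) = - Ln (- seg_ratio a b z) + \<i> * of_real pi" if "0 < Re z" for z
    using Im_seg_ratio(2)[OF ab that] Ln_minus[of "- seg_ratio a b z"] integral_segment_kernel[OF ab off[of z]] that
    by (cases "seg_ratio a b z = 0") auto
  show thesis
  proof (rule that)
    show "((\<lambda>z. integral {a..b} (\<lambda>s. \<i> / (z - \<i> * of_real s))) \<longlongrightarrow> - Ln (- seg_ratio a b ?p) - \<i> * of_real pi) (at ?p within {w. Re w < 0})"
      by (rule Lim_transform_eventually[OF tendsto_diff[OF lim tendsto_const]]) (simp add: eventually_at_filter L)
    show "((\<lambda>z. integral {a..b} (\<lambda>s. \<i> / (z - \<i> * of_real s))) \<longlongrightarrow> - Ln (- seg_ratio a b ?p) + \<i> * of_real pi) (at ?p within {w. 0 < Re w})"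
      by (rule Lim_transform_eventually[OF tendsto_add[OF lim tendsto_const]]) (simp add: eventually_at_filter R)
  qed
qed

text \<open>The growth is only logarithmic: the real part of the logarithm is a difference of
  logarithms of the distances to the endpoints, and the imaginary part is bounded by
  \<open>pi\<close>.\<close>

lemma segment_kernel_endpoint:
  assumes "a < b" "p \<in> {\<i> * of_real a, \<i> * of_real b}"
  shows "((\<lambda>z. (z - p) * integral {a..b} (\<lambda>s. \<i> / (z - \<i> * of_real s))) \<longlongrightarrow> 0) (at p within - upper_seg a b)"
proof -
  let ?G = "\<lambda>z. norm (z - p) * \<bar>ln (norm (z - \<i> * of_real b))\<bar> + norm (z - p) * \<bar>ln (norm (z - \<i> * of_real a))\<bar> + norm (z - p) * pi"
  have trm: "((\<lambda>z. norm (z - p) * \<bar>ln (norm (z - q))\<bar>) \<longlongrightarrow> 0) (at p)" for q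
  proof (cases "q = p")
    case True
    have "((\<lambda>z. \<bar>norm (z - p) * ln (norm (z - p))\<bar>) \<longlongrightarrow> \<bar>0\<bar>) (at p)"
      by (intro tendsto_rabs tendsto_norm_mult_ln_norm)
    then show ?thesis using True by (simp add: abs_mult)
  next
    case False
    then have "((\<lambda>z. norm (z - p) * \<bar>ln (norm (z - q))\<bar>) \<longlongrightarrow> norm (p - p) * \<bar>ln (norm (p - q))\<bar>) (at p)"
      by (intro tendsto_intros) auto
    then show ?thesis by simp
  qed
  have pi: "((\<lambda>z. norm (z - p) * pi) \<longlongrightarrow> norm (p - p) * pi) (at p)" by (intro tendsto_intros)
  have "(?G \<longlongrightarrow> 0 + 0 + norm (p - p) * pi) (at p)" by (intro tendsto_add trm pi)
  then have "(?G \<longlongrightarrow> 0) (at p within - upper_seg a b)" by (simp add: Lim_at_imp_Lim_at_within)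
  moreover have "eventually (\<lambda>z. norm ((z - p) * integral {a..b} (\<lambda>s. \<i> / (z - \<i> * of_real s))) \<le> ?G z) (at p within - upper_seg a b)"
    unfolding eventually_at_filter
  proof (rule always_eventually, intro allI impI)
    fix z assume "z \<in> - upper_seg a b"
    then have z: "z \<notin> upper_seg a b" by simp
    have nz: "\<i> * of_real a - z \<noteq> 0" "\<i> * of_real b - z \<noteq> 0"
      using not_upper_seg_imp_neq[OF z, of a] not_upper_seg_imp_neq[OF z, of b] assms(1) by auto
    then have q: "seg_ratio a b z \<noteq> 0" by (simp add: seg_ratio_def)
    have "\<bar>Re (Ln (seg_ratio a b z))\<bar> = \<bar>ln (norm (z - \<i> * of_real b)) - ln (norm (z - \<i> * of_real a))\<bar>"
      using nz q by (simp add: Re_Ln seg_ratio_def norm_divide ln_div norm_minus_commute)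
    moreover have "\<bar>Im (Ln (seg_ratio a b z))\<bar> \<le> pi"
      using mpi_less_Im_Ln[OF q] Im_Ln_le_pi[OF q] by linarith
    ultimately have "norm (Ln (seg_ratio a b z)) \<le> \<bar>ln (norm (z - \<i> * of_real b))\<bar> + \<bar>ln (norm (z - \<i> * of_real a))\<bar> + pi"
      using cmod_le[of "Ln (seg_ratio a b z)"] by linarith
    then have "norm (z - p) * norm (Ln (seg_ratio a b z)) \<le> norm (z - p) * (\<bar>ln (norm (z - \<i> * of_real b))\<bar> + \<bar>ln (norm (z - \<i> * of_real a))\<bar> + pi)"
      by (rule mult_left_mono) simp
    then show "norm ((z - p) * integral {a..b} (\<lambda>s. \<i> / (z - \<i> * of_real s))) \<le> ?G z"
      unfolding integral_segment_kernel[OF assms(1) z] by (simp add: norm_mult distrib_left)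
  qed
  ultimately show ?thesis by (rule Lim_null_comparison[rotated])
qed

lemma vector_matrix_mult_mat22 [simp]:
  fixes v :: "complex^2"
  shows "(v v* mat22 a b c d) $ 1 = v $ 1 * a + v $ 2 * c"
  "(v v* mat22 a b c d) $ 2 = v $ 1 * b + v $ 2 * d"
  by (simp_all add: vector_matrix_mult_def mat22_def sum_2 mult.commute)

subsection \<open>The soliton problem\<close>

lemma normalized_at_infinity_tendsto:
  fixes F :: "complex \<Rightarrow> complex^2"
  assumes "normalized_at_infinity F"
  shows "((\<lambda>z. F z $ 1) \<longlongrightarrow> 1) at_infinity" "((\<lambda>z. F z $ 2) \<longlongrightarrow> 1) at_infinity"
proof -
  obtain c where c: "eventually (\<lambda>z. norm (norm (F z - vector [1, 1])) \<le> c * norm (1 / norm z)) at_infinity"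
    using assms unfolding normalized_at_infinity_def by (elim landau_o.bigE)
  have "((\<lambda>z::complex. c / norm z) \<longlongrightarrow> 0) at_infinity"
    by (intro tendsto_divide_0[OF tendsto_const] filterlim_at_top_imp_at_infinity filterlim_norm_at_top)
  moreover have "eventually (\<lambda>z. norm (F z - vector [1, 1]) \<le> c / norm z) at_infinity"
    using c by (rule eventually_mono) simp
  ultimately have "((\<lambda>z. F z - vector [1, 1]) \<longlongrightarrow> 0) at_infinity" by (rule Lim_null_comparison[rotated])
  then have "((\<lambda>z. (F z - vector [1, 1]) $ i + (vector [1, 1] :: complex^2) $ i) \<longlongrightarrow> (0 :: complex^2) $ i + (vector [1, 1] :: complex^2) $ i) at_infinity" for i
    by (intro tendsto_add tendsto_vec_nth tendsto_const)
  from this[of 1] this[of 2] show "((\<lambda>z. F z $ 1) \<longlongrightarrow> 1) at_infinity" "((\<lambda>z. F z $ 2) \<longlongrightarrow> 1) at_infinity"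
    by simp_all
qed

lemma soliton_pole_node: "soliton_pole a b N j = \<i> * of_real (riemann_node a b N j)"
  by (simp add: soliton_pole_def riemann_node_def)

lemma soliton_poles_eq:
  "soliton_poles a b N = (\<lambda>j. \<i> * of_real (riemann_node a b N j)) ` {1..N} \<union> (\<lambda>j. - \<i> * of_real (riemann_node a b N j)) ` {1..N}"
  unfolding soliton_poles_def by (auto simp: soliton_pole_node image_def)

lemma soliton_poles_subset:
  assumes "a \<le> b"
  shows "soliton_poles a b N \<subseteq> upper_seg a b \<union> lower_seg a b"
  unfolding soliton_poles_eq using riemann_node_in[OF assms] by (auto simp: upper_seg_eq[OF assms] lower_seg_eq[OF assms])

lemma finite_soliton_poles: "finite (soliton_poles a b N)"
  by (simp add: soliton_poles_def)

lemma uminus_soliton_poles: "- z \<in> soliton_poles a b N \<longleftrightarrow> z \<in> soliton_poles a b N"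
  unfolding soliton_poles_eq by (auto simp: image_iff minus_equation_iff[of z])

text \<open>\<open>at_most_simple_pole\<close> admits removable singularities, where the residue is
  zero; the limit formula covers both cases.\<close>

lemma residue_of_simple_pole_limit:
  assumes "finite P" "f holomorphic_on (- P)" "at_most_simple_pole f p"
  shows "((\<lambda>z. (z - p) * f z) \<longlongrightarrow> residue f p) (at p)"
proof -
  obtain l where l: "((\<lambda>z. (z - p) * f z) \<longlongrightarrow> l) (at p)"
    using assms(3) unfolding at_most_simple_pole_def by blast
  have "residue f p = l"
  proof (rule residue_simple')
    show "open (- (P - {p}))" by (rule open_Compl[OF finite_imp_closed[OF finite_Diff[OF assms(1)]]])
    show "f holomorphic_on (- (P - {p}) - {p})" by (rule holomorphic_on_subset[OF assms(2)]) auto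
    show "((\<lambda>w. f w * (w - p)) \<longlongrightarrow> l) (at p)" using l by (simp add: mult.commute)
  qed simp
  with l show ?thesis by simp
qed

text \<open>The first component has poles only at the upper nodes, so subtracting 1 and its
  principal parts leaves an entire function that vanishes at infinity, hence zero. The symmetry
  gives the second component as its reflection, and the residue condition at the upper nodes then
  closes into a linear system: \<open>\<i> / (- \<i> * s - \<i> * t) = - 1 / (s + t)\<close> is the
  source of the kernel and its sign.\<close>

lemma soliton_representation:
  fixes M :: "complex \<Rightarrow> complex^2" and r1 :: "complex \<Rightarrow> complex"
  assumes ab: "0 < a" "a < b" and N: "1 \<le> N" and M: "soliton_rhp a b r1 N x M"
    and r1: "\<And>t. t \<in> {a..b} \<Longrightarrow> r1 (\<i> * of_real t) = of_real (pi * R t)"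
  defines "\<rho> \<equiv> \<lambda>t. of_real (R t * exp (- 2 * t * x)) :: complex"
  shows "\<exists>\<phi>. (\<forall>s\<in>{a..b}. \<phi> s + riemann_sum a b N (\<lambda>t. \<rho> t * \<phi> t / of_real (s + t)) = 1)
     \<and> (\<forall>z. z \<notin> soliton_poles a b N \<longrightarrow> M z $ 1 = 1 + \<i> * riemann_sum a b N (\<lambda>t. \<rho> t * \<phi> t / (z - \<i> * of_real t))
           \<and> M z $ 2 = 1 + \<i> * riemann_sum a b N (\<lambda>t. \<rho> t * \<phi> t / (- z - \<i> * of_real t)))"
proof -
  let ?P = "soliton_poles a b N"
  let ?s = "riemann_node a b N"
  define p where "p j = \<i> * of_real (?s j)" for j
  have sp: "soliton_pole a b N j = p j" for j by (simp add: soliton_pole_node p_def)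
  define c where "c j = norming_const a b r1 N j * exp (2 * \<i> * p j * of_real x) / of_nat N" for j
  have sin: "?s j \<in> {a..b}" if "j \<in> {1..N}" for j using riemann_node_in[of a b j N] ab that by auto
  have s0: "0 < ?s j" if "j \<in> {1..N}" for j using sin[OF that] ab by auto
  have P: "?P = p ` {1..N} \<union> (\<lambda>j. - p j) ` {1..N}" by (simp add: soliton_poles_eq p_def)
  have pinj: "p j = p k \<longleftrightarrow> j = k" for j k
    using ab N by (auto simp: p_def riemann_node_def divide_simps)
  have pneg: "- p k \<noteq> p j" if "j \<in> {1..N}" "k \<in> {1..N}" for j k
    using s0[OF that(1)] s0[OF that(2)] by (auto simp: p_def complex_eq_iff)
  define f where "f z = M z $ 1" for z
  have fhol: "f holomorphic_on (- ?P)"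
    using M unfolding soliton_rhp_def row_holomorphic_on_def f_def by blast
  have pole: "at_most_simple_pole f q" if "q \<in> ?P" for q
    using M that unfolding soliton_rhp_def f_def by blast
  have jumps: "((\<lambda>z. M z v* mat22 0 0 (c j) 0) \<longlongrightarrow> row_residue M (p j)) (at (p j))"
    "((\<lambda>z. M z v* mat22 0 (- (norming_const a b r1 N j * exp (- 2 * \<i> * cnj (p j) * of_real x) / of_nat N)) 0 0)
         \<longlongrightarrow> row_residue M (- p j)) (at (- p j))" if "j \<in> {1..N}" for j
  proof -
    have cnj: "cnj (p j) = - p j" by (simp add: p_def)
    have "let p = soliton_pole a b N j; c = norming_const a b r1 N j in
        ((\<lambda>z. M z v* mat22 0 0 (c * exp (2 * \<i> * p * of_real x) / of_nat N) 0)
           \<longlongrightarrow> row_residue M p) (at p) \<and>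
        ((\<lambda>z. M z v* mat22 0 (- (c * exp (- 2 * \<i> * cnj p * of_real x) / of_nat N)) 0 0)
           \<longlongrightarrow> row_residue M (cnj p)) (at (cnj p))"
      using M that unfolding soliton_rhp_def by blast
    note J = this[unfolded Let_def sp]
    show "((\<lambda>z. M z v* mat22 0 0 (c j) 0) \<longlongrightarrow> row_residue M (p j)) (at (p j))"
      unfolding c_def using J by (rule conjunct1)
    show "((\<lambda>z. M z v* mat22 0 (- (norming_const a b r1 N j * exp (- 2 * \<i> * cnj (p j) * of_real x) / of_nat N)) 0 0)
         \<longlongrightarrow> row_residue M (- p j)) (at (- p j))"
      using conjunct2[OF J] unfolding cnj .
  qed
  have sym: "M z $ 2 = f (- z)" if "z \<notin> ?P" for z
  proof -
    have "M (- z) = M z v* mat22 0 1 1 0"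
      using M that unfolding soliton_rhp_def swap_symmetric_on_def by (simp add: uminus_soliton_poles)
    then show ?thesis by (simp add: f_def)
  qed
  define \<alpha> where "\<alpha> j = residue f (p j)" for j
  \<comment> \<open>The residue matrix at a lower pole has vanishing first column, so the first
    component has no residue there.\<close>
  have res_low: "residue f (- p j) = 0" if "j \<in> {1..N}" for j
  proof -
    have "((\<lambda>z. (M z v* mat22 0 (- (norming_const a b r1 N j * exp (- 2 * \<i> * cnj (p j) * of_real x) / of_nat N)) 0 0) $ 1)
         \<longlongrightarrow> row_residue M (- p j) $ 1) (at (- p j))" by (rule tendsto_vec_nth[OF jumps(2)[OF that]])
    then show ?thesis by (simp add: row_residue_def f_def[abs_def] tendsto_const_iff)
  qed
  define H where "H z = (\<Sum>j=1..N. \<alpha> j / (z - p j))" for z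
  have Hcont: "isCont H z" if "z \<notin> p ` {1..N}" for z
    unfolding H_def using that by (intro continuous_intros) auto
  \<comment> \<open>At upper poles the principal parts cancel; at lower ones \<open>H\<close> is
    continuous and the residue of \<open>f\<close> is zero.\<close>
  have limG: "((\<lambda>z. (z - q) * (f z - 1 - H z)) \<longlongrightarrow> 0) (at q)" if q: "q \<in> ?P" for q
  proof -
    have lim1: "((\<lambda>z. (z - q) * f z) \<longlongrightarrow> residue f q) (at q)"
      by (rule residue_of_simple_pole_limit[OF finite_soliton_poles fhol pole[OF q]])
    have lim2: "((\<lambda>z. (z - q) * H z) \<longlongrightarrow> residue f q) (at q)"
    proof (cases "q \<in> p ` {1..N}")
      case True
      then obtain k where k: "k \<in> {1..N}" "q = p k" by blast
      define H' where "H' z = (\<Sum>j\<in>{1..N} - {k}. \<alpha> j / (z - p j))" for z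
      have "isCont H' q" unfolding H'_def k(2) using pinj by (intro continuous_intros) auto
      then have "((\<lambda>z. \<alpha> k + (z - q) * H' z) \<longlongrightarrow> \<alpha> k + (q - q) * H' q) (at q)"
        unfolding isCont_def by (intro tendsto_intros)
      then have "((\<lambda>z. \<alpha> k + (z - q) * H' z) \<longlongrightarrow> residue f q) (at q)" by (simp add: \<alpha>_def k(2))
      then show ?thesis
      proof (rule Lim_transform_eventually)
        have "\<alpha> k + (z - q) * H' z = (z - q) * H z" if "z \<noteq> q" for z
          unfolding H_def H'_def using k that by (subst (2) sum.remove[of _ k]) (auto simp: distrib_left)
        then show "eventually (\<lambda>z. \<alpha> k + (z - q) * H' z = (z - q) * H z) (at q)"
          by (simp add: eventually_at_filter)
      qed
    next
      case False
      then obtain k where k: "k \<in> {1..N}" "q = - p k" using q P by auto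
      have "((\<lambda>z. (z - q) * H z) \<longlongrightarrow> (q - q) * H q) (at q)"
        using Hcont[OF False] unfolding isCont_def by (intro tendsto_intros)
      then show ?thesis using res_low[OF k(1)] by (simp add: k(2))
    qed
    have lim3: "((\<lambda>z. z - q) \<longlongrightarrow> q - q) (at q)" by (intro tendsto_intros)
    have "((\<lambda>z. (z - q) * f z - (z - q) - (z - q) * H z) \<longlongrightarrow> residue f q - (q - q) - residue f q) (at q)"
      by (intro tendsto_diff lim1 lim2 lim3)
    then show ?thesis by (simp add: algebra_simps)
  qed
  have holG: "(\<lambda>z. f z - 1 - H z) holomorphic_on (UNIV - ?P)"
    unfolding H_def using P by (intro holomorphic_intros holomorphic_on_subset[OF fhol]) auto
  have "\<exists>F. F holomorphic_on UNIV \<and> (\<forall>z\<in>UNIV - ?P. F z = f z - 1 - H z)"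
    by (rule holomorphic_extension_finite[OF finite_soliton_poles open_UNIV subset_UNIV holG]) (rule limG)
  then obtain F where F: "F holomorphic_on UNIV" "\<forall>z\<in>UNIV - ?P. F z = f z - 1 - H z" by (elim exE conjE)
  have f_inf: "(f \<longlongrightarrow> 1) at_infinity"
    using M normalized_at_infinity_tendsto(1) unfolding soliton_rhp_def f_def by blast
  have "filterlim (\<lambda>z. - p j + z) at_infinity at_infinity" for j
    by (rule tendsto_add_filterlim_at_infinity[OF tendsto_const filterlim_ident])
  then have "((\<lambda>z. \<alpha> j / (z - p j)) \<longlongrightarrow> 0) at_infinity" for j
    by (intro tendsto_divide_0[OF tendsto_const]) (simp add: algebra_simps)
  then have "(H \<longlongrightarrow> (\<Sum>j=1..N. 0)) at_infinity" unfolding H_def by (intro tendsto_sum)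
  then have "((\<lambda>z. f z - 1 - H z) \<longlongrightarrow> 1 - 1 - 0) at_infinity" by (intro tendsto_diff f_inf tendsto_const) simp
  then have inf: "((\<lambda>z. f z - 1 - H z) \<longlongrightarrow> 0) at_infinity" by simp
  have off: "eventually (\<lambda>z. z \<notin> ?P) at_infinity"
  proof -
    obtain B where "\<forall>z\<in>?P. norm z \<le> B" using finite_imp_bounded[OF finite_soliton_poles] unfolding bounded_iff by blast
    then show ?thesis unfolding eventually_at_infinity by (intro exI[of _ "B + 1"]) force
  qed
  have "(F \<longlongrightarrow> 0) at_infinity"
    by (rule Lim_transform_eventually[OF inf]) (rule eventually_mono[OF off], use F in simp)
  then have "F z = 0" for z using F(1) by (intro Liouville_weak_0)
  then have fH: "f z = 1 + H z" if "z \<notin> ?P" for z using F(2) that by (auto simp: algebra_simps)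
  have Psym: "z \<in> ?P \<Longrightarrow> - z \<in> ?P" "- z \<in> ?P \<Longrightarrow> z \<in> ?P" for z using uminus_soliton_poles by auto
  have M2: "M z $ 2 = 1 + H (- z)" if "z \<notin> ?P" for z
    using sym[OF that] fH[of "- z"] Psym(2)[of z] that by auto
  \<comment> \<open>By symmetry this is the second component of \<open>M\<close> at
    \<open>\<i> * s\<close>, with the removable singularities at the nodes filled in. The values of
    \<open>M\<close> at its poles are arbitrary, so the residue condition is read through this
    limit.\<close>
  define \<phi> where "\<phi> s = 1 + H (- (\<i> * of_real s))" for s :: real
  have \<alpha>: "\<alpha> k = c k * \<phi> (?s k)" if k: "k \<in> {1..N}" for k
  proof -
    have "((\<lambda>z. (M z v* mat22 0 0 (c k) 0) $ 1) \<longlongrightarrow> row_residue M (p k) $ 1) (at (p k))"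
      by (rule tendsto_vec_nth[OF jumps(1)[OF k]])
    then have A: "((\<lambda>z. M z $ 2 * c k) \<longlongrightarrow> \<alpha> k) (at (p k))"
      by (simp add: row_residue_def \<alpha>_def f_def[abs_def])
    have "- p k \<notin> p ` {1..N}" using pneg k by auto
    then have "isCont (\<lambda>z. (1 + H (- z)) * c k) (p k)"
      by (intro continuous_intros isCont_o2[where g = H, OF _ Hcont])
    then have B: "((\<lambda>z. (1 + H (- z)) * c k) \<longlongrightarrow> (1 + H (- p k)) * c k) (at (p k))" by (simp add: isCont_def)
    have "open (- (?P - {p k}))" by (rule open_Compl[OF finite_imp_closed[OF finite_Diff[OF finite_soliton_poles]]])
    then have "eventually (\<lambda>z. z \<in> - (?P - {p k})) (nhds (p k))"
      by (rule eventually_nhds_in_open) simp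
    then have ev: "eventually (\<lambda>z. z \<notin> ?P) (at (p k))"
      unfolding eventually_at_filter by (rule eventually_mono) auto
    have "((\<lambda>z. M z $ 2 * c k) \<longlongrightarrow> (1 + H (- p k)) * c k) (at (p k))"
      by (rule Lim_transform_eventually[OF B]) (rule eventually_mono[OF ev], simp add: M2)
    from tendsto_unique[OF _ A this] show ?thesis by (simp add: \<phi>_def p_def mult.commute)
  qed
  \<comment> \<open>The norming constants split into quadrature weight times density; the
    exponential is real at points of the imaginary axis.\<close>
  have ck: "c k = \<i> * (of_real ((b - a) / real N) * \<rho> (?s k))" if k: "k \<in> {1..N}" for k
  proof -
    have "exp (2 * \<i> * p k * of_real x) = of_real (exp (- 2 * ?s k * x))"
      by (simp add: p_def exp_of_real[symmetric] mult_ac)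
    moreover have "norming_const a b r1 N k = \<i> * of_real (b - a) * of_real (R (?s k))"
      using r1[OF sin[OF k]] by (simp add: norming_const_def sp p_def)
    ultimately show ?thesis by (simp add: c_def \<rho>_def)
  qed
  have H: "H z = \<i> * riemann_sum a b N (\<lambda>t. \<rho> t * \<phi> t / (z - \<i> * of_real t))" for z
    unfolding H_def riemann_sum_def sum_distrib_left
    by (intro sum.cong refl) (simp add: \<alpha> ck p_def mult_ac)
  have "\<phi> s + riemann_sum a b N (\<lambda>t. \<rho> t * \<phi> t / of_real (s + t)) = 1" if s: "s \<in> {a..b}" for s
  proof -
    have "\<i> * riemann_sum a b N (\<lambda>t. \<rho> t * \<phi> t / (- (\<i> * of_real s) - \<i> * of_real t))
        = - riemann_sum a b N (\<lambda>t. \<rho> t * \<phi> t / of_real (s + t))"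
      unfolding riemann_sum_def sum_distrib_left sum_negf[symmetric]
    proof (intro sum.cong refl)
      fix j
      have "- (\<i> * of_real s) - \<i> * of_real (?s j) = - (\<i> * of_real (s + ?s j))" by (simp add: algebra_simps)
      then show "\<i> * (of_real ((b - a) / real N) * (\<rho> (?s j) * \<phi> (?s j) / (- (\<i> * of_real s) - \<i> * of_real (?s j))))
         = - (of_real ((b - a) / real N) * (\<rho> (?s j) * \<phi> (?s j) / of_real (s + ?s j)))"
        by (simp add: mult_ac)
    qed
    then show ?thesis unfolding \<phi>_def[of s] H by simp
  qed
  then show ?thesis using fH M2 by (intro exI[of _ \<phi>]) (auto simp: f_def H)
qed

subsection \<open>The soliton gas problem\<close>

text \<open>The Minkowski sum of a convex set with a ball is convex. Analyticity on the segment
  provides just some open domain, while the difference quotient argument averages along segments and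
  needs a convex one.\<close>

lemma convex_open_neighbourhood:
  fixes S :: "complex set"
  assumes "compact S" "convex S" "open T" "S \<subseteq> T"
  obtains U where "open U" "convex U" "S \<subseteq> U" "U \<subseteq> T"
proof -
  obtain e where e: "e > 0" "(\<Union>x\<in>S. ball x e) \<subseteq> T"
    using compact_subset_open_imp_ball_epsilon_subset[OF assms(1,3,4)] by metis
  have eq: "(\<Union>x\<in>S. ball x e) = (\<Union>x\<in>S. \<Union>y\<in>ball 0 e. {x + y})"
  proof -
    have "ball x e = (\<Union>y\<in>ball 0 e. {x + y})" for x :: complex
    proof (intro set_eqI iffI)
      fix y assume "y \<in> ball x e"
      then have "y - x \<in> ball 0 e" by (simp add: dist_norm norm_minus_commute)
      then show "y \<in> (\<Union>y\<in>ball 0 e. {x + y})" by (rule UN_I) simp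
    next
      fix y assume "y \<in> (\<Union>y\<in>ball 0 e. {x + y})"
      then obtain v where "v \<in> ball 0 e" "y = x + v" by blast
      then show "y \<in> ball x e" by (simp add: dist_norm)
    qed
    then show ?thesis by (intro SUP_cong refl)
  qed
  have "convex (\<Union>x\<in>S. ball x e)" unfolding eq by (rule convex_sums[OF assms(2) convex_ball])
  moreover have "S \<subseteq> (\<Union>x\<in>S. ball x e)" using centre_in_ball e(1) by blast
  moreover have "open (\<Union>x\<in>S. ball x e)" by (intro open_UN ballI open_ball)
  ultimately show thesis using e(2) by (intro that)
qed

lemma holomorphic_tendsto_within:
  fixes f :: "complex \<Rightarrow> complex"
  assumes "f holomorphic_on U" "open U" "p \<in> U"
  shows "(f \<longlongrightarrow> f p) (at p within S)"
proof (rule Lim_at_imp_Lim_at_within)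
  have "isCont f p"
    using continuous_on_eq_continuous_at[OF assms(2)] holomorphic_on_imp_continuous_on[OF assms(1)] assms(3) by blast
  then show "(f \<longlongrightarrow> f p) (at p)" by (simp add: isCont_def)
qed

text \<open>\<open>R\<close> is the density \<open>r1 / pi\<close> in the coordinate \<open>t = Im \<zeta>\<close>.\<close>

locale soliton_density =
  fixes a b :: real and r1 :: "complex \<Rightarrow> complex" and R :: "real \<Rightarrow> real"
  assumes a_pos: "0 < a" and ab: "a < b"
    and r1_analytic: "r1 analytic_on upper_seg a b"
    and r1_upper: "\<And>t. t \<in> {a..b} \<Longrightarrow> r1 (\<i> * of_real t) = of_real (pi * R t)"
    and r1_lower: "\<And>t. t \<in> {a..b} \<Longrightarrow> r1 (- (\<i> * of_real t)) = of_real (pi * R t)"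
    and R_nonneg: "\<And>t. t \<in> {a..b} \<Longrightarrow> 0 \<le> R t"
begin

text \<open>
  The Cauchy integrals in the jump matrices of \<open>limit_rhp\<close> are \<open>- cauchy_R z\<close> on the upper curve
  and \<open>cauchy_R (- z)\<close> on the lower one.
\<close>

definition cauchy_R :: "complex \<Rightarrow> complex" where
  "cauchy_R z = \<i> * integral {a..b} (\<lambda>t. of_real (R t) / (z - \<i> * of_real t))"

lemma ab_le: "a \<le> b" using ab by simp

lemma continuous_R: "continuous_on {a..b} R"
proof -
  have "continuous_on {a..b} (\<lambda>t. Re (r1 (\<i> * of_real t)) / pi)"
    by (intro continuous_intros continuous_on_compose2[OF analytic_imp_holomorphic[OF r1_analytic, THEN holomorphic_on_imp_continuous_on]])
      (auto intro!: ii_in_upper_seg)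
  then show ?thesis by (rule continuous_on_eq) (simp add: r1_upper)
qed

lemma continuous_of_real_R: "continuous_on {a..b} (\<lambda>t. of_real (R t) :: complex)"
  by (intro continuous_intros continuous_R)

lemma holomorphic_cauchy_R: "cauchy_R holomorphic_on - upper_seg a b"
  unfolding cauchy_R_def[abs_def]
  by (intro holomorphic_on_mult holomorphic_on_const holomorphic_on_cauchy_integral continuous_of_real_R)

lemma contour_integral_upper:
  "contour_integral (linepath (\<i> * of_real a) (\<i> * of_real b))
     (\<lambda>\<zeta>. 2 * \<i> * r1 \<zeta> / (\<zeta> - z) / (2 * of_real pi * \<i>)) = - cauchy_R z"
proof -
  have "contour_integral (linepath (\<i> * of_real a) (\<i> * of_real b))
     (\<lambda>\<zeta>. 2 * \<i> * r1 \<zeta> / (\<zeta> - z) / (2 * of_real pi * \<i>))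
    = \<i> * integral {a..b} (\<lambda>t. 2 * \<i> * r1 (Complex 0 t) / (Complex 0 t - z) / (2 * of_real pi * \<i>))"
    by (rule contour_integral_linepath_same_Re) (use ab in auto)
  also have "integral {a..b} (\<lambda>t. 2 * \<i> * r1 (Complex 0 t) / (Complex 0 t - z) / (2 * of_real pi * \<i>))
      = integral {a..b} (\<lambda>t. - (of_real (R t) / (z - \<i> * of_real t)))"
  proof (rule integral_cong)
    fix t assume t: "t \<in> {a..b}"
    have C: "Complex 0 t = \<i> * of_real t" by (simp add: complex_eq_iff)
    have "2 * \<i> * of_real (pi * R t) / (\<i> * of_real t - z) / (2 * of_real pi * \<i>) = of_real (R t) / (\<i> * of_real t - z)" by simp
    also have "\<dots> = - (of_real (R t) / (z - \<i> * of_real t))" by (metis minus_diff_eq minus_divide_right)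
    finally show "2 * \<i> * r1 (Complex 0 t) / (Complex 0 t - z) / (2 * of_real pi * \<i>) = - (of_real (R t) / (z - \<i> * of_real t))"
      unfolding C r1_upper[OF t] .
  qed
  finally show ?thesis by (simp add: cauchy_R_def)
qed

lemma contour_integral_lower:
  "contour_integral (linepath (- \<i> * of_real b) (- \<i> * of_real a))
     (\<lambda>\<zeta>. 2 * \<i> * r1 \<zeta> / (\<zeta> - z) / (2 * of_real pi * \<i>)) = cauchy_R (- z)"
proof -
  let ?f = "\<lambda>t. 2 * \<i> * r1 (Complex 0 t) / (Complex 0 t - z) / (2 * of_real pi * \<i>)"
  have "contour_integral (linepath (- \<i> * of_real b) (- \<i> * of_real a))
     (\<lambda>\<zeta>. 2 * \<i> * r1 \<zeta> / (\<zeta> - z) / (2 * of_real pi * \<i>)) = \<i> * integral {- b..- a} ?f"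
    by (rule contour_integral_linepath_same_Re) (use ab in auto)
  also have "integral {- b..- a} ?f = integral {a..b} (\<lambda>t. ?f (- t))"
    using Henstock_Kurzweil_Integration.integral_reflect_real[of b a "\<lambda>t. ?f (- t)"] by simp
  also have "\<dots> = integral {a..b} (\<lambda>t. of_real (R t) / (- z - \<i> * of_real t))"
  proof (rule integral_cong)
    fix t assume t: "t \<in> {a..b}"
    have C: "Complex 0 (- t) = - (\<i> * of_real t)" by (simp add: complex_eq_iff)
    have "2 * \<i> * of_real (pi * R t) / (- (\<i> * of_real t) - z) / (2 * of_real pi * \<i>) = of_real (R t) / (- (\<i> * of_real t) - z)" by simp
    then have "2 * \<i> * of_real (pi * R t) / (- (\<i> * of_real t) - z) / (2 * of_real pi * \<i>) = of_real (R t) / (- z - \<i> * of_real t)"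
      by (simp only: minus_diff_commute)
    then show "?f (- t) = of_real (R t) / (- z - \<i> * of_real t)"
      unfolding C r1_lower[OF t] .
  qed
  finally show ?thesis by (simp add: cauchy_R_def)
qed

text \<open>The density is the restriction of the analytic function \<open>r1\<close>, which can be
  frozen at \<open>z\<close> up to a holomorphic term \<open>K\<close>. The boundary behaviour of
  \<open>cauchy_R\<close> is thereby that of the logarithmic kernel of constant density.\<close>

lemma cauchy_R_local:
  obtains U K where "open U" "upper_seg a b \<subseteq> U" "r1 holomorphic_on U" "K holomorphic_on U"
    "\<And>z. z \<in> U - upper_seg a b \<Longrightarrow>
       cauchy_R z = (r1 z * integral {a..b} (\<lambda>t. \<i> / (z - \<i> * of_real t)) - K z) / of_real pi"
proof -
  obtain T where T: "open T" "upper_seg a b \<subseteq> T" "r1 holomorphic_on T"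
    using r1_analytic unfolding analytic_on_holomorphic by blast
  obtain U where U: "open U" "convex U" "upper_seg a b \<subseteq> U" "U \<subseteq> T"
    using convex_open_neighbourhood[OF compact_upper_seg convex_upper_seg T(1,2)] by metis
  have hol: "r1 holomorphic_on U" by (rule holomorphic_on_subset[OF T(3) U(4)])
  obtain K where K: "K holomorphic_on U" "\<forall>z\<in>U - upper_seg a b.
      K z = integral {a..b} (\<lambda>t. \<i> * (r1 z - r1 (\<i> * of_real t)) / (z - \<i> * of_real t))"
    using difference_quotient_integral_extension[OF ab U(2,1,3) hol continuous_on_const] by blast
  show thesis
  proof (rule that[OF U(1,3) hol K(1)])
    fix z assume z: "z \<in> U - upper_seg a b"
    have nz: "z - \<i> * of_real t \<noteq> 0" if "t \<in> {a..b}" for t using not_upper_seg_imp_neq z that by blast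
    have "r1 z * integral {a..b} (\<lambda>t. \<i> / (z - \<i> * of_real t)) - K z
        = integral {a..b} (\<lambda>t. r1 z * (\<i> / (z - \<i> * of_real t)) - \<i> * (r1 z - of_real (pi * R t)) / (z - \<i> * of_real t))"
    proof (subst integral_diff)
      show "(\<lambda>t. r1 z * (\<i> / (z - \<i> * of_real t))) integrable_on {a..b}"
        using nz by (intro integrable_continuous_real continuous_intros) blast
      show "(\<lambda>t. \<i> * (r1 z - of_real (pi * R t)) / (z - \<i> * of_real t)) integrable_on {a..b}"
        using nz by (intro integrable_continuous_real continuous_intros continuous_R) blast
      have "K z = integral {a..b} (\<lambda>t. \<i> * (r1 z - r1 (\<i> * of_real t)) / (z - \<i> * of_real t))"
        using K(2) z by (rule bspec)
      also have "\<dots> = integral {a..b} (\<lambda>t. \<i> * (r1 z - of_real (pi * R t)) / (z - \<i> * of_real t))"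
        by (rule integral_cong) (simp add: r1_upper)
      finally have "K z = integral {a..b} (\<lambda>t. \<i> * (r1 z - of_real (pi * R t)) / (z - \<i> * of_real t))" .
      then show "r1 z * integral {a..b} (\<lambda>t. \<i> / (z - \<i> * of_real t)) - K z = integral {a..b} (\<lambda>t. r1 z * (\<i> / (z - \<i> * of_real t)))
          - integral {a..b} (\<lambda>t. \<i> * (r1 z - of_real (pi * R t)) / (z - \<i> * of_real t))"
        by (simp only: integral_mult_right)
    qed
    also have "\<dots> = integral {a..b} (\<lambda>t. (of_real pi * \<i>) * (of_real (R t) / (z - \<i> * of_real t)))"
      by (intro integral_cong) (simp add: diff_divide_distrib right_diff_distrib mult.commute)
    also have "\<dots> = of_real pi * cauchy_R z" unfolding integral_mult_right cauchy_R_def by simp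
    finally show "cauchy_R z = (r1 z * integral {a..b} (\<lambda>t. \<i> / (z - \<i> * of_real t)) - K z) / of_real pi" by simp
  qed
qed

text \<open>The difference of the left and right values is \<open>- 2 * \<i> * r1\<close>, exactly
  the coefficient in the jump matrix of the gas problem; dressing with \<open>cauchy_R\<close>
  removes that jump for this reason.\<close>

lemma cauchy_R_boundary_values:
  assumes "t \<in> {a<..<b}"
  obtains l where "(cauchy_R \<longlongrightarrow> l - \<i> * r1 (\<i> * of_real t)) (at (\<i> * of_real t) within {w. Re w < 0})"
    "(cauchy_R \<longlongrightarrow> l + \<i> * r1 (\<i> * of_real t)) (at (\<i> * of_real t) within {w. 0 < Re w})"
proof -
  let ?p = "\<i> * of_real t :: complex"
  obtain U K where U: "open U" "upper_seg a b \<subseteq> U" "r1 holomorphic_on U" "K holomorphic_on U"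
    and eq: "\<And>z. z \<in> U - upper_seg a b \<Longrightarrow>
       cauchy_R z = (r1 z * integral {a..b} (\<lambda>t. \<i> / (z - \<i> * of_real t)) - K z) / of_real pi"
    using cauchy_R_local by metis
  obtain m where m: "((\<lambda>z. integral {a..b} (\<lambda>s. \<i> / (z - \<i> * of_real s))) \<longlongrightarrow> m - \<i> * of_real pi) (at ?p within {w. Re w < 0})"
    "((\<lambda>z. integral {a..b} (\<lambda>s. \<i> / (z - \<i> * of_real s))) \<longlongrightarrow> m + \<i> * of_real pi) (at ?p within {w. 0 < Re w})"
    using segment_kernel_boundary_values[of a t b] assms by auto
  have p: "?p \<in> U" using U(2) ii_in_upper_seg[of t a b] assms by auto
  note c = holomorphic_tendsto_within[OF U(3,1) p] holomorphic_tendsto_within[OF U(4,1) p]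
  have ev: "eventually (\<lambda>z. (r1 z * integral {a..b} (\<lambda>t. \<i> / (z - \<i> * of_real t)) - K z) / of_real pi = cauchy_R z) (at ?p within S)"
    if S: "S \<inter> upper_seg a b = {}" for S
  proof -
    have "(r1 z * integral {a..b} (\<lambda>t. \<i> / (z - \<i> * of_real t)) - K z) / of_real pi = cauchy_R z" if "z \<in> U" "z \<in> S" for z
      by (rule eq[symmetric]) (use that S in blast)
    then show ?thesis unfolding eventually_at_topological using U(1) p by (intro exI[of _ U]) blast
  qed
  have dis: "{w. Re w < 0} \<inter> upper_seg a b = {}" "{w. 0 < Re w} \<inter> upper_seg a b = {}"
    using ab by (auto simp: upper_seg_eq)
  define l where "l = (r1 ?p * m - K ?p) / of_real pi"
  have l: "(r1 ?p * (m - \<i> * of_real pi) - K ?p) / of_real pi = l - \<i> * r1 ?p"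
    "(r1 ?p * (m + \<i> * of_real pi) - K ?p) / of_real pi = l + \<i> * r1 ?p"
    by (simp_all add: l_def field_simps)
  show thesis
  proof (rule that[of l])
    show "(cauchy_R \<longlongrightarrow> l - \<i> * r1 ?p) (at ?p within {w. Re w < 0})"
      unfolding l(1)[symmetric]
      by (rule Lim_transform_eventually[OF _ ev[OF dis(1)]]) (intro tendsto_intros c m; simp)
    show "(cauchy_R \<longlongrightarrow> l + \<i> * r1 ?p) (at ?p within {w. 0 < Re w})"
      unfolding l(2)[symmetric]
      by (rule Lim_transform_eventually[OF _ ev[OF dis(2)]]) (intro tendsto_intros c m; simp)
  qed
qed

lemma cauchy_R_endpoint:
  assumes "p \<in> {\<i> * of_real a, \<i> * of_real b}"
  shows "((\<lambda>z. (z - p) * cauchy_R z) \<longlongrightarrow> 0) (at p within - upper_seg a b)"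
proof -
  obtain U K where U: "open U" "upper_seg a b \<subseteq> U" "r1 holomorphic_on U" "K holomorphic_on U"
    and eq: "\<And>z. z \<in> U - upper_seg a b \<Longrightarrow>
       cauchy_R z = (r1 z * integral {a..b} (\<lambda>t. \<i> / (z - \<i> * of_real t)) - K z) / of_real pi"
    using cauchy_R_local by metis
  have p: "p \<in> U" using U(2) ii_in_upper_seg[of _ a b] assms ab by auto
  note c = holomorphic_tendsto_within[OF U(3,1) p] holomorphic_tendsto_within[OF U(4,1) p]
  have "((\<lambda>z. (r1 z * ((z - p) * integral {a..b} (\<lambda>t. \<i> / (z - \<i> * of_real t))) - (z - p) * K z) / of_real pi)
      \<longlongrightarrow> (r1 p * 0 - (p - p) * K p) / of_real pi) (at p within - upper_seg a b)"
    by (intro tendsto_intros c segment_kernel_endpoint ab assms) simp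
  then have lim: "((\<lambda>z. (r1 z * ((z - p) * integral {a..b} (\<lambda>t. \<i> / (z - \<i> * of_real t))) - (z - p) * K z) / of_real pi)
      \<longlongrightarrow> 0) (at p within - upper_seg a b)" by simp
  have "(r1 z * ((z - p) * integral {a..b} (\<lambda>t. \<i> / (z - \<i> * of_real t))) - (z - p) * K z) / of_real pi
      = (z - p) * cauchy_R z" if "z \<in> U" "z \<in> - upper_seg a b" for z
    using eq[of z] that by (simp add: right_diff_distrib mult_ac)
  then have "eventually (\<lambda>z. (r1 z * ((z - p) * integral {a..b} (\<lambda>t. \<i> / (z - \<i> * of_real t))) - (z - p) * K z) / of_real pi
      = (z - p) * cauchy_R z) (at p within - upper_seg a b)"
    unfolding eventually_at_topological using U(1) p by (intro exI[of _ U]) blast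
  with lim show ?thesis by (rule Lim_transform_eventually)
qed

end

section \<open>Continuation of the soliton gas solution across the upper segment\<close>

lemma bigo_ln_imp_removable:
  fixes X :: "complex \<Rightarrow> complex^2" and p :: complex
  assumes "(\<lambda>z. norm (X z)) \<in> O[at p within S](\<lambda>z. ln (norm (z - p)))"
  shows "((\<lambda>z. (z - p) * X z $ i) \<longlongrightarrow> 0) (at p within S)"
proof -
  obtain c where c: "c > 0" "eventually (\<lambda>z. norm (norm (X z)) \<le> c * norm (ln (norm (z - p)))) (at p within S)"
    using assms by (elim landau_o.bigE)
  have "((\<lambda>z. c * \<bar>norm (z - p) * ln (norm (z - p))\<bar>) \<longlongrightarrow> c * \<bar>0\<bar>) (at p)"
    by (intro tendsto_mult tendsto_const tendsto_rabs tendsto_norm_mult_ln_norm)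
  then have "((\<lambda>z. c * \<bar>norm (z - p) * ln (norm (z - p))\<bar>) \<longlongrightarrow> 0) (at p within S)"
    by (simp add: Lim_at_imp_Lim_at_within)
  moreover have "eventually (\<lambda>z. norm ((z - p) * X z $ i) \<le> c * \<bar>norm (z - p) * ln (norm (z - p))\<bar>) (at p within S)"
    using c(2)
  proof (rule eventually_mono)
    fix z assume z: "norm (norm (X z)) \<le> c * norm (ln (norm (z - p)))"
    have "norm (X z $ i) \<le> norm (X z)" by (rule Finite_Cartesian_Product.norm_nth_le)
    also have "\<dots> \<le> c * \<bar>ln (norm (z - p))\<bar>" using z by simp
    finally have "norm (z - p) * norm (X z $ i) \<le> norm (z - p) * (c * \<bar>ln (norm (z - p))\<bar>)"
      by (rule mult_left_mono) simp
    then show "norm ((z - p) * X z $ i) \<le> c * \<bar>norm (z - p) * ln (norm (z - p))\<bar>"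
      by (simp add: norm_mult abs_mult mult_ac)
  qed
  ultimately show ?thesis by (rule Lim_null_comparison[rotated])
qed

lemma tendsto_within_ignore_closed:
  fixes f :: "complex \<Rightarrow> complex"
  assumes "(f \<longlongrightarrow> l) (at p within - (A \<union> B))" "closed B" "p \<notin> B"
  shows "(f \<longlongrightarrow> l) (at p within - A)"
proof (rule Lim_transform_within_set[OF assms(1)])
  show "eventually (\<lambda>x. x \<in> - (A \<union> B) \<longleftrightarrow> x \<in> - A) (at p)"
    unfolding eventually_at_topological using assms(2,3) by (intro exI[of _ "- B"]) (simp add: open_Compl)
qed

lemma tendsto_vector_2:
  fixes f g :: "'a \<Rightarrow> complex"
  assumes "(f \<longlongrightarrow> l) F" "(g \<longlongrightarrow> m) F"
  shows "((\<lambda>x. vector [f x, g x] :: complex^2) \<longlongrightarrow> vector [l, m]) F"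
proof (rule vec_tendstoI)
  fix i :: 2
  show "((\<lambda>x. (vector [f x, g x] :: complex^2) $ i) \<longlongrightarrow> (vector [l, m] :: complex^2) $ i) F"
    using assms exhaust_2[of i] by auto
qed

context soliton_density
begin

lemma upper_lower_disjoint: "upper_seg a b \<inter> lower_seg a b = {}"
  using a_pos ab by (auto simp: upper_seg_eq lower_seg_eq)

lemma upper_subset: "upper_seg a b \<subseteq> {z. 0 < Im z}" and lower_subset: "lower_seg a b \<subseteq> {z. Im z < 0}"
  using a_pos ab by (auto simp: upper_seg_eq lower_seg_eq)

lemma open_segment_mem: "t \<in> {a<..<b} \<Longrightarrow> \<i> * of_real t \<in> open_segment (\<i> * of_real a) (\<i> * of_real b)"
  using ii_in_upper_seg[of t a b] by (auto simp: open_segment_def upper_seg_def)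

text \<open>The upper jump matrix leaves the second component unchanged, so it continues across the
  upper segment as \<open>Y\<close>, and the symmetry expresses the first component through
  \<open>Y\<close> as well. The jump of the first component is a multiple of the second, and
  subtracting the same multiple of \<open>cauchy_R\<close> cancels it, which gives
  \<open>H\<close>.\<close>

lemma soliton_gas_extension:
  fixes X :: "complex \<Rightarrow> complex^2"
  assumes X: "soliton_gas_rhp a b r1 x X"
  shows "\<exists>Y H. Y holomorphic_on - lower_seg a b \<and> H holomorphic_on {z. 0 < Im z}
     \<and> (\<forall>z\<in>- (upper_seg a b \<union> lower_seg a b). X z $ 2 = Y z \<and> X z $ 1 = Y (- z))
     \<and> (\<forall>z\<in>{z. 0 < Im z} - upper_seg a b. H z = X z $ 1 - exp (2 * \<i> * z * of_real x) * cauchy_R z * X z $ 2)"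
proof -
  let ?U = "upper_seg a b" and ?L = "lower_seg a b"
  have hol: "(\<lambda>z. X z $ i) holomorphic_on - (?U \<union> ?L)" for i
    using X unfolding soliton_gas_rhp_def Let_def row_holomorphic_on_def by blast
  have ends: "((\<lambda>w. (w - p) * X w $ i) \<longlongrightarrow> 0) (at p within - ?U)" if p: "p \<in> {\<i> * of_real a, \<i> * of_real b}" for p i
  proof (rule tendsto_within_ignore_closed)
    have "(\<lambda>z. norm (X z)) \<in> O[at p within (- (?U \<union> ?L))](\<lambda>z. ln (norm (z - p)))"
      using X p unfolding soliton_gas_rhp_def Let_def by blast
    then show "((\<lambda>w. (w - p) * X w $ i) \<longlongrightarrow> 0) (at p within - (?U \<union> ?L))" by (rule bigo_ln_imp_removable)
    show "p \<notin> ?L" using p lower_subset a_pos ab by auto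
  qed simp
  have jump: "\<exists>Fp Fm. (X \<longlongrightarrow> Fp) (at (\<i> * of_real t) within {w. Re w < 0}) \<and> (X \<longlongrightarrow> Fm) (at (\<i> * of_real t) within {w. Re w > 0})
      \<and> Fp = Fm v* mat22 1 0 (- 2 * \<i> * r1 (\<i> * of_real t) * exp (2 * \<i> * (\<i> * of_real t) * of_real x)) 1"
    if t: "t \<in> {a<..<b}" for t
    using X open_segment_mem[OF t] unfolding soliton_gas_rhp_def Let_def has_jump_def by blast
  have "\<exists>Y. Y holomorphic_on - ?L \<and> (\<forall>z\<in>- ?L - ?U. Y z = X z $ 2)"
  proof (rule holomorphic_extension_across_upper_seg[OF ab])
    show "open (- ?L)" by (simp add: open_Compl)
    show "?U \<subseteq> - ?L" using upper_lower_disjoint by blast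
    show "(\<lambda>z. X z $ 2) holomorphic_on - ?L - ?U" by (rule holomorphic_on_subset[OF hol]) blast
    fix t assume t: "t \<in> {a<..<b}"
    obtain Fp Fm where F: "(X \<longlongrightarrow> Fp) (at (\<i> * of_real t) within {w. Re w < 0})" "(X \<longlongrightarrow> Fm) (at (\<i> * of_real t) within {w. Re w > 0})"
      and eq: "Fp = Fm v* mat22 1 0 (- 2 * \<i> * r1 (\<i> * of_real t) * exp (2 * \<i> * (\<i> * of_real t) * of_real x)) 1"
      using jump[OF t] by (elim exE conjE)
    have "Fp $ 2 = Fm $ 2" unfolding eq by simp
    then show "\<exists>l. ((\<lambda>z. X z $ 2) \<longlongrightarrow> l) (at (\<i> * of_real t) within {w. Re w < 0}) \<and> ((\<lambda>z. X z $ 2) \<longlongrightarrow> l) (at (\<i> * of_real t) within {w. 0 < Re w})"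
      using tendsto_vec_nth[OF F(1), of 2] tendsto_vec_nth[OF F(2), of 2] by (intro exI[of _ "Fm $ 2"]) simp
  qed (use ends in blast)
  then obtain Y where Y: "Y holomorphic_on - ?L" "\<And>z. z \<in> - (?U \<union> ?L) \<Longrightarrow> Y z = X z $ 2" by auto
  let ?e = "\<lambda>z. exp (2 * \<i> * z * of_real x)"
  let ?H = "{z. 0 < Im z}"
  have opH: "open ?H" by (rule open_halfspace_Im_gt)
  have HL: "?H \<subseteq> - ?L" using lower_subset by auto
  have "\<exists>H. H holomorphic_on ?H \<and> (\<forall>z\<in>?H - ?U. H z = X z $ 1 - ?e z * cauchy_R z * Y z)"
  proof (rule holomorphic_extension_across_upper_seg[OF ab opH upper_subset])
    show "(\<lambda>z. X z $ 1 - ?e z * cauchy_R z * Y z) holomorphic_on ?H - ?U"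
      by (intro holomorphic_intros holomorphic_on_subset[OF hol] holomorphic_on_subset[OF holomorphic_cauchy_R]
          holomorphic_on_subset[OF Y(1)]) (use HL in auto)
  next
    fix t assume t: "t \<in> {a<..<b}"
    let ?p = "\<i> * of_real t :: complex"
    obtain Fp Fm where F: "(X \<longlongrightarrow> Fp) (at ?p within {w. Re w < 0})" "(X \<longlongrightarrow> Fm) (at ?p within {w. Re w > 0})"
      and eq: "Fp = Fm v* mat22 1 0 (- 2 * \<i> * r1 ?p * exp (2 * \<i> * ?p * of_real x)) 1"
      using jump[OF t] by (elim exE conjE)
    obtain l where l: "(cauchy_R \<longlongrightarrow> l - \<i> * r1 ?p) (at ?p within {w. Re w < 0})"
      "(cauchy_R \<longlongrightarrow> l + \<i> * r1 ?p) (at ?p within {w. 0 < Re w})"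
      using cauchy_R_boundary_values[OF t] by metis
    have pH: "?p \<in> ?H" using t a_pos by simp
    then have pL: "?p \<in> - ?L" using HL by blast
    have opL: "open (- ?L)" by (simp add: open_Compl)
    have cY: "(Y \<longlongrightarrow> Y ?p) (at ?p within S)" for S
      by (rule holomorphic_tendsto_within[OF Y(1) opL pL])
    have ce: "(?e \<longlongrightarrow> ?e ?p) (at ?p within S)" for S by (intro tendsto_intros)
    \<comment> \<open>The jump relation involves the limit of the second component from the right;
      this identifies it with the value of the continuation \<open>Y\<close> on the segment.\<close>
    have "eventually (\<lambda>z. X z $ 2 = Y z) (at ?p within {w. 0 < Re w})"
      unfolding eventually_at_topological
    proof (intro exI[of _ "- ?L"] conjI ballI impI opL pL)
      fix z assume "z \<in> - ?L" "z \<in> {w. 0 < Re w}"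
      then show "X z $ 2 = Y z" using Y(2)[of z] ab by (auto simp: upper_seg_eq)
    qed
    from Lim_transform_eventually[OF tendsto_vec_nth[OF F(2)] this]
    have "(Y \<longlongrightarrow> Fm $ 2) (at ?p within {w. 0 < Re w})" .
    moreover have "at ?p within {w. 0 < Re w} \<noteq> bot"
      using islimpt_off_upper_seg(1)[of ?p a b] ab by (simp add: trivial_limit_within)
    ultimately have Fm2: "Fm $ 2 = Y ?p" using tendsto_unique[OF _ _ cY] by blast
    have "Fp $ 1 = Fm $ 1 - 2 * \<i> * r1 ?p * ?e ?p * Y ?p" unfolding eq using Fm2 by simp
    \<comment> \<open>The term \<open>- 2 * \<i> * r1\<close> from the jump matrix is compensated by
      the two values \<open>l - \<i> * r1\<close> and \<open>l + \<i> * r1\<close> of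
      \<open>cauchy_R\<close>.\<close>
    then have lim_eq: "Fp $ 1 - ?e ?p * (l - \<i> * r1 ?p) * Y ?p = Fm $ 1 - ?e ?p * (l + \<i> * r1 ?p) * Y ?p"
      by (simp add: algebra_simps)
    have L: "((\<lambda>z. X z $ 1 - ?e z * cauchy_R z * Y z) \<longlongrightarrow> Fp $ 1 - ?e ?p * (l - \<i> * r1 ?p) * Y ?p) (at ?p within {w. Re w < 0})"
      by (intro tendsto_diff tendsto_mult tendsto_vec_nth[OF F(1)] l(1) cY ce)
    have R: "((\<lambda>z. X z $ 1 - ?e z * cauchy_R z * Y z) \<longlongrightarrow> Fm $ 1 - ?e ?p * (l + \<i> * r1 ?p) * Y ?p) (at ?p within {w. 0 < Re w})"
      by (intro tendsto_diff tendsto_mult tendsto_vec_nth[OF F(2)] l(2) cY ce)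
    show "\<exists>l. ((\<lambda>z. X z $ 1 - ?e z * cauchy_R z * Y z) \<longlongrightarrow> l) (at ?p within {w. Re w < 0})
        \<and> ((\<lambda>z. X z $ 1 - ?e z * cauchy_R z * Y z) \<longlongrightarrow> l) (at ?p within {w. 0 < Re w})"
      using L R unfolding lim_eq by blast
  next
    fix p assume p: "p \<in> {\<i> * of_real a, \<i> * of_real b :: complex}"
    have pL: "p \<in> - ?L" using p lower_subset a_pos ab by auto
    have opL: "open (- ?L)" by (simp add: open_Compl)
    have "((\<lambda>w. (w - p) * X w $ 1 - ?e w * ((w - p) * cauchy_R w) * Y w) \<longlongrightarrow> 0 - ?e p * 0 * Y p) (at p within - ?U)"
      by (intro tendsto_diff[OF ends[OF p]] tendsto_mult cauchy_R_endpoint[OF p] holomorphic_tendsto_within[OF Y(1) opL pL]) (intro tendsto_intros)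
    then show "((\<lambda>w. (w - p) * (X w $ 1 - ?e w * cauchy_R w * Y w)) \<longlongrightarrow> 0) (at p within - ?U)"
      by (simp add: right_diff_distrib mult_ac)
  qed
  then obtain H where H: "H holomorphic_on ?H" "\<And>z. z \<in> ?H - ?U \<Longrightarrow> H z = X z $ 1 - ?e z * cauchy_R z * Y z" by auto
  have sym: "X z $ 1 = Y (- z)" if z: "z \<in> - (?U \<union> ?L)" for z
  proof -
    have z': "- z \<in> - (?U \<union> ?L)" using z lower_seg_iff[OF ab_le, of z] lower_seg_iff[OF ab_le, of "- z"] by auto
    have "swap_symmetric_on (- (?U \<union> ?L)) X" using X unfolding soliton_gas_rhp_def Let_def by blast
    then have "X (- z) = X z v* mat22 0 1 1 0" using z z' unfolding swap_symmetric_on_def by blast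
    then have "X (- z) $ 2 = X z $ 1" by simp
    then show ?thesis using Y(2)[OF z'] by simp
  qed
  have "H z = X z $ 1 - ?e z * cauchy_R z * X z $ 2" if z: "z \<in> ?H - ?U" for z
  proof -
    have "z \<in> - (?U \<union> ?L)" using z HL by blast
    then show ?thesis using H(2)[OF z] Y(2) by simp
  qed
  then show ?thesis using Y H(1) sym by (intro exI[of _ Y] exI[of _ H]) simp
qed

end

subsection \<open>The limiting problem\<close>

lemma inside_subset_convex:
  fixes S T :: "complex set"
  assumes "convex T" "S \<subseteq> T"
  shows "inside S \<subseteq> T"
  using inside_mono[OF assms(2)] inside_convex[OF assms(1)] by blast

locale soliton_contours = soliton_density +
  fixes \<gamma>p \<gamma>m :: "real \<Rightarrow> complex"
  assumes gp: "valid_path \<gamma>p" "simple_path \<gamma>p" "pathfinish \<gamma>p = pathstart \<gamma>p"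
      "path_image \<gamma>p \<subseteq> {z. 0 < Im z}" "upper_seg a b \<subseteq> inside (path_image \<gamma>p)"
    and gm: "valid_path \<gamma>m" "simple_path \<gamma>m" "pathfinish \<gamma>m = pathstart \<gamma>m"
      "path_image \<gamma>m \<subseteq> {z. Im z < 0}" "lower_seg a b \<subseteq> inside (path_image \<gamma>m)"
begin

abbreviation "Pp \<equiv> path_image \<gamma>p"
abbreviation "Pm \<equiv> path_image \<gamma>m"

lemma closed_paths: "closed Pp" "closed Pm"
  using gp(1) gm(1) closed_valid_path_image by auto

lemma open_regions: "open (inside Pp)" "open (outside Pp)" "open (inside Pm)" "open (outside Pm)"
  using closed_paths by (simp_all add: open_inside open_outside)

lemma bounded_insides: "bounded (inside Pp)" "bounded (inside Pm)"
  using gp(1) gm(1) by (simp_all add: bounded_inside bounded_valid_path_image)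

lemma inside_p_subset: "inside Pp \<subseteq> {z. 0 < Im z}"
  by (rule inside_subset_convex[OF convex_halfspace_Im_gt gp(4)])

lemma inside_m_subset: "inside Pm \<subseteq> {z. Im z < 0}"
  by (rule inside_subset_convex[OF convex_halfspace_Im_lt gm(4)])

lemma frontier_regions: "frontier (inside Pp) = Pp" "frontier (outside Pp) = Pp" "frontier (inside Pm) = Pm" "frontier (outside Pm) = Pm"
  using Jordan_inside_outside[OF gp(2,3)] Jordan_inside_outside[OF gm(2,3)] by auto

text \<open>By the Jordan curve theorem each side has the whole curve as its frontier, so one-sided
  limits at curve points are taken along nontrivial filters.\<close>

lemma islimpt_regions:
  "z \<in> Pp \<Longrightarrow> z islimpt inside Pp" "z \<in> Pp \<Longrightarrow> z islimpt outside Pp"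
  "z \<in> Pm \<Longrightarrow> z islimpt inside Pm" "z \<in> Pm \<Longrightarrow> z islimpt outside Pm"
proof -
  have *: "z islimpt S" if "frontier S = P" "S \<inter> P = {}" "z \<in> P" for P S :: "complex set"
    using that unfolding frontier_def closure_def by blast
  show "z \<in> Pp \<Longrightarrow> z islimpt inside Pp" "z \<in> Pp \<Longrightarrow> z islimpt outside Pp"
    "z \<in> Pm \<Longrightarrow> z islimpt inside Pm" "z \<in> Pm \<Longrightarrow> z islimpt outside Pm"
    by (rule *[OF frontier_regions(1) inside_no_overlap], assumption)
      (rule *[OF frontier_regions(2) outside_no_overlap] *[OF frontier_regions(3) inside_no_overlap]
        *[OF frontier_regions(4) outside_no_overlap], assumption)+
qed

lemma regions_cover: "- (Pp \<union> Pm) = inside Pp \<union> (inside Pm \<union> (outside Pp \<inter> outside Pm))"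
proof -
  have "inside Pp \<union> outside Pp = - Pp" "inside Pm \<union> outside Pm = - Pm" by (rule inside_Un_outside)+
  moreover have "inside Pp \<inter> Pm = {}" "inside Pm \<inter> Pp = {}"
    using inside_p_subset inside_m_subset gp(4) gm(4) by (force)+
  ultimately show ?thesis by blast
qed

lemma inside_p_cases: "z \<in> inside Pp \<Longrightarrow> z \<notin> inside Pm \<and> z \<notin> outside Pp \<and> z \<in> outside Pm \<and> z \<notin> lower_seg a b"
  and inside_m_cases: "z \<in> inside Pm \<Longrightarrow> z \<notin> inside Pp \<and> z \<notin> outside Pm \<and> z \<in> outside Pp \<and> z \<notin> upper_seg a b"
  and outside_cases: "z \<in> outside Pp \<inter> outside Pm \<Longrightarrow> z \<notin> inside Pp \<and> z \<notin> inside Pm \<and> z \<notin> upper_seg a b \<and> z \<notin> lower_seg a b"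
proof -
  have io: "inside Pp \<inter> outside Pp = {}" "inside Pm \<inter> outside Pm = {}" by (rule inside_Int_outside)+
  have u: "inside Pp \<union> outside Pp = - Pp" "inside Pm \<union> outside Pm = - Pm" by (rule inside_Un_outside)+
  show "z \<in> inside Pp \<Longrightarrow> z \<notin> inside Pm \<and> z \<notin> outside Pp \<and> z \<in> outside Pm \<and> z \<notin> lower_seg a b"
  proof -
    assume z: "z \<in> inside Pp"
    then have "0 < Im z" using inside_p_subset by blast
    then have "z \<notin> inside Pm" "z \<notin> Pm" using inside_m_subset gm(4) by force+
    then show ?thesis using z io u gm(5) by blast
  qed
  show "z \<in> inside Pm \<Longrightarrow> z \<notin> inside Pp \<and> z \<notin> outside Pm \<and> z \<in> outside Pp \<and> z \<notin> upper_seg a b"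
  proof -
    assume z: "z \<in> inside Pm"
    then have "Im z < 0" using inside_m_subset by blast
    then have "z \<notin> inside Pp" "z \<notin> Pp" using inside_p_subset gp(4) by force+
    then show ?thesis using z io u gp(5) by blast
  qed
  show "z \<in> outside Pp \<inter> outside Pm \<Longrightarrow> z \<notin> inside Pp \<and> z \<notin> inside Pm \<and> z \<notin> upper_seg a b \<and> z \<notin> lower_seg a b"
    using io gp(5) gm(5) by blast
qed

lemma path_p_cases: "z \<in> Pp \<Longrightarrow> 0 < Im z \<and> z \<notin> upper_seg a b \<and> z \<notin> lower_seg a b \<and> z \<in> outside Pm"
  and path_m_cases: "z \<in> Pm \<Longrightarrow> Im z < 0 \<and> z \<notin> upper_seg a b \<and> z \<notin> lower_seg a b \<and> z \<in> outside Pp"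
proof -
  have n: "inside Pp \<inter> Pp = {}" "inside Pm \<inter> Pm = {}" by (rule inside_no_overlap)+
  have u: "inside Pp \<union> outside Pp = - Pp" "inside Pm \<union> outside Pm = - Pm" by (rule inside_Un_outside)+
  show "z \<in> Pp \<Longrightarrow> 0 < Im z \<and> z \<notin> upper_seg a b \<and> z \<notin> lower_seg a b \<and> z \<in> outside Pm"
  proof -
    assume z: "z \<in> Pp"
    then have im: "0 < Im z" using gp(4) by blast
    then have "z \<notin> inside Pm" "z \<notin> Pm" using inside_m_subset gm(4) by force+
    then show ?thesis using z im n u gm(5) gp(5) by blast
  qed
  show "z \<in> Pm \<Longrightarrow> Im z < 0 \<and> z \<notin> upper_seg a b \<and> z \<notin> lower_seg a b \<and> z \<in> outside Pp"
  proof -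
    assume z: "z \<in> Pm"
    then have im: "Im z < 0" using gm(4) by blast
    then have "z \<notin> inside Pp" "z \<notin> Pp" using inside_p_subset gp(4) by force+
    then show ?thesis using z im n u gm(5) gp(5) by blast
  qed
qed

section \<open>Existence of a symmetric solution of the limiting problem\<close>

text \<open>Dressing inside the curves moves the discontinuity from the segments to the curves.
  There \<open>X\<close> is continuous, so the jump is the triangular factor itself, with
  \<open>- cauchy_R z\<close> above and, by the symmetry, \<open>cauchy_R (- z)\<close>
  below.\<close>

lemma gas_solution_of_limit_problem:
  fixes X :: "complex \<Rightarrow> complex^2"
  assumes X: "soliton_gas_rhp a b r1 x X"
  shows "\<exists>Z. symmetric_limit_rhp a b r1 \<gamma>p \<gamma>m x Z \<and> (\<forall>z\<in>outside Pp \<inter> outside Pm. Z z = X z)"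
proof -
  let ?U = "upper_seg a b" and ?L = "lower_seg a b" and ?H = "{z::complex. 0 < Im z}"
  let ?e = "\<lambda>z. exp (2 * \<i> * z * of_real x)"
  obtain Y H where Y: "Y holomorphic_on - ?L" and H: "H holomorphic_on ?H"
    and XY': "\<forall>z\<in>- (?U \<union> ?L). X z $ 2 = Y z \<and> X z $ 1 = Y (- z)"
    and HX': "\<forall>z\<in>?H - ?U. H z = X z $ 1 - ?e z * cauchy_R z * X z $ 2"
    using soliton_gas_extension[OF X] by (elim exE conjE)
  note XY = bspec[OF XY'] and HX = bspec[OF HX']
  define Z where "Z z = (if z \<in> inside Pp then vector [H z, Y z] else if z \<in> inside Pm then vector [Y (- z), H (- z)] else X z)" for z
  have opL: "open (- ?L)" and opUL: "open (- (?U \<union> ?L))" by (auto simp: open_Compl)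
  have opH: "open ?H" by (rule open_halfspace_Im_gt)
  have Zin: "Z z = vector [H z, Y z]" if "z \<in> inside Pp" for z using that by (simp add: Z_def)
  have Zim: "Z z = vector [Y (- z), H (- z)]" if "z \<in> inside Pm" for z using that inside_m_cases[OF that] by (simp add: Z_def)
  have Zout: "Z z = X z" if "z \<in> outside Pp \<inter> outside Pm" for z using outside_cases[OF that] by (simp add: Z_def)
  have Xhol: "(\<lambda>z. X z $ i) holomorphic_on - (?U \<union> ?L)" for i
    using X unfolding soliton_gas_rhp_def Let_def row_holomorphic_on_def by blast
  have Xcont: "(X \<longlongrightarrow> X z) (at z within S)" if "z \<in> - (?U \<union> ?L)" for z S
    by (rule vec_tendstoI) (rule holomorphic_tendsto_within[OF Xhol opUL that])
  have hin: "(\<lambda>z. Z z $ i) holomorphic_on inside Pp" for i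
  proof -
    have "inside Pp \<subseteq> - ?L" using inside_p_cases by blast
    then have "Y holomorphic_on inside Pp" by (rule holomorphic_on_subset[OF Y])
    moreover have "H holomorphic_on inside Pp" by (rule holomorphic_on_subset[OF H inside_p_subset])
    ultimately have "(\<lambda>z. (vector [H z, Y z] :: complex^2) $ i) holomorphic_on inside Pp"
      using exhaust_2[of i] by (elim disjE) simp_all
    then show ?thesis by (rule holomorphic_transform) (simp add: Zin)
  qed
  have him: "(\<lambda>z. Z z $ i) holomorphic_on inside Pm" for i
  proof -
    have neg: "(\<lambda>z. - z) holomorphic_on inside Pm" by (intro holomorphic_intros)
    have sub: "uminus ` inside Pm \<subseteq> ?H" using inside_m_subset by auto
    moreover have "?H \<subseteq> - ?L" using lower_subset by auto
    ultimately have "uminus ` inside Pm \<subseteq> - ?L" by (rule order.trans)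
    with sub have "(\<lambda>z. H (- z)) holomorphic_on inside Pm" "(\<lambda>z. Y (- z)) holomorphic_on inside Pm"
      using holomorphic_on_compose_gen[OF neg H] holomorphic_on_compose_gen[OF neg Y] by (simp_all add: o_def)
    then have "(\<lambda>z. (vector [Y (- z), H (- z)] :: complex^2) $ i) holomorphic_on inside Pm"
      using exhaust_2[of i] by (elim disjE) simp_all
    then show ?thesis by (rule holomorphic_transform) (simp add: Zim)
  qed
  have hout: "(\<lambda>z. Z z $ i) holomorphic_on outside Pp \<inter> outside Pm" for i
  proof (rule holomorphic_transform)
    show "(\<lambda>z. X z $ i) holomorphic_on outside Pp \<inter> outside Pm"
      by (rule holomorphic_on_subset[OF Xhol]) (use outside_cases in blast)
  qed (simp add: Zout)
  have "row_holomorphic_on Z (- (Pp \<union> Pm))"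
    unfolding row_holomorphic_on_def regions_cover
    by (intro allI holomorphic_on_Un hin him hout open_regions open_Un open_Int)
  moreover have "has_jump Z (inside Pp) (outside Pp)
        (mat22 1 0 (?e z * contour_integral (linepath (\<i> * of_real a) (\<i> * of_real b))
                (\<lambda>\<zeta>. 2 * \<i> * r1 \<zeta> / (\<zeta> - z) / (2 * of_real pi * \<i>))) 1) z" if z: "z \<in> Pp" for z
  proof -
    note zc = path_p_cases[OF z]
    have 1: "(Z \<longlongrightarrow> vector [H z, Y z]) (at z within inside Pp)"
    proof (rule Lim_transform_eventually)
      show "((\<lambda>z. vector [H z, Y z]) \<longlongrightarrow> (vector [H z, Y z] :: complex^2)) (at z within inside Pp)"
        by (intro tendsto_vector_2 holomorphic_tendsto_within[OF H opH] holomorphic_tendsto_within[OF Y opL]) (use zc in auto)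
      show "eventually (\<lambda>z. vector [H z, Y z] = Z z) (at z within inside Pp)"
        by (simp add: eventually_at_filter Zin)
    qed
    have 2: "(Z \<longlongrightarrow> X z) (at z within outside Pp)"
    proof (rule Lim_transform_eventually)
      show "(X \<longlongrightarrow> X z) (at z within outside Pp)" using zc by (intro Xcont) auto
      show "eventually (\<lambda>z. X z = Z z) (at z within outside Pp)"
        unfolding eventually_at_topological
        by (intro exI[of _ "outside Pm"] conjI open_regions) (use zc Zout in auto)
    qed
    have eq: "vector [H z, Y z] = X z v* mat22 1 0 (?e z * - cauchy_R z) 1"
    proof -
      have "H z = X z $ 1 - ?e z * cauchy_R z * X z $ 2" "Y z = X z $ 2" using HX[of z] XY[of z] zc by auto
      then show ?thesis unfolding vec_eq_iff forall_2 by (simp add: mult_ac)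
    qed
    show ?thesis unfolding has_jump_def contour_integral_upper
      by (rule exI[of _ "vector [H z, Y z]"], rule exI[of _ "X z"]) (intro conjI 1 2 eq)
  qed
  moreover have "has_jump Z (outside Pm) (inside Pm)
        (mat22 1 (exp (- 2 * \<i> * z * of_real x) * contour_integral (linepath (- \<i> * of_real b) (- \<i> * of_real a))
                (\<lambda>\<zeta>. 2 * \<i> * r1 \<zeta> / (\<zeta> - z) / (2 * of_real pi * \<i>))) 0 1) z" if z: "z \<in> Pm" for z
  proof -
    note zc = path_m_cases[OF z]
    have nz: "- z \<in> ?H" "- z \<in> - ?L" "- z \<notin> ?U"
      using zc lower_subset lower_seg_iff[OF ab_le, of z] by auto
    have tn: "((\<lambda>w. f (- w)) \<longlongrightarrow> f (- z)) (at z within S)" if f: "f holomorphic_on A" "open A" "- z \<in> A" for f A S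
    proof -
      have "isCont f (- z)" unfolding isCont_def by (rule holomorphic_tendsto_within[OF f])
      moreover have "isCont (\<lambda>w::complex. - w) z" by (intro continuous_minus continuous_ident)
      ultimately have "isCont (\<lambda>w. f (- w)) z" by (rule isCont_o2[rotated])
      then show ?thesis unfolding isCont_def by (rule Lim_at_imp_Lim_at_within)
    qed
    have 1: "(Z \<longlongrightarrow> vector [Y (- z), H (- z)]) (at z within inside Pm)"
    proof (rule Lim_transform_eventually)
      show "((\<lambda>z. vector [Y (- z), H (- z)]) \<longlongrightarrow> (vector [Y (- z), H (- z)] :: complex^2)) (at z within inside Pm)"
        by (intro tendsto_vector_2 tn[OF H opH nz(1)] tn[OF Y opL nz(2)])
      show "eventually (\<lambda>z. vector [Y (- z), H (- z)] = Z z) (at z within inside Pm)"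
        by (simp add: eventually_at_filter Zim)
    qed
    have 2: "(Z \<longlongrightarrow> X z) (at z within outside Pm)"
    proof (rule Lim_transform_eventually)
      show "(X \<longlongrightarrow> X z) (at z within outside Pm)" using zc by (intro Xcont) auto
      show "eventually (\<lambda>z. X z = Z z) (at z within outside Pm)"
        unfolding eventually_at_topological
        by (intro exI[of _ "outside Pp"] conjI open_regions) (use zc Zout in auto)
    qed
    \<comment> \<open>The lower curve is clockwise, so the left boundary value is the one from
      outside: \<open>X z\<close> stands on the left and the dressed vector carries the jump
      matrix.\<close>
    have eq: "X z = vector [Y (- z), H (- z)] v* mat22 1 (exp (- 2 * \<i> * z * of_real x) * cauchy_R (- z)) 0 1"
    proof -
      have "H (- z) = X (- z) $ 1 - ?e (- z) * cauchy_R (- z) * X (- z) $ 2" using HX[of "- z"] nz by blast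
      moreover have "X (- z) $ 2 = Y (- z)" "X (- z) $ 1 = Y (- (- z))" using XY[of "- z"] nz by blast+
      moreover have "X z $ 2 = Y z" "X z $ 1 = Y (- z)" using XY[of z] zc by auto
      ultimately show ?thesis unfolding vec_eq_iff forall_2 by (simp add: mult_ac)
    qed
    show ?thesis unfolding has_jump_def contour_integral_lower
      by (rule exI[of _ "X z"], rule exI[of _ "vector [Y (- z), H (- z)]"]) (intro conjI 1 2 eq)
  qed
  moreover have "normalized_at_infinity Z"
  proof -
    have "bounded (inside Pp \<union> inside Pm)" using bounded_insides by simp
    then obtain B where B: "\<forall>z\<in>inside Pp \<union> inside Pm. norm z \<le> B" unfolding bounded_iff by blast
    have "eventually (\<lambda>z::complex. norm (Z z - vector [1, 1]) = norm (X z - vector [1, 1])) at_infinity"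
      unfolding eventually_at_infinity
    proof (intro exI[of _ "B + 1"] allI impI)
      fix z :: complex assume "B + 1 \<le> norm z"
      then have "z \<notin> inside Pp" "z \<notin> inside Pm" using B by force+
      then show "norm (Z z - vector [1, 1]) = norm (X z - vector [1, 1])" by (simp add: Z_def)
    qed
    note ev = this
    have "normalized_at_infinity X" using X unfolding soliton_gas_rhp_def Let_def by blast
    then show ?thesis
      unfolding normalized_at_infinity_def by (simp only: landau_o.big.in_cong[OF ev])
  qed
  moreover have "swap_symmetric_on (outside Pp \<inter> outside Pm) Z"
    unfolding swap_symmetric_on_def
  proof (intro ballI impI)
    fix z assume z: "z \<in> outside Pp \<inter> outside Pm" "- z \<in> outside Pp \<inter> outside Pm"
    have "swap_symmetric_on (- (?U \<union> ?L)) X" using X unfolding soliton_gas_rhp_def Let_def by blast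
    moreover have "z \<in> - (?U \<union> ?L)" "- z \<in> - (?U \<union> ?L)" using outside_cases z by blast+
    ultimately have "X (- z) = X z v* mat22 0 1 1 0" unfolding swap_symmetric_on_def by blast
    then show "Z (- z) = Z z v* mat22 0 1 1 0" by (simp only: Zout[OF z(1)] Zout[OF z(2)])
  qed
  ultimately have "symmetric_limit_rhp a b r1 \<gamma>p \<gamma>m x Z"
    unfolding symmetric_limit_rhp_def limit_rhp_def by (intro conjI ballI)
  then show ?thesis using Zout by (intro exI[of _ Z] conjI ballI)
qed

end

section \<open>Integral representation of the symmetric solutions\<close>

lemma integral_neg_ii_kernel:
  "\<i> * integral {a..b} (\<lambda>t. f t / (- (\<i> * of_real s) - \<i> * of_real t)) = - integral {a..b} (\<lambda>t. f t / of_real (s + t) :: complex)"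
proof -
  have "integral {a..b} (\<lambda>t. f t / (- (\<i> * of_real s) - \<i> * of_real t)) = integral {a..b} (\<lambda>t. \<i> * (f t / of_real (s + t)))"
  proof (rule integral_cong)
    fix t
    have "- (\<i> * of_real s) - \<i> * of_real t = - (\<i> * of_real (s + t))" by (simp add: algebra_simps)
    then show "f t / (- (\<i> * of_real s) - \<i> * of_real t) = \<i> * (f t / of_real (s + t))"
      by (simp only: minus_divide_right[symmetric] divide_divide_eq_left[symmetric]) (simp add: field_simps)
  qed
  then show ?thesis by (simp only: integral_mult_right) simp
qed

context soliton_contours
begin

lemma extension_across_p:
  assumes "open S" "f holomorphic_on S - Pp"
    and "\<And>z. z \<in> S \<inter> Pp \<Longrightarrow> \<exists>l. (f \<longlongrightarrow> l) (at z within inside Pp) \<and> (f \<longlongrightarrow> l) (at z within outside Pp)"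
  shows "\<exists>F. F holomorphic_on S \<and> (\<forall>z\<in>S - Pp. F z = f z)"
proof -
  have "z islimpt - Pp \<and> (\<exists>l. (f \<longlongrightarrow> l) (at z within - Pp))" if z: "z \<in> S \<inter> Pp" for z
  proof -
    have eq: "- Pp = inside Pp \<union> outside Pp" by simp
    have "\<exists>l. (f \<longlongrightarrow> l) (at z within - Pp)" unfolding eq using assms(3)[OF z] Lim_Un by blast
    moreover have "z islimpt - Pp" unfolding eq using islimpt_subset[OF islimpt_regions(1)[of z] Un_upper1] z by blast
    ultimately show ?thesis by (intro conjI)
  qed
  then obtain F where "F holomorphic_on S" "\<And>z. z \<in> S - Pp \<Longrightarrow> F z = f z"
    using holomorphic_extension_across_path[OF assms(1) gp(1,2) assms(2)] by metis
  then show ?thesis by (intro exI[of _ F]) simp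
qed

lemma extension_across_m:
  assumes "open S" "f holomorphic_on S - Pm"
    and "\<And>z. z \<in> S \<inter> Pm \<Longrightarrow> \<exists>l. (f \<longlongrightarrow> l) (at z within inside Pm) \<and> (f \<longlongrightarrow> l) (at z within outside Pm)"
  shows "\<exists>F. F holomorphic_on S \<and> (\<forall>z\<in>S - Pm. F z = f z)"
proof -
  have "z islimpt - Pm \<and> (\<exists>l. (f \<longlongrightarrow> l) (at z within - Pm))" if z: "z \<in> S \<inter> Pm" for z
  proof -
    have eq: "- Pm = inside Pm \<union> outside Pm" by simp
    have "\<exists>l. (f \<longlongrightarrow> l) (at z within - Pm)" unfolding eq using assms(3)[OF z] Lim_Un by blast
    moreover have "z islimpt - Pm" unfolding eq using islimpt_subset[OF islimpt_regions(3)[of z] Un_upper1] z by blast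
    ultimately show ?thesis by (intro conjI)
  qed
  then obtain F where "F holomorphic_on S" "\<And>z. z \<in> S - Pm \<Longrightarrow> F z = f z"
    using holomorphic_extension_across_path[OF assms(1) gm(1,2) assms(2)] by metis
  then show ?thesis by (intro exI[of _ F]) simp
qed

text \<open>The inverse triangular factor changes the first component only inside the upper curve
  and the second only inside the lower one. Each component is continued first across the curve where
  it was corrected and then across the other one, where it had no jump. What remains singular is the
  segment on which the Cauchy integral in the factor is singular.\<close>

lemma undo_triangular_factors:
  fixes Z :: "complex \<Rightarrow> complex^2"
  assumes Z: "symmetric_limit_rhp a b r1 \<gamma>p \<gamma>m x Z"
  shows "\<exists>K1 K2. K1 holomorphic_on - upper_seg a b \<and> K2 holomorphic_on - lower_seg a b
     \<and> (\<forall>z\<in>outside Pp \<inter> outside Pm. K1 z = Z z $ 1 \<and> K2 z = Z z $ 2)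
     \<and> (\<forall>z\<in>inside Pp. K2 z = Z z $ 2) \<and> (\<forall>z\<in>inside Pm. K1 z = Z z $ 1)
     \<and> (\<forall>z\<in>inside Pp - upper_seg a b. K1 z = Z z $ 1 + exp (2 * \<i> * z * of_real x) * cauchy_R z * Z z $ 2)
     \<and> (\<forall>z\<in>inside Pm - lower_seg a b. K2 z = Z z $ 2 + exp (2 * \<i> * - z * of_real x) * cauchy_R (- z) * Z z $ 1)"
proof -
  let ?U = "upper_seg a b" and ?L = "lower_seg a b"
  let ?e = "\<lambda>z. exp (2 * \<i> * z * of_real x)"
  have hol: "(\<lambda>z. Z z $ i) holomorphic_on - (Pp \<union> Pm)" for i
    using Z unfolding symmetric_limit_rhp_def limit_rhp_def row_holomorphic_on_def by blast
  have jp: "\<exists>Fp Fm. (Z \<longlongrightarrow> Fp) (at z within inside Pp) \<and> (Z \<longlongrightarrow> Fm) (at z within outside Pp) \<and> Fp = Fm v* mat22 1 0 (?e z * - cauchy_R z) 1"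
    if "z \<in> Pp" for z
    using Z that unfolding symmetric_limit_rhp_def limit_rhp_def has_jump_def contour_integral_upper by blast
  have jm: "\<exists>Fp Fm. (Z \<longlongrightarrow> Fp) (at z within outside Pm) \<and> (Z \<longlongrightarrow> Fm) (at z within inside Pm) \<and> Fp = Fm v* mat22 1 (exp (- 2 * \<i> * z * of_real x) * cauchy_R (- z)) 0 1"
    if "z \<in> Pm" for z
    using Z that unfolding symmetric_limit_rhp_def limit_rhp_def has_jump_def contour_integral_lower by blast
  have opU: "open (- ?U)" "open (- ?L)" by (simp_all add: open_Compl)
  have opM: "open (- (Pm \<union> ?U))" "open (- (Pp \<union> ?L))" by (rule open_Compl[OF closed_Un[OF closed_paths(2) closed_upper_seg]] open_Compl[OF closed_Un[OF closed_paths(1) closed_lower_seg]])+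
  have cA: "(cauchy_R \<longlongrightarrow> cauchy_R z) (at z within S)" if "z \<notin> ?U" for z S
    by (rule holomorphic_tendsto_within[OF holomorphic_cauchy_R opU(1)]) (use that in simp)
  have ce: "(?e \<longlongrightarrow> ?e z) (at z within S)" for z S by (intro tendsto_intros)
  have hAm: "(\<lambda>z. cauchy_R (- z)) holomorphic_on - ?L"
  proof -
    have "uminus ` (- ?L) \<subseteq> - ?U" using lower_seg_iff[OF ab_le] by auto
    moreover have "uminus holomorphic_on (- ?L)" by (rule holomorphic_on_minus[OF holomorphic_on_ident])
    ultimately show ?thesis using holomorphic_on_compose_gen[OF _ holomorphic_cauchy_R] by (simp add: o_def)
  qed
  have cAm: "((\<lambda>z. cauchy_R (- z)) \<longlongrightarrow> cauchy_R (- z)) (at z within S)" if "z \<notin> ?L" for z S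
    by (rule holomorphic_tendsto_within[OF hAm opU(2)]) (use that in simp)
  have cem: "((\<lambda>z. ?e (- z)) \<longlongrightarrow> ?e (- z)) (at z within S)" for z S by (intro tendsto_intros)
  have em: "exp (- 2 * \<i> * z * of_real x) = ?e (- z)" for z by simp

  define F1 where "F1 z = (if z \<in> inside Pp then Z z $ 1 + ?e z * cauchy_R z * Z z $ 2 else Z z $ 1)" for z
  define F2 where "F2 z = (if z \<in> inside Pm then Z z $ 2 + ?e (- z) * cauchy_R (- z) * Z z $ 1 else Z z $ 2)" for z
  have "F1 holomorphic_on (inside Pp - ?U) \<union> (outside Pp - Pm)"
  proof (rule holomorphic_on_Un)
    have "(\<lambda>z. Z z $ 1 + ?e z * cauchy_R z * Z z $ 2) holomorphic_on (inside Pp - ?U)"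
      by (intro holomorphic_intros holomorphic_on_subset[OF hol] holomorphic_on_subset[OF holomorphic_cauchy_R])
        (use regions_cover in blast)+
    then show "F1 holomorphic_on inside Pp - ?U" by (rule holomorphic_transform) (simp add: F1_def)
    have "(\<lambda>z. Z z $ 1) holomorphic_on outside Pp - Pm"
      by (rule holomorphic_on_subset[OF hol]) (use outside_no_overlap[of Pp] in blast)
    then show "F1 holomorphic_on outside Pp - Pm"
      by (rule holomorphic_transform) (use inside_p_cases in \<open>auto simp: F1_def\<close>)
  qed (use open_regions closed_paths in \<open>auto intro!: open_Diff\<close>)
  moreover have "- (Pm \<union> ?U) - Pp \<subseteq> (inside Pp - ?U) \<union> (outside Pp - Pm)" using inside_Un_outside[of Pp] by blast
  ultimately have "F1 holomorphic_on - (Pm \<union> ?U) - Pp" by (rule holomorphic_on_subset)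
  have "\<exists>G1. G1 holomorphic_on - (Pm \<union> ?U) \<and> (\<forall>z\<in>- (Pm \<union> ?U) - Pp. G1 z = F1 z)"
  proof (rule extension_across_p[OF opM(1)])
    show "F1 holomorphic_on - (Pm \<union> ?U) - Pp" by fact
    fix z assume "z \<in> - (Pm \<union> ?U) \<inter> Pp"
    then have z: "z \<in> Pp" by blast
    obtain Fp Fm where F: "(Z \<longlongrightarrow> Fp) (at z within inside Pp)" "(Z \<longlongrightarrow> Fm) (at z within outside Pp)"
      and eq: "Fp = Fm v* mat22 1 0 (?e z * - cauchy_R z) 1"
      using jp[OF z] by (elim exE conjE)
    have zU: "z \<notin> ?U" using path_p_cases[OF z] by blast
    have "((\<lambda>z. Z z $ 1 + ?e z * cauchy_R z * Z z $ 2) \<longlongrightarrow> Fp $ 1 + ?e z * cauchy_R z * Fp $ 2) (at z within inside Pp)"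
      by (intro tendsto_add tendsto_mult tendsto_vec_nth[OF F(1)] ce cA zU)
    then have "(F1 \<longlongrightarrow> Fp $ 1 + ?e z * cauchy_R z * Fp $ 2) (at z within inside Pp)"
      by (rule Lim_transform_eventually) (simp add: eventually_at_filter F1_def)
    moreover have "Fp $ 1 + ?e z * cauchy_R z * Fp $ 2 = Fm $ 1" unfolding eq by simp
    moreover have "(F1 \<longlongrightarrow> Fm $ 1) (at z within outside Pp)"
    proof (rule Lim_transform_eventually[OF tendsto_vec_nth[OF F(2)]])
      have "Z z $ 1 = F1 z" if "z \<in> outside Pp" for z using inside_p_cases[of z] that by (auto simp: F1_def)
      then show "eventually (\<lambda>z. Z z $ 1 = F1 z) (at z within outside Pp)" by (simp add: eventually_at_filter)
    qed
    ultimately show "\<exists>l. (F1 \<longlongrightarrow> l) (at z within inside Pp) \<and> (F1 \<longlongrightarrow> l) (at z within outside Pp)"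
      by (intro exI[of _ "Fm $ 1"]) simp
  qed
  then obtain G1 where G1: "G1 holomorphic_on - (Pm \<union> ?U)" "\<forall>z\<in>- (Pm \<union> ?U) - Pp. G1 z = F1 z" by (elim exE conjE)
  have G1Z: "G1 w = Z w $ 1" if "w \<in> outside Pp" "w \<notin> Pm" for w
  proof -
    have "w \<in> - (Pm \<union> ?U) - Pp" using that outside_no_overlap[of Pp] inside_p_cases[of w] gp(5) by blast
    then have "G1 w = F1 w" using G1(2) by (rule bspec[rotated])
    also have "\<dots> = Z w $ 1" using that inside_p_cases[of w] by (auto simp: F1_def)
    finally show ?thesis .
  qed
  have "\<exists>K1. K1 holomorphic_on - ?U \<and> (\<forall>z\<in>- ?U - Pm. K1 z = G1 z)"
  proof (rule extension_across_m[OF opU(1)])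
    show "G1 holomorphic_on - ?U - Pm" by (rule holomorphic_on_subset[OF G1(1)]) blast
    fix z assume "z \<in> - ?U \<inter> Pm"
    then have z: "z \<in> Pm" by blast
    obtain Fp Fm where F: "(Z \<longlongrightarrow> Fp) (at z within outside Pm)" "(Z \<longlongrightarrow> Fm) (at z within inside Pm)"
      and eq: "Fp = Fm v* mat22 1 (exp (- 2 * \<i> * z * of_real x) * cauchy_R (- z)) 0 1"
      using jm[OF z] by (elim exE conjE)
    have ev: "eventually (\<lambda>w. Z w $ 1 = G1 w) (at z within S)" if "S \<inter> Pm = {}" for S
      unfolding eventually_at_topological
    proof (intro exI[of _ "outside Pp"] conjI ballI impI open_regions)
      show "z \<in> outside Pp" using path_m_cases[OF z] by blast
      fix w assume "w \<in> outside Pp" "w \<in> S"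
      moreover from this have "w \<notin> Pm" using that by blast
      ultimately show "Z w $ 1 = G1 w" by (simp add: G1Z)
    qed
    \<comment> \<open>The lower jump matrix is upper triangular with unit diagonal, so the first
      component is continuous across that curve.\<close>
    have "Fp $ 1 = Fm $ 1" unfolding eq by simp
    then show "\<exists>l. (G1 \<longlongrightarrow> l) (at z within inside Pm) \<and> (G1 \<longlongrightarrow> l) (at z within outside Pm)"
      using Lim_transform_eventually[OF tendsto_vec_nth[OF F(1)] ev[OF outside_no_overlap]]
        Lim_transform_eventually[OF tendsto_vec_nth[OF F(2)] ev[OF inside_no_overlap]]
      by (intro exI[of _ "Fm $ 1"]) simp
  qed
  then obtain K1 where K1: "K1 holomorphic_on - ?U" "\<forall>z\<in>- ?U - Pm. K1 z = G1 z" by (elim exE conjE)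

  have "F2 holomorphic_on (inside Pm - ?L) \<union> (outside Pm - Pp)"
  proof (rule holomorphic_on_Un)
    have "(\<lambda>z. Z z $ 2 + ?e (- z) * cauchy_R (- z) * Z z $ 1) holomorphic_on (inside Pm - ?L)"
      by (intro holomorphic_intros holomorphic_on_subset[OF hol] holomorphic_on_subset[OF hAm])
        (use regions_cover in blast)+
    then show "F2 holomorphic_on inside Pm - ?L" by (rule holomorphic_transform) (simp add: F2_def)
    have "(\<lambda>z. Z z $ 2) holomorphic_on outside Pm - Pp"
      by (rule holomorphic_on_subset[OF hol]) (use outside_no_overlap[of Pm] in blast)
    then show "F2 holomorphic_on outside Pm - Pp"
      by (rule holomorphic_transform) (use inside_m_cases in \<open>auto simp: F2_def\<close>)
  qed (use open_regions closed_paths in \<open>auto intro!: open_Diff\<close>)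
  moreover have "- (Pp \<union> ?L) - Pm \<subseteq> (inside Pm - ?L) \<union> (outside Pm - Pp)" using inside_Un_outside[of Pm] by blast
  ultimately have "F2 holomorphic_on - (Pp \<union> ?L) - Pm" by (rule holomorphic_on_subset)
  have "\<exists>G2. G2 holomorphic_on - (Pp \<union> ?L) \<and> (\<forall>z\<in>- (Pp \<union> ?L) - Pm. G2 z = F2 z)"
  proof (rule extension_across_m[OF opM(2)])
    show "F2 holomorphic_on - (Pp \<union> ?L) - Pm" by fact
    fix z assume "z \<in> - (Pp \<union> ?L) \<inter> Pm"
    then have z: "z \<in> Pm" by blast
    obtain Fp Fm where F: "(Z \<longlongrightarrow> Fp) (at z within outside Pm)" "(Z \<longlongrightarrow> Fm) (at z within inside Pm)"
      and eq: "Fp = Fm v* mat22 1 (exp (- 2 * \<i> * z * of_real x) * cauchy_R (- z)) 0 1"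
      using jm[OF z] by (elim exE conjE)
    have zL: "z \<notin> ?L" using path_m_cases[OF z] by blast
    have "((\<lambda>z. Z z $ 2 + ?e (- z) * cauchy_R (- z) * Z z $ 1) \<longlongrightarrow> Fm $ 2 + ?e (- z) * cauchy_R (- z) * Fm $ 1) (at z within inside Pm)"
      by (intro tendsto_add tendsto_mult tendsto_vec_nth[OF F(2)] cem cAm zL)
    then have "(F2 \<longlongrightarrow> Fm $ 2 + ?e (- z) * cauchy_R (- z) * Fm $ 1) (at z within inside Pm)"
      by (rule Lim_transform_eventually) (simp add: eventually_at_filter F2_def)
    moreover have "Fm $ 2 + ?e (- z) * cauchy_R (- z) * Fm $ 1 = Fp $ 2" unfolding eq em by simp
    moreover have "(F2 \<longlongrightarrow> Fp $ 2) (at z within outside Pm)"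
    proof (rule Lim_transform_eventually[OF tendsto_vec_nth[OF F(1)]])
      have "Z z $ 2 = F2 z" if "z \<in> outside Pm" for z using inside_m_cases[of z] that by (auto simp: F2_def)
      then show "eventually (\<lambda>z. Z z $ 2 = F2 z) (at z within outside Pm)" by (simp add: eventually_at_filter)
    qed
    ultimately show "\<exists>l. (F2 \<longlongrightarrow> l) (at z within inside Pm) \<and> (F2 \<longlongrightarrow> l) (at z within outside Pm)"
      by (intro exI[of _ "Fp $ 2"]) simp
  qed
  then obtain G2 where G2: "G2 holomorphic_on - (Pp \<union> ?L)" "\<forall>z\<in>- (Pp \<union> ?L) - Pm. G2 z = F2 z" by (elim exE conjE)
  have G2Z: "G2 w = Z w $ 2" if "w \<in> outside Pm" "w \<notin> Pp" for w
  proof -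
    have "w \<in> - (Pp \<union> ?L) - Pm" using that outside_no_overlap[of Pm] inside_m_cases[of w] gm(5) by blast
    then have "G2 w = F2 w" using G2(2) by (rule bspec[rotated])
    also have "\<dots> = Z w $ 2" using that inside_m_cases[of w] by (auto simp: F2_def)
    finally show ?thesis .
  qed
  have "\<exists>K2. K2 holomorphic_on - ?L \<and> (\<forall>z\<in>- ?L - Pp. K2 z = G2 z)"
  proof (rule extension_across_p[OF opU(2)])
    show "G2 holomorphic_on - ?L - Pp" by (rule holomorphic_on_subset[OF G2(1)]) blast
    fix z assume "z \<in> - ?L \<inter> Pp"
    then have z: "z \<in> Pp" by blast
    obtain Fp Fm where F: "(Z \<longlongrightarrow> Fp) (at z within inside Pp)" "(Z \<longlongrightarrow> Fm) (at z within outside Pp)"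
      and eq: "Fp = Fm v* mat22 1 0 (?e z * - cauchy_R z) 1"
      using jp[OF z] by (elim exE conjE)
    have ev: "eventually (\<lambda>w. Z w $ 2 = G2 w) (at z within S)" if "S \<inter> Pp = {}" for S
      unfolding eventually_at_topological
    proof (intro exI[of _ "outside Pm"] conjI ballI impI open_regions)
      show "z \<in> outside Pm" using path_p_cases[OF z] by blast
      fix w assume "w \<in> outside Pm" "w \<in> S"
      moreover from this have "w \<notin> Pp" using that by blast
      ultimately show "Z w $ 2 = G2 w" by (simp add: G2Z)
    qed
    have "Fp $ 2 = Fm $ 2" unfolding eq by simp
    then show "\<exists>l. (G2 \<longlongrightarrow> l) (at z within inside Pp) \<and> (G2 \<longlongrightarrow> l) (at z within outside Pp)"
      using Lim_transform_eventually[OF tendsto_vec_nth[OF F(1)] ev[OF inside_no_overlap]]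
        Lim_transform_eventually[OF tendsto_vec_nth[OF F(2)] ev[OF outside_no_overlap]]
      by (intro exI[of _ "Fm $ 2"]) simp
  qed
  then obtain K2 where K2: "K2 holomorphic_on - ?L" "\<forall>z\<in>- ?L - Pp. K2 z = G2 z" by (elim exE conjE)

  have io: "inside Pp \<inter> Pp = {}" "outside Pp \<inter> Pp = {}" "inside Pm \<inter> Pm = {}" "outside Pm \<inter> Pm = {}" by simp_all
  have 1: "K1 z = Z z $ 1" if "z \<in> outside Pp" "z \<notin> Pm" for z
  proof -
    have "z \<in> - ?U - Pm" using that inside_p_cases[of z] gp(5) by blast
    then have "K1 z = G1 z" using K1(2) by (rule bspec[rotated])
    with G1Z[OF that] show ?thesis by simp
  qed
  have 2: "K2 z = Z z $ 2" if "z \<in> outside Pm" "z \<notin> Pp" for z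
  proof -
    have "z \<in> - ?L - Pp" using that inside_m_cases[of z] gm(5) by blast
    then have "K2 z = G2 z" using K2(2) by (rule bspec[rotated])
    with G2Z[OF that] show ?thesis by simp
  qed
  have 3: "K1 z = Z z $ 1 + ?e z * cauchy_R z * Z z $ 2" if z: "z \<in> inside Pp - ?U" for z
  proof -
    have "z \<notin> Pm" using z inside_p_cases[of z] io by blast
    then have "z \<in> - ?U - Pm" "z \<in> - (Pm \<union> ?U) - Pp" using z io by blast+
    then have "K1 z = G1 z" "G1 z = F1 z" using K1(2) G1(2) by blast+
    then show ?thesis using z by (simp add: F1_def)
  qed
  have 4: "K2 z = Z z $ 2 + ?e (- z) * cauchy_R (- z) * Z z $ 1" if z: "z \<in> inside Pm - ?L" for z
  proof -
    have "z \<notin> Pp" using z inside_m_cases[of z] io by blast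
    then have "z \<in> - ?L - Pp" "z \<in> - (Pp \<union> ?L) - Pm" using z io by blast+
    then have "K2 z = G2 z" "G2 z = F2 z" using K2(2) G2(2) by blast+
    then show ?thesis using z by (simp add: F2_def)
  qed
  have 5: "\<forall>z\<in>outside Pp \<inter> outside Pm. K1 z = Z z $ 1 \<and> K2 z = Z z $ 2"
    using 1 2 io by blast
  have 6: "\<forall>z\<in>inside Pp. K2 z = Z z $ 2" using 2 inside_p_cases io by blast
  have 7: "\<forall>z\<in>inside Pm. K1 z = Z z $ 1" using 1 inside_m_cases io by blast
  show ?thesis
    by (rule exI[of _ K1], rule exI[of _ K2]) (intro conjI K1(1) K2(1) 5 6 7 ballI 3 4)
qed

end

context soliton_density
begin

text \<open>One plus a Cauchy transform of the weighted density. For \<open>\<phi>\<close> solving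
  the integral equation, \<open>wave x \<phi> z\<close> and \<open>wave x \<phi> (- z)\<close> are
  the two components of the solution with the triangular factors undone.\<close>

definition wave :: "real \<Rightarrow> (real \<Rightarrow> complex) \<Rightarrow> complex \<Rightarrow> complex" where
  "wave x \<phi> z = 1 + \<i> * integral {a..b} (\<lambda>t. of_real (R t * exp (- 2 * t * x)) * \<phi> t / (z - \<i> * of_real t))"

lemma continuous_density: "continuous_on {a..b} (\<lambda>t. of_real (R t * exp (- 2 * t * x)) :: complex)"
  by (intro continuous_intros continuous_R)

lemma holomorphic_wave:
  assumes "continuous_on {a..b} \<phi>"
  shows "wave x \<phi> holomorphic_on - upper_seg a b"
  unfolding wave_def[abs_def]
  by (intro holomorphic_on_add holomorphic_on_mult holomorphic_on_const holomorphic_on_cauchy_integral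
      continuous_on_mult continuous_density assms)

lemma wave_at_infinity:
  assumes "continuous_on {a..b} \<phi>"
  shows "(wave x \<phi> \<longlongrightarrow> 1) at_infinity"
proof -
  have "((\<lambda>z. 1 + \<i> * integral {a..b} (\<lambda>t. of_real (R t * exp (- 2 * t * x)) * \<phi> t / (z - \<i> * of_real t))) \<longlongrightarrow> 1 + \<i> * 0) at_infinity"
    by (intro tendsto_add tendsto_mult tendsto_const tendsto_cauchy_integral_at_infinity
        continuous_on_mult continuous_density assms) (use a_pos ab in auto)
  then show ?thesis by (simp add: wave_def[abs_def])
qed

text \<open>On the lower imaginary axis the Cauchy kernel becomes the positive kernel
  \<open>1 / (s + t)\<close>, so the integral equation states that this value is
  \<open>\<phi> s\<close>.\<close>

lemma wave_neg_ii:
  "wave x \<phi> (- (\<i> * of_real s)) = 1 - integral {a..b} (\<lambda>t. of_real (R t * exp (- 2 * t * x)) * \<phi> t / of_real (s + t))"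
  unfolding wave_def integral_neg_ii_kernel by simp

end

context soliton_contours
begin

lemma bounded_not_outside: "bounded (- outside Pp \<union> - outside Pm)"
  unfolding bounded_Un by (intro conjI cobounded_outside bounded_valid_path_image gp(1) gm(1))

text \<open>Take \<open>\<phi>\<close> to be the undressed second component \<open>K2\<close> on the
  upper segment. The undressed first component \<open>K1\<close> and the wave of
  \<open>\<phi>\<close> have the same singular part there, because multiplying
  \<open>cauchy_R\<close> by a holomorphic function or multiplying the density inside the integral
  differ by a holomorphic commutator. Their difference is entire and vanishes at infinity. The
  symmetry then yields \<open>K2\<close>, and with it the integral equation.\<close>

lemma limit_problem_representation:
  fixes Z :: "complex \<Rightarrow> complex^2"
  assumes Z: "symmetric_limit_rhp a b r1 \<gamma>p \<gamma>m x Z"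
  shows "\<exists>\<phi>. continuous_on {a..b} \<phi>
     \<and> (\<forall>s\<in>{a..b}. \<phi> s + integral {a..b} (\<lambda>t. of_real (R t * exp (- 2 * t * x)) * \<phi> t / of_real (s + t)) = 1)
     \<and> (\<forall>z\<in>outside Pp \<inter> outside Pm. Z z $ 1 = wave x \<phi> z \<and> Z z $ 2 = wave x \<phi> (- z))
     \<and> (\<forall>z\<in>inside Pp. Z z $ 2 = wave x \<phi> (- z)) \<and> (\<forall>z\<in>inside Pm. Z z $ 1 = wave x \<phi> z)
     \<and> (\<forall>z\<in>inside Pp - upper_seg a b.
          Z z $ 1 = wave x \<phi> z - exp (2 * \<i> * z * of_real x) * cauchy_R z * wave x \<phi> (- z))
     \<and> (\<forall>z\<in>inside Pm - lower_seg a b.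
          Z z $ 2 = wave x \<phi> (- z) - exp (2 * \<i> * - z * of_real x) * cauchy_R (- z) * wave x \<phi> z)"
proof -
  let ?U = "upper_seg a b" and ?L = "lower_seg a b" and ?H = "{z::complex. 0 < Im z}"
  let ?e = "\<lambda>z. exp (2 * \<i> * z * of_real x)"
  obtain K1 K2 where K: "K1 holomorphic_on - ?U" "K2 holomorphic_on - ?L"
    and out: "\<forall>z\<in>outside Pp \<inter> outside Pm. K1 z = Z z $ 1 \<and> K2 z = Z z $ 2"
    and inp: "\<forall>z\<in>inside Pp. K2 z = Z z $ 2" and inm: "\<forall>z\<in>inside Pm. K1 z = Z z $ 1"
    and inp': "\<forall>z\<in>inside Pp - ?U. K1 z = Z z $ 1 + ?e z * cauchy_R z * Z z $ 2"
    and inm': "\<forall>z\<in>inside Pm - ?L. K2 z = Z z $ 2 + ?e (- z) * cauchy_R (- z) * Z z $ 1"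
    using undo_triangular_factors[OF Z] by (elim exE conjE)
  have opU: "open (- ?U)" "open (- ?L)" by (simp_all add: open_Compl)
  have opH: "open ?H" by (rule open_halfspace_Im_gt)
  have HL: "?H \<subseteq> - ?L" using lower_subset by auto
  define \<phi> where "\<phi> t = K2 (\<i> * of_real t)" for t :: real
  let ?\<rho> = "\<lambda>t. of_real (R t * exp (- 2 * t * x)) :: complex"
  have itH: "\<i> * of_real t \<in> ?H" if "t \<in> {a..b}" for t using that a_pos by simp
  have c\<phi>: "continuous_on {a..b} \<phi>"
    unfolding \<phi>_def
    by (intro continuous_on_compose2[OF holomorphic_on_imp_continuous_on[OF K(2)]] continuous_intros)
      (use itH HL in blast)
  define g where "g z = ?e z * K2 z" for z
  have "K2 holomorphic_on ?H" by (rule holomorphic_on_subset[OF K(2) HL])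
  then have ghol: "g holomorphic_on ?H" unfolding g_def by (intro holomorphic_intros)
  have git: "of_real (R t) * g (\<i> * of_real t) = ?\<rho> t * \<phi> t" for t
  proof -
    have "2 * \<i> * (\<i> * of_real t) * of_real x = (of_real (- 2 * t * x) :: complex)" by (simp add: mult_ac)
    then have "exp (2 * \<i> * (\<i> * of_real t) * of_real x) = (of_real (exp (- 2 * t * x)) :: complex)"
      by (simp only: exp_of_real)
    then show ?thesis unfolding g_def \<phi>_def by (simp only: of_real_mult mult.assoc)
  qed
  \<comment> \<open>Up to the factor \<open>\<i>\<close>, \<open>D\<close> is the difference between
    \<open>g * cauchy_R\<close> and the Cauchy integral of the density multiplied by
    \<open>g\<close>, continued across the segment.\<close>
  obtain D where D: "D holomorphic_on ?H"
    "\<forall>z\<in>?H - ?U. D z = integral {a..b} (\<lambda>t. of_real (R t) * (g z - g (\<i> * of_real t)) / (z - \<i> * of_real t))"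
    using difference_quotient_integral_extension[OF ab convex_halfspace_Im_gt opH upper_subset ghol continuous_of_real_R]
    by (elim exE conjE)
  have D_eq: "\<i> * D z = g z * cauchy_R z - (wave x \<phi> z - 1)" if z: "z \<in> ?H - ?U" for z
  proof -
    have nz: "z - \<i> * of_real t \<noteq> 0" if "t \<in> {a..b}" for t using not_upper_seg_imp_neq z that by blast
    have "D z = integral {a..b} (\<lambda>t. g z * (of_real (R t) / (z - \<i> * of_real t)) - ?\<rho> t * \<phi> t / (z - \<i> * of_real t))"
      unfolding bspec[OF D(2) z] git[symmetric]
      by (intro integral_cong) (simp add: diff_divide_distrib right_diff_distrib mult.commute)
    also have "\<dots> = integral {a..b} (\<lambda>t. g z * (of_real (R t) / (z - \<i> * of_real t))) - integral {a..b} (\<lambda>t. ?\<rho> t * \<phi> t / (z - \<i> * of_real t))"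
      using nz by (intro integral_diff integrable_continuous_real continuous_intros continuous_R c\<phi>) blast+
    also have "\<dots> = g z * integral {a..b} (\<lambda>t. of_real (R t) / (z - \<i> * of_real t)) - integral {a..b} (\<lambda>t. ?\<rho> t * \<phi> t / (z - \<i> * of_real t))"
      by (simp only: integral_mult_right)
    finally show ?thesis by (simp add: cauchy_R_def wave_def right_diff_distrib mult_ac)
  qed
  note whol = holomorphic_wave[OF c\<phi>, of x]
  \<comment> \<open>Two expressions for the difference of \<open>K1\<close> and the wave. The one
    used inside the upper curve is built from \<open>Z\<close> and \<open>D\<close> and has no
    singularity on the segment, which makes \<open>E\<close> entire.\<close>
  define E where "E z = (if z \<in> inside Pp then Z z $ 1 - 1 + \<i> * D z else K1 z - wave x \<phi> z)" for z
  have E_off: "E z = K1 z - wave x \<phi> z" if z: "z \<notin> ?U" for z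
  proof (cases "z \<in> inside Pp")
    case True
    then have "z \<in> ?H - ?U" using z inside_p_subset by blast
    moreover have "K1 z = Z z $ 1 + ?e z * cauchy_R z * K2 z" using inp inp' True z by auto
    ultimately show ?thesis using True D_eq[of z] by (simp add: E_def g_def algebra_simps)
  qed (simp add: E_def)
  have "E holomorphic_on UNIV"
  proof -
    have "(\<lambda>z. K1 z - wave x \<phi> z) holomorphic_on - ?U" by (intro holomorphic_on_diff K whol)
    then have 1: "E holomorphic_on - ?U" by (rule holomorphic_transform) (simp add: E_off)
    have "(\<lambda>z. Z z $ 1) holomorphic_on inside Pp"
    proof (rule holomorphic_on_subset)
      show "(\<lambda>z. Z z $ 1) holomorphic_on - (Pp \<union> Pm)"
        using Z unfolding symmetric_limit_rhp_def limit_rhp_def row_holomorphic_on_def by blast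
    qed (use regions_cover in blast)
    then have "(\<lambda>z. Z z $ 1 - 1 + \<i> * D z) holomorphic_on inside Pp"
      by (intro holomorphic_intros holomorphic_on_subset[OF D(1) inside_p_subset])
    then have 2: "E holomorphic_on inside Pp" by (rule holomorphic_transform) (simp add: E_def)
    have "E holomorphic_on - ?U \<union> inside Pp" by (rule holomorphic_on_Un[OF 1 2 opU(1) open_regions(1)])
    moreover have "- ?U \<union> inside Pp = UNIV" using gp(5) by blast
    ultimately show ?thesis by simp
  qed
  moreover have "(E \<longlongrightarrow> 0) at_infinity"
  proof -
    have "normalized_at_infinity Z" using Z unfolding symmetric_limit_rhp_def limit_rhp_def by blast
    from tendsto_diff[OF normalized_at_infinity_tendsto(1)[OF this] wave_at_infinity[OF c\<phi>]]
    have lim: "((\<lambda>z. Z z $ 1 - wave x \<phi> z) \<longlongrightarrow> 0) at_infinity" by simp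
    obtain B where B: "\<forall>z\<in>- outside Pp \<union> - outside Pm. norm z \<le> B"
      using bounded_not_outside unfolding bounded_iff by blast
    have "eventually (\<lambda>z. Z z $ 1 - wave x \<phi> z = E z) at_infinity"
      unfolding eventually_at_infinity
    proof (intro exI[of _ "B + 1"] allI impI)
      fix z :: complex assume "B + 1 \<le> norm z"
      then have z: "z \<in> outside Pp \<inter> outside Pm" using B by force
      then have "K1 z = Z z $ 1" using out by blast
      moreover have "z \<notin> ?U" using outside_cases[OF z] by blast
      ultimately show "Z z $ 1 - wave x \<phi> z = E z" by (simp add: E_off)
    qed
    with lim show ?thesis by (rule Lim_transform_eventually)
  qed
  ultimately have "E z = 0" for z by (rule Liouville_weak_0)
  then have K1: "K1 z = wave x \<phi> z" if "z \<notin> ?U" for z using E_off[OF that] by simp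
  \<comment> \<open>The symmetry of \<open>Z\<close> is known only where \<open>z\<close> and
    \<open>- z\<close> lie outside both curves, in particular for large \<open>norm z\<close>. The
    identity theorem spreads it over the complement of the lower segment, which is
    connected.\<close>
  have K2: "K2 z = wave x \<phi> (- z)" if z: "z \<in> - ?L" for z
  proof -
    obtain B where B: "\<forall>z\<in>- outside Pp \<union> - outside Pm. norm z \<le> B"
      using bounded_not_outside unfolding bounded_iff by blast
    define S where "S = - cball (0::complex) B"
    have S: "z \<in> outside Pp \<inter> outside Pm" "- z \<in> outside Pp \<inter> outside Pm" if "z \<in> S" for z
    proof -
      have far: "w \<in> outside Pp \<inter> outside Pm" if "B < norm w" for w using B that by force
      have "B < norm z" using that by (simp add: S_def)
      then show "z \<in> outside Pp \<inter> outside Pm" "- z \<in> outside Pp \<inter> outside Pm" using far[of z] far[of "- z"] by simp_all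
    qed
    have "(\<lambda>z. wave x \<phi> (- z)) holomorphic_on - ?L"
    proof -
      have "uminus ` (- ?L) \<subseteq> - ?U" using lower_seg_iff[OF ab_le] by auto
      moreover have "uminus holomorphic_on (- ?L)" by (rule holomorphic_on_minus[OF holomorphic_on_ident])
      ultimately show ?thesis using holomorphic_on_compose_gen[OF _ whol] by (simp add: o_def)
    qed
    moreover have "K2 z = wave x \<phi> (- z)" if z: "z \<in> S" for z
    proof -
      have "swap_symmetric_on (outside Pp \<inter> outside Pm) Z" using Z unfolding symmetric_limit_rhp_def by blast
      then have "Z (- z) = Z z v* mat22 0 1 1 0" using S[OF z] unfolding swap_symmetric_on_def by blast
      then have "Z (- z) $ 1 = Z z $ 2" by simp
      moreover have "K2 z = Z z $ 2" "K1 (- z) = Z (- z) $ 1" using out S[OF z] by blast+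
      moreover have "- z \<notin> ?U" using outside_cases[OF S(2)[OF z]] by blast
      ultimately show ?thesis using K1[of "- z"] by simp
    qed
    moreover have "connected (- ?L)"
      by (rule connected_complement_bounded_convex) (simp_all add: compact_imp_bounded)
    moreover have "open S" by (simp add: S_def open_Compl)
    moreover have "S \<subseteq> - ?L" using S(1) outside_cases by blast
    moreover have "S \<noteq> {}" unfolding S_def using cobounded_imp_unbounded[of "- cball (0::complex) B"] by auto
    ultimately show ?thesis
      using analytic_continuation_open[of S "- ?L" K2 "\<lambda>z. wave x \<phi> (- z)" z] opU(2) K(2) z by blast
  qed
  \<comment> \<open>The upper segment lies in the domain of \<open>K2\<close>; evaluating the
    identity there gives back \<open>\<phi>\<close> and closes the equation.\<close>
  have eq: "\<phi> s + integral {a..b} (\<lambda>t. ?\<rho> t * \<phi> t / of_real (s + t)) = 1" if s: "s \<in> {a..b}" for s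
  proof -
    have "\<i> * of_real s \<in> - ?L" using itH[OF s] HL by blast
    from K2[OF this] have "\<phi> s = 1 - integral {a..b} (\<lambda>t. ?\<rho> t * \<phi> t / of_real (s + t))"
      unfolding \<phi>_def[of s] wave_neg_ii .
    then show ?thesis by simp
  qed
  have p2: "Z z $ 2 = wave x \<phi> (- z)" if z: "z \<in> inside Pp" for z
    using inp K2[of z] inside_p_cases[OF z] z by simp
  have m1: "Z z $ 1 = wave x \<phi> z" if z: "z \<in> inside Pm" for z
    using inm K1[of z] inside_m_cases[OF z] z by simp
  have p1: "Z z $ 1 = wave x \<phi> z - ?e z * cauchy_R z * wave x \<phi> (- z)" if z: "z \<in> inside Pp - ?U" for z
    using bspec[OF inp' z] K1[of z] p2[of z] z by (simp add: eq_diff_eq)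
  have m2: "Z z $ 2 = wave x \<phi> (- z) - ?e (- z) * cauchy_R (- z) * wave x \<phi> z" if z: "z \<in> inside Pm - ?L" for z
    using bspec[OF inm' z] K2[of z] m1[of z] z by (simp add: eq_diff_eq)
  have o: "Z z $ 1 = wave x \<phi> z \<and> Z z $ 2 = wave x \<phi> (- z)" if z: "z \<in> outside Pp \<inter> outside Pm" for z
    using bspec[OF out z] K1[of z] K2[of z] outside_cases[OF z] by simp
  show ?thesis by (rule exI[of _ \<phi>]) (intro conjI ballI c\<phi> eq o[THEN conjunct1] o[THEN conjunct2] p1 p2 m1 m2)
qed

end

section \<open>Convergence of the discrete waves and of their dressed forms\<close>

context soliton_density
begin

definition waveN :: "real \<Rightarrow> (real \<Rightarrow> complex) \<Rightarrow> nat \<Rightarrow> complex \<Rightarrow> complex" where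
  "waveN x \<psi> N z = 1 + \<i> * riemann_sum a b N (\<lambda>t. of_real (R t * exp (- 2 * t * x)) * \<psi> t / (z - \<i> * of_real t))"

definition cauchy_RN :: "nat \<Rightarrow> complex \<Rightarrow> complex" where
  "cauchy_RN N z = \<i> * riemann_sum a b N (\<lambda>t. of_real (R t) / (z - \<i> * of_real t))"

text \<open>The map \<open>k\<close> will be the identity or negation, since both components involve
  the same wave at \<open>z\<close> and at \<open>- z\<close>. Staying off the segment keeps the
  kernel continuous on the compact product.\<close>

lemma uniform_limit_riemann_cauchy:
  fixes k :: "complex \<Rightarrow> complex"
  assumes K: "compact K" "continuous_on K k" "k ` K \<inter> upper_seg a b = {}"
    and f: "continuous_on {a..b} f" and lim: "uniform_limit {a..b} F f sequentially"
  shows "uniform_limit K (\<lambda>N z. riemann_sum a b N (\<lambda>t. F N t / (k z - \<i> * of_real t)))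
     (\<lambda>z. integral {a..b} (\<lambda>t. f t / (k z - \<i> * of_real t))) sequentially"
proof (rule riemann_sum_uniform_limit'[OF ab_le K(1)])
  let ?D = "K \<times> {a..b}"
  have nz: "k (fst p) - \<i> * of_real (snd p) \<noteq> 0" if "p \<in> ?D" for p
  proof (rule not_upper_seg_imp_neq)
    show "k (fst p) \<notin> upper_seg a b" using K(3) that by auto
    show "snd p \<in> {a..b}" using that by auto
  qed
  have ck: "continuous_on ?D (\<lambda>p. 1 / (k (fst p) - \<i> * of_real (snd p)))"
    by (intro continuous_intros continuous_on_compose2[OF K(2)]) (use nz in auto)
  have cf: "continuous_on ?D (\<lambda>p. f (snd p))"
    by (intro continuous_on_compose2[OF f] continuous_intros) auto
  show "continuous_on ?D (\<lambda>(z, t). f t / (k z - \<i> * of_real t))"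
    using continuous_on_mult[OF cf ck] by (simp add: case_prod_unfold)
  have cpt: "compact ?D" by (intro compact_Times K(1) compact_Icc)
  have bd: "bounded (h ` ?D)" if "continuous_on ?D h" for h :: "complex \<times> real \<Rightarrow> complex"
    by (intro compact_imp_bounded compact_continuous_image that cpt)
  have "uniform_limit ?D (\<lambda>N p. F N (snd p) * (1 / (k (fst p) - \<i> * of_real (snd p))))
      (\<lambda>p. f (snd p) * (1 / (k (fst p) - \<i> * of_real (snd p)))) sequentially"
    by (rule uniform_lim_mult[OF uniform_limit_imp_Times_snd[OF lim] uniform_limit_const bd[OF cf] bd[OF ck]])
  then show "uniform_limit ?D (\<lambda>N (z, t). F N t / (k z - \<i> * of_real t)) (\<lambda>(z, t). f t / (k z - \<i> * of_real t)) sequentially"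
    by (simp add: case_prod_unfold)
qed

lemma uniform_limit_cauchy_RN:
  fixes k :: "complex \<Rightarrow> complex"
  assumes "compact K" "continuous_on K k" "k ` K \<inter> upper_seg a b = {}"
  shows "uniform_limit K (\<lambda>N z. cauchy_RN N (k z)) (\<lambda>z. cauchy_R (k z)) sequentially"
proof -
  have "uniform_limit {a..b} (\<lambda>N::nat. \<lambda>t. of_real (R t) :: complex) (\<lambda>t. of_real (R t)) sequentially"
    by (rule uniform_limit_const)
  from uniform_limit_riemann_cauchy[OF assms continuous_of_real_R this]
  show ?thesis unfolding cauchy_RN_def cauchy_R_def
    by (rule bounded_linear.uniform_limit[OF bounded_linear_mult_right])
qed

lemma uniform_limit_waveN:
  fixes k :: "complex \<Rightarrow> complex"
  assumes "compact K" "continuous_on K k" "k ` K \<inter> upper_seg a b = {}"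
    and \<phi>: "continuous_on {a..b} \<phi>" and lim: "uniform_limit {a..b} \<psi> \<phi> sequentially"
  shows "uniform_limit K (\<lambda>N z. waveN x (\<psi> N) N (k z)) (\<lambda>z. wave x \<phi> (k z)) sequentially"
proof -
  have bd: "bounded (h ` {a..b})" if "continuous_on {a..b} h" for h :: "real \<Rightarrow> complex"
    by (intro compact_imp_bounded compact_continuous_image that compact_Icc)
  have c: "continuous_on {a..b} (\<lambda>t. of_real (R t * exp (- 2 * t * x)) * \<phi> t)"
    by (rule continuous_on_mult[OF continuous_density \<phi>])
  have "uniform_limit {a..b} (\<lambda>N t. of_real (R t * exp (- 2 * t * x)) * \<psi> N t) (\<lambda>t. of_real (R t * exp (- 2 * t * x)) * \<phi> t) sequentially"
    by (rule uniform_lim_mult[OF uniform_limit_const lim bd[OF continuous_density] bd[OF \<phi>]])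
  note l = uniform_limit_riemann_cauchy[OF assms(1-3) c this]
  show ?thesis unfolding waveN_def wave_def
    by (rule uniform_limit_add[OF uniform_limit_const bounded_linear.uniform_limit[OF bounded_linear_mult_right l]])
qed

text \<open>
  On the segment the approximants are only defined by removing singularities, so convergence
  there is transported from a surrounding curve by the maximum principle.
\<close>

lemma dressed_convergence:
  assumes U0: "open U0" "upper_seg a b \<subseteq> U0" "U0 \<subseteq> {z. 0 < Im z}"
    and \<phi>: "continuous_on {a..b} \<phi>" and lim: "uniform_limit {a..b} \<psi> \<phi> sequentially"
    and HN: "\<And>N. 1 \<le> N \<Longrightarrow> HN N holomorphic_on U0"
      "\<And>N z. 1 \<le> N \<Longrightarrow> z \<in> U0 - upper_seg a b \<Longrightarrow>
         HN N z = waveN x (\<psi> N) N z - exp (2 * \<i> * z * of_real x) * cauchy_RN N z * waveN x (\<psi> N) N (- z)"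
    and H: "H holomorphic_on U0"
      "\<And>z. z \<in> U0 - upper_seg a b \<Longrightarrow>
         H z = wave x \<phi> z - exp (2 * \<i> * z * of_real x) * cauchy_R z * wave x \<phi> (- z)"
    and z0: "z0 \<in> U0"
  shows "(\<lambda>N. HN N z0) \<longlonglongrightarrow> H z0"
proof -
  let ?U = "upper_seg a b" and ?e = "\<lambda>z. exp (2 * \<i> * z * of_real x)"
  have unif: "uniform_limit K HN H sequentially" if K: "compact K" "K \<subseteq> U0 - ?U" for K
  proof -
    have "- z \<notin> ?U" if "z \<in> U0" for z using that U0(3) upper_subset by force
    then have m: "uminus ` K \<inter> ?U = {}" using K(2) by blast
    have i: "(\<lambda>z. z) ` K \<inter> ?U = {}" using K(2) by auto
    have neg: "continuous_on K (\<lambda>z. - z)" by (intro continuous_intros)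
    have bd: "bounded (h ` K)" if "continuous_on K h" for h :: "complex \<Rightarrow> complex"
      by (intro compact_imp_bounded compact_continuous_image that K(1))
    have off: "K \<subseteq> - ?U" using K(2) by blast
    have cw: "continuous_on K (wave x \<phi>)" "continuous_on K cauchy_R"
      by (intro holomorphic_on_imp_continuous_on holomorphic_on_subset[OF _ off] holomorphic_wave \<phi> holomorphic_cauchy_R)+
    have cwm: "continuous_on K (\<lambda>z. wave x \<phi> (- z))"
      by (rule continuous_on_compose2[OF holomorphic_on_imp_continuous_on[OF holomorphic_wave[OF \<phi>]] neg]) (use m in blast)
    have ce: "continuous_on K ?e" by (intro continuous_intros)
    have "uniform_limit K (\<lambda>N z. waveN x (\<psi> N) N z - ?e z * cauchy_RN N z * waveN x (\<psi> N) N (- z))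
        (\<lambda>z. wave x \<phi> z - ?e z * cauchy_R z * wave x \<phi> (- z)) sequentially"
      by (intro uniform_limit_minus uniform_lim_mult bd cw cwm ce continuous_on_mult uniform_limit_const
          uniform_limit_waveN[OF K(1) _ i \<phi> lim] uniform_limit_waveN[OF K(1) neg m \<phi> lim]
          uniform_limit_cauchy_RN[OF K(1) _ i] continuous_on_id)
    moreover have "eventually (\<lambda>N. \<forall>z\<in>K. waveN x (\<psi> N) N z - ?e z * cauchy_RN N z * waveN x (\<psi> N) N (- z) = HN N z) sequentially"
      unfolding eventually_sequentially
    proof (intro exI[of _ 1] allI impI ballI)
      fix N :: nat and z assume "1 \<le> N" "z \<in> K"
      then show "waveN x (\<psi> N) N z - ?e z * cauchy_RN N z * waveN x (\<psi> N) N (- z) = HN N z"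
        using HN(2)[of N z] K(2) by auto
    qed
    moreover have "wave x \<phi> z - ?e z * cauchy_R z * wave x \<phi> (- z) = H z" if "z \<in> K" for z
      using H(2)[of z] K(2) that by auto
    ultimately show ?thesis by (rule iffD1[OF uniform_limit_cong, rotated -1])
  qed
  show ?thesis
  proof (cases "z0 \<in> ?U")
    case False
    then show ?thesis using unif[of "{z0}"] z0 by (simp add: uniform_limit_singleton)
  next
    case True
    have ne: "?U \<noteq> {}" using True by blast
    obtain d where d: "d > 0" "(\<Union>w\<in>?U. ball w d) \<subseteq> U0"
      using compact_subset_open_imp_ball_epsilon_subset[OF compact_upper_seg U0(1,2)] by metis
    \<comment> \<open>Half the distance \<open>d\<close> keeps the closure of this neighbourhood
      inside \<open>U0\<close>, while its frontier is a compact set off the segment, where uniform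
      convergence is already known.\<close>
    define S where "S = {z. infdist z ?U < d / 2}"
    define T where "T = {z. infdist z ?U \<le> d / 2}"
    have near: "\<exists>w\<in>?U. dist z w < d" if "z \<in> T" for z
    proof -
      obtain w where "w \<in> ?U" "infdist z ?U = dist z w" using infdist_attains_inf[OF closed_upper_seg ne] by metis
      then show ?thesis using that d(1) by (intro bexI[of _ w]) (auto simp: T_def)
    qed
    have TU0: "T \<subseteq> U0"
    proof
      fix z assume "z \<in> T"
      from near[OF this] obtain w where "w \<in> ?U" "dist z w < d" by blast
      then have "z \<in> (\<Union>w\<in>?U. ball w d)" by (intro UN_I[of w]) (auto simp: dist_commute)
      then show "z \<in> U0" using d(2) by blast
    qed
    have opS: "open S" unfolding S_def by (intro open_Collect_less continuous_intros)
    have clT: "closed T" unfolding T_def by (intro closed_Collect_le continuous_intros)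
    have "S \<subseteq> T" by (auto simp: S_def T_def)
    then have clS: "closure S \<subseteq> T" using clT by (rule closure_minimal)
    have bT: "bounded T"
    proof -
      obtain B where B: "\<forall>w\<in>?U. norm w \<le> B" using compact_imp_bounded[OF compact_upper_seg] unfolding bounded_iff by metis
      have "norm z \<le> B + d" if "z \<in> T" for z
      proof -
        obtain w where w: "w \<in> ?U" "dist z w < d" using near[OF \<open>z \<in> T\<close>] by blast
        have "norm z \<le> norm w + norm (z - w)" by (metis norm_triangle_sub)
        then show ?thesis using w B by (force simp: dist_norm)
      qed
      then show ?thesis unfolding bounded_iff by blast
    qed
    then have bS: "bounded S" using \<open>S \<subseteq> T\<close> bounded_subset by blast
    have fr: "frontier S = closure S - S" by (simp add: frontier_def interior_open[OF opS])
    have frU: "frontier S \<subseteq> U0 - ?U"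
    proof
      fix z assume z: "z \<in> frontier S"
      then have "z \<in> T" "z \<notin> S" using fr clS by auto
      moreover have "z \<notin> ?U"
      proof
        assume "z \<in> ?U"
        then have "infdist z ?U = 0" by simp
        then show False using \<open>z \<notin> S\<close> d(1) by (simp add: S_def)
      qed
      ultimately show "z \<in> U0 - ?U" using TU0 by blast
    qed
    have "compact (frontier S)" using bS by (rule compact_frontier_bounded)
    note lim_fr = unif[OF this frU]
    have z0S: "z0 \<in> S" using True d(1) by (simp add: S_def)
    show ?thesis unfolding tendsto_iff
    proof (intro allI impI)
      fix e :: real assume e: "e > 0"
      have "eventually (\<lambda>N. \<forall>z\<in>frontier S. dist (HN N z) (H z) < e / 2) sequentially"
        by (rule uniform_limitD[OF lim_fr]) (use e in simp)
      moreover have "eventually (\<lambda>N::nat. 1 \<le> N) sequentially" by (rule eventually_ge_at_top)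
      ultimately show "eventually (\<lambda>N. dist (HN N z0) (H z0) < e) sequentially"
      proof eventually_elim
        fix N :: nat assume N: "\<forall>z\<in>frontier S. dist (HN N z) (H z) < e / 2" "1 \<le> N"
        have hol: "(\<lambda>z. HN N z - H z) holomorphic_on U0" by (intro holomorphic_on_diff HN(1) N(2) H(1))
        have "norm (HN N z0 - H z0) \<le> e / 2"
        proof (rule maximum_modulus_frontier[of "\<lambda>z. HN N z - H z" S])
          show "(\<lambda>z. HN N z - H z) holomorphic_on interior S"
            by (rule holomorphic_on_subset[OF hol]) (use interior_subset \<open>S \<subseteq> T\<close> TU0 in blast)
          show "continuous_on (closure S) (\<lambda>z. HN N z - H z)"
            by (rule continuous_on_subset[OF holomorphic_on_imp_continuous_on[OF hol]]) (use clS TU0 in blast)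
          show "norm (HN N z - H z) \<le> e / 2" if "z \<in> frontier S" for z
            using N(1) that by (force simp: dist_norm)
        qed (use bS z0S in auto)
        then show "dist (HN N z0) (H z0) < e" using e by (simp add: dist_norm)
      qed
    qed
  qed
qed

lemma node_in: "j \<in> {1..N} \<Longrightarrow> riemann_node a b N j \<in> {a..b}"
  using riemann_node_in[OF ab_le] by simp

lemma node_inj: "1 \<le> N \<Longrightarrow> riemann_node a b N j = riemann_node a b N k \<longleftrightarrow> j = k"
  using ab by (auto simp: riemann_node_def)

lemma riemann_cauchy_residue:
  assumes "1 \<le> N" "k \<in> {1..N}"
  defines "q \<equiv> \<i> * of_real (riemann_node a b N k)"
  shows "((\<lambda>z. (z - q) * riemann_sum a b N (\<lambda>t. f t / (z - \<i> * of_real t))) \<longlongrightarrow>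
     of_real ((b - a) / real N) * f (riemann_node a b N k)) (at q)"
proof -
  let ?s = "riemann_node a b N"
  define w where "w j = of_real ((b - a) / real N) * f (?s j)" for j
  have rs: "riemann_sum a b N (\<lambda>t. f t / (z - \<i> * of_real t)) = (\<Sum>j=1..N. w j / (z - \<i> * of_real (?s j)))" for z
    by (simp add: riemann_sum_def w_def)
  define H where "H z = (\<Sum>j\<in>{1..N} - {k}. w j / (z - \<i> * of_real (?s j)))" for z
  have "q - \<i> * of_real (?s j) \<noteq> 0" if "j \<in> {1..N} - {k}" for j
    using node_inj[OF assms(1)] that by (simp add: q_def)
  then have "(H \<longlongrightarrow> H q) (at q)" unfolding H_def by (intro tendsto_intros) auto
  then have "((\<lambda>z. w k + (z - q) * H z) \<longlongrightarrow> w k + (q - q) * H q) (at q)"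
    by (intro tendsto_add tendsto_mult tendsto_diff tendsto_const tendsto_ident_at)
  then have "((\<lambda>z. w k + (z - q) * H z) \<longlongrightarrow> w k) (at q)" by simp
  then show ?thesis
    unfolding w_def[of k, symmetric]
  proof (rule Lim_transform_eventually)
    have "w k + (z - q) * H z = (z - q) * riemann_sum a b N (\<lambda>t. f t / (z - \<i> * of_real t))" if "z \<noteq> q" for z
    proof -
      have "riemann_sum a b N (\<lambda>t. f t / (z - \<i> * of_real t)) = w k / (z - q) + H z"
        unfolding rs H_def q_def by (rule sum.remove) (use assms(2) in auto)
      then show ?thesis using that by (simp add: distrib_left)
    qed
    then show "eventually (\<lambda>z. w k + (z - q) * H z = (z - q) * riemann_sum a b N (\<lambda>t. f t / (z - \<i> * of_real t))) (at q)"
      by (simp add: eventually_at_filter)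
  qed
qed

abbreviation upper_nodes :: "nat \<Rightarrow> complex set" where
  "upper_nodes N \<equiv> (\<lambda>j. \<i> * of_real (riemann_node a b N j)) ` {1..N}"

lemma upper_nodes_subset: "upper_nodes N \<subseteq> upper_seg a b"
proof (rule image_subsetI)
  fix j assume "j \<in> {1..N}"
  then show "\<i> * of_real (riemann_node a b N j) \<in> upper_seg a b" by (intro ii_in_upper_seg node_in)
qed

lemma holomorphic_riemann_cauchy:
  "(\<lambda>z. riemann_sum a b N (\<lambda>t. f t / (z - \<i> * of_real t))) holomorphic_on - upper_nodes N"
  unfolding riemann_sum_def by (intro holomorphic_intros) auto

lemma holomorphic_waveN: "waveN x \<psi> N holomorphic_on - upper_nodes N"
  unfolding waveN_def[abs_def] by (intro holomorphic_intros holomorphic_riemann_cauchy)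

lemma holomorphic_waveN_minus: "(\<lambda>z. waveN x \<psi> N (- z)) holomorphic_on - lower_seg a b"
  unfolding waveN_def riemann_sum_def
proof (intro holomorphic_intros)
  fix z j assume z: "z \<in> - lower_seg a b" and j: "j \<in> {1..N}"
  have "- z \<notin> upper_seg a b" using z lower_seg_iff[OF ab_le] by simp
  then show "- z - \<i> * of_real (riemann_node a b N j) \<noteq> 0" by (rule not_upper_seg_imp_neq) (rule node_in[OF j])
qed

lemma waveN_neg_ii:
  "waveN x \<psi> N (- (\<i> * of_real s)) = 1 - riemann_sum a b N (\<lambda>t. of_real (R t * exp (- 2 * t * x)) * \<psi> t / of_real (s + t))"
proof -
  have "\<i> * riemann_sum a b N (\<lambda>t. f t / (- (\<i> * of_real s) - \<i> * of_real t)) = - riemann_sum a b N (\<lambda>t. f t / of_real (s + t))" for f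
    unfolding riemann_sum_def sum_distrib_left sum_negf[symmetric]
  proof (intro sum.cong refl)
    fix j
    have "- (\<i> * of_real s) - \<i> * of_real (riemann_node a b N j) = - (\<i> * of_real (s + riemann_node a b N j))" by (simp add: algebra_simps)
    then show "\<i> * (of_real ((b - a) / real N) * (f (riemann_node a b N j) / (- (\<i> * of_real s) - \<i> * of_real (riemann_node a b N j))))
       = - (of_real ((b - a) / real N) * (f (riemann_node a b N j) / of_real (s + riemann_node a b N j)))"
      by (simp add: mult_ac)
  qed
  then show ?thesis unfolding waveN_def by simp
qed

text \<open>Discrete counterpart of the Plemelj cancellation. At a node \<open>q\<close> the
  residues of \<open>waveN\<close> and \<open>cauchy_RN\<close> share the quadrature weight, the
  exponential turns the density \<open>R\<close> into the one at \<open>x\<close>, and the linear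
  system says that \<open>waveN\<close> at \<open>- q\<close> is the node value of
  \<open>\<psi>\<close>; the poles cancel.\<close>

lemma dressed_soliton_extension:
  assumes N: "1 \<le> N"
    and eq: "\<And>s. s \<in> {a..b} \<Longrightarrow> \<psi> s + riemann_sum a b N (\<lambda>t. of_real (R t * exp (- 2 * t * x)) * \<psi> t / of_real (s + t)) = 1"
  shows "\<exists>H. H holomorphic_on {z. 0 < Im z} \<and> (\<forall>z\<in>{z. 0 < Im z} - soliton_poles a b N.
      H z = waveN x \<psi> N z - exp (2 * \<i> * z * of_real x) * cauchy_RN N z * waveN x \<psi> N (- z))"
proof -
  let ?H = "{z::complex. 0 < Im z}" and ?e = "\<lambda>z. exp (2 * \<i> * z * of_real x)"
  let ?s = "riemann_node a b N"
  define E where "E = upper_nodes N"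
  have EH: "E \<subseteq> ?H" unfolding E_def using upper_nodes_subset upper_subset by (rule order.trans)
  have diffE: "?H - E = ?H - soliton_poles a b N"
  proof -
    have "Im (- \<i> * of_real (?s j)) < 0" if "j \<in> {1..N}" for j using node_in[OF that] a_pos by simp
    then have "?H \<inter> (\<lambda>j. - \<i> * of_real (?s j)) ` {1..N} = {}" by force
    then show ?thesis unfolding soliton_poles_eq E_def by blast
  qed
  let ?f = "\<lambda>z. waveN x \<psi> N z - ?e z * cauchy_RN N z * waveN x \<psi> N (- z)"
  have HL: "?H \<subseteq> - lower_seg a b" using lower_subset by auto
  have opH: "open ?H" by (rule open_halfspace_Im_gt)
  have hm: "(\<lambda>z. waveN x \<psi> N (- z)) holomorphic_on ?H" by (rule holomorphic_on_subset[OF holomorphic_waveN_minus HL])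
  have hA: "cauchy_RN N holomorphic_on - E"
    unfolding cauchy_RN_def[abs_def] E_def by (intro holomorphic_intros holomorphic_riemann_cauchy)
  have hW: "waveN x \<psi> N holomorphic_on - E" unfolding E_def by (rule holomorphic_waveN)
  have "\<exists>H. H holomorphic_on ?H \<and> (\<forall>z\<in>?H - E. H z = ?f z)"
  proof (rule holomorphic_extension_finite)
    show "finite E" by (simp add: E_def)
    show "?f holomorphic_on ?H - E"
      by (intro holomorphic_intros holomorphic_on_subset[OF hW] holomorphic_on_subset[OF hA]
          holomorphic_on_subset[OF hm]) auto
    fix q assume "q \<in> E"
    then obtain k where k: "k \<in> {1..N}" "q = \<i> * of_real (?s k)" by (auto simp: E_def)
    let ?w = "of_real ((b - a) / real N) :: complex"
    let ?\<rho> = "\<lambda>t. of_real (R t * exp (- 2 * t * x)) :: complex"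
    note res = riemann_cauchy_residue[OF N k(1), folded k(2)]
    have qH: "q \<in> ?H" using EH \<open>q \<in> E\<close> by blast
    have A: "((\<lambda>z. (z - q) * waveN x \<psi> N z) \<longlongrightarrow> \<i> * (?w * (?\<rho> (?s k) * \<psi> (?s k)))) (at q)"
    proof -
      have "((\<lambda>z. (z - q) * 1 + \<i> * ((z - q) * riemann_sum a b N (\<lambda>t. ?\<rho> t * \<psi> t / (z - \<i> * of_real t))))
          \<longlongrightarrow> (q - q) * 1 + \<i> * (?w * (?\<rho> (?s k) * \<psi> (?s k)))) (at q)"
        by (intro tendsto_add tendsto_mult tendsto_diff tendsto_const tendsto_ident_at res)
      then show ?thesis unfolding waveN_def by (simp add: distrib_left mult_ac)
    qed
    have B: "((\<lambda>z. (z - q) * cauchy_RN N z) \<longlongrightarrow> \<i> * (?w * of_real (R (?s k)))) (at q)"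
    proof -
      have "((\<lambda>z. \<i> * ((z - q) * riemann_sum a b N (\<lambda>t. of_real (R t) / (z - \<i> * of_real t)))) \<longlongrightarrow> \<i> * (?w * of_real (R (?s k)))) (at q)"
        by (intro tendsto_mult tendsto_const res)
      then show ?thesis unfolding cauchy_RN_def by (simp add: mult_ac)
    qed
    \<comment> \<open>This is where the linear system enters: without it the residues would not
      match.\<close>
    have C: "((\<lambda>z. waveN x \<psi> N (- z)) \<longlongrightarrow> \<psi> (?s k)) (at q)"
    proof -
      have "waveN x \<psi> N (- q) = \<psi> (?s k)"
        unfolding k(2) waveN_neg_ii using eq[OF node_in[OF k(1)]] by (simp add: eq_diff_eq[symmetric])
      then show ?thesis using holomorphic_tendsto_within[OF hm opH qH, of UNIV] by simp
    qed
    have e: "(?e \<longlongrightarrow> ?e q) (at q)" by (intro tendsto_intros)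
    have "2 * \<i> * q * of_real x = (of_real (- 2 * ?s k * x) :: complex)" by (simp add: k(2) mult_ac)
    then have eq_q: "?e q = of_real (exp (- 2 * ?s k * x))" by (simp only: exp_of_real)
    have "((\<lambda>z. (z - q) * waveN x \<psi> N z - ?e z * ((z - q) * cauchy_RN N z) * waveN x \<psi> N (- z))
       \<longlongrightarrow> \<i> * (?w * (?\<rho> (?s k) * \<psi> (?s k))) - ?e q * (\<i> * (?w * of_real (R (?s k)))) * \<psi> (?s k)) (at q)"
      by (intro tendsto_diff tendsto_mult A B C e)
    moreover have zero: "\<i> * (?w * (?\<rho> (?s k) * \<psi> (?s k))) - ?e q * (\<i> * (?w * of_real (R (?s k)))) * \<psi> (?s k) = 0"
      unfolding eq_q by (simp add: mult_ac)
    ultimately have "((\<lambda>z. (z - q) * waveN x \<psi> N z - ?e z * ((z - q) * cauchy_RN N z) * waveN x \<psi> N (- z)) \<longlongrightarrow> 0) (at q)"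
      by (simp only: zero)
    then show "((\<lambda>z. (z - q) * ?f z) \<longlongrightarrow> 0) (at q)"
      by (simp add: right_diff_distrib mult_ac)
  qed (use EH opH in auto)
  then show ?thesis unfolding diffE .
qed

end

context soliton_contours
begin

text \<open>On each of the three regions the definition agrees, off finitely many poles, with a
  vector of holomorphic functions. Since \<open>remove_sings\<close> takes limits, it agrees with
  them everywhere in the region, including points that are poles of \<open>M\<close>.\<close>

lemma soliton_Z_values:
  fixes M :: "complex \<Rightarrow> complex^2"
  assumes N: "1 \<le> N"
    and M: "\<And>z. z \<notin> soliton_poles a b N \<Longrightarrow> M z $ 1 = waveN x \<psi> N z \<and> M z $ 2 = waveN x \<psi> N (- z)"
    and H: "H holomorphic_on {z. 0 < Im z}"
      "\<And>z. z \<in> {z. 0 < Im z} - soliton_poles a b N \<Longrightarrow>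
         H z = waveN x \<psi> N z - exp (2 * \<i> * z * of_real x) * cauchy_RN N z * waveN x \<psi> N (- z)"
  shows "z \<in> outside Pp \<inter> outside Pm \<Longrightarrow> soliton_Z a b r1 \<gamma>p \<gamma>m N x M z = vector [waveN x \<psi> N z, waveN x \<psi> N (- z)]"
    "z \<in> inside Pp \<Longrightarrow> soliton_Z a b r1 \<gamma>p \<gamma>m N x M z = vector [H z, waveN x \<psi> N (- z)]"
    "z \<in> inside Pm \<Longrightarrow> soliton_Z a b r1 \<gamma>p \<gamma>m N x M z = vector [waveN x \<psi> N z, H (- z)]"
proof -
  let ?P = "soliton_poles a b N" and ?e = "\<lambda>z. exp (2 * \<i> * z * of_real x)"
  let ?p = "soliton_pole a b N" and ?c = "norming_const a b r1 N"
  define W where "W z = (if z \<in> inside Pp then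
       M z v* mat22 1 0 (- (1 / of_nat N * (\<Sum>j=1..N. ?c j * exp (2 * \<i> * z * of_real x) / (z - ?p j)))) 1
     else if z \<in> inside Pm then
       M z v* mat22 1 (1 / of_nat N * (\<Sum>j=1..N. ?c j * exp (- 2 * \<i> * z * of_real x) / (z - cnj (?p j)))) 0 1
     else M z)" for z
  have Z: "soliton_Z a b r1 \<gamma>p \<gamma>m N x M = (\<lambda>z. \<chi> i. remove_sings (\<lambda>w. W w $ i) z)"
    unfolding soliton_Z_def Let_def W_def ..
  have vals: "soliton_Z a b r1 \<gamma>p \<gamma>m N x M z = vector [f z, g z]"
    if S: "open S" "z \<in> S" and f: "f holomorphic_on S" and g: "g holomorphic_on S"
      and Wf: "\<And>w. w \<in> S - ?P \<Longrightarrow> W w $ 1 = f w \<and> W w $ 2 = g w" for S f g z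
  proof -
    have "open (S - (?P - {z}))" by (intro open_Diff S(1) finite_imp_closed finite_Diff finite_soliton_poles)
    then have ev: "eventually (\<lambda>w. w \<in> S - ?P) (at z)"
      unfolding eventually_at_topological using S(2) by (intro exI[of _ "S - (?P - {z})"]) auto
    have "((\<lambda>w. W w $ 1) \<longlongrightarrow> f z) (at z)"
      by (rule Lim_transform_eventually[OF holomorphic_tendsto_within[OF f S]]) (rule eventually_mono[OF ev], simp add: Wf)
    moreover have "((\<lambda>w. W w $ 2) \<longlongrightarrow> g z) (at z)"
      by (rule Lim_transform_eventually[OF holomorphic_tendsto_within[OF g S]]) (rule eventually_mono[OF ev], simp add: Wf)
    ultimately show ?thesis unfolding Z vec_eq_iff forall_2 by (simp add: remove_sings_eqI)
  qed
  have c: "?c j = of_nat N * (\<i> * (of_real ((b - a) / real N) * of_real (R (riemann_node a b N j))))" if "j \<in> {1..N}" for j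
    using r1_upper[OF node_in[OF that]] N by (simp add: norming_const_def soliton_pole_node)
  have up: "1 / of_nat N * (\<Sum>j=1..N. ?c j * exp (2 * \<i> * z * of_real x) / (z - ?p j)) = ?e z * cauchy_RN N z" for z
    unfolding cauchy_RN_def riemann_sum_def sum_distrib_left
    by (intro sum.cong refl) (use N in \<open>simp add: c soliton_pole_node\<close>)
  \<comment> \<open>The lower poles are the negatives of the upper ones, so this sum is the upper
    one at \<open>- z\<close>, with the sign of the denominators reversed.\<close>
  have low: "1 / of_nat N * (\<Sum>j=1..N. ?c j * exp (- 2 * \<i> * z * of_real x) / (z - cnj (?p j))) = - (?e (- z) * cauchy_RN N (- z))" for z
    unfolding cauchy_RN_def riemann_sum_def sum_distrib_left sum_negf[symmetric]
  proof (intro sum.cong refl)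
    fix j assume j: "j \<in> {1..N}"
    define Y where "Y = z - cnj (?p j)"
    have "- z - \<i> * of_real (riemann_node a b N j) = - Y" by (simp add: Y_def soliton_pole_node)
    then show "1 / of_nat N * (?c j * exp (- 2 * \<i> * z * of_real x) / (z - cnj (?p j)))
      = - (?e (- z) * (\<i> * (of_real ((b - a) / real N) * (of_real (R (riemann_node a b N j)) / (- z - \<i> * of_real (riemann_node a b N j))))))"
      unfolding Y_def[symmetric] c[OF j] using N by (simp add: mult_ac)
  qed
  show "soliton_Z a b r1 \<gamma>p \<gamma>m N x M z = vector [waveN x \<psi> N z, waveN x \<psi> N (- z)]" if z: "z \<in> outside Pp \<inter> outside Pm" for z
  proof (rule vals[where S = "outside Pp \<inter> outside Pm", OF _ z])
    show "open (outside Pp \<inter> outside Pm)" by (intro open_Int open_regions)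
    have "outside Pp \<inter> outside Pm \<subseteq> - upper_seg a b" using outside_cases by blast
    then have "outside Pp \<inter> outside Pm \<subseteq> - upper_nodes N" using upper_nodes_subset[of N] by blast
    then show "waveN x \<psi> N holomorphic_on outside Pp \<inter> outside Pm" by (rule holomorphic_on_subset[OF holomorphic_waveN])
    have "outside Pp \<inter> outside Pm \<subseteq> - lower_seg a b" using outside_cases by blast
    then show "(\<lambda>z. waveN x \<psi> N (- z)) holomorphic_on outside Pp \<inter> outside Pm"
      by (rule holomorphic_on_subset[OF holomorphic_waveN_minus])
    fix w assume "w \<in> (outside Pp \<inter> outside Pm) - ?P"
    then show "W w $ 1 = waveN x \<psi> N w \<and> W w $ 2 = waveN x \<psi> N (- w)"
      using outside_cases[of w] M[of w] by (simp add: W_def)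
  qed
  show "soliton_Z a b r1 \<gamma>p \<gamma>m N x M z = vector [H z, waveN x \<psi> N (- z)]" if z: "z \<in> inside Pp" for z
  proof (rule vals[OF open_regions(1) z])
    show "H holomorphic_on inside Pp" by (rule holomorphic_on_subset[OF H(1) inside_p_subset])
    show "(\<lambda>z. waveN x \<psi> N (- z)) holomorphic_on inside Pp"
      by (rule holomorphic_on_subset[OF holomorphic_waveN_minus]) (use inside_p_cases in blast)
    fix w assume w: "w \<in> inside Pp - ?P"
    then have "w \<in> {z. 0 < Im z} - ?P" using inside_p_subset by blast
    from H(2)[OF this] show "W w $ 1 = H w \<and> W w $ 2 = waveN x \<psi> N (- w)"
      using w M[of w] unfolding W_def up by (simp add: mult.commute)
  qed
  show "soliton_Z a b r1 \<gamma>p \<gamma>m N x M z = vector [waveN x \<psi> N z, H (- z)]" if z: "z \<in> inside Pm" for z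
  proof (rule vals[where g = "\<lambda>z. H (- z)", OF open_regions(3) z])
    show "waveN x \<psi> N holomorphic_on inside Pm"
      by (rule holomorphic_on_subset[OF holomorphic_waveN]) (use inside_m_cases upper_nodes_subset in blast)
    have "uminus ` inside Pm \<subseteq> {z. 0 < Im z}" using inside_m_subset by auto
    moreover have "uminus holomorphic_on inside Pm" by (rule holomorphic_on_minus[OF holomorphic_on_ident])
    ultimately show "(\<lambda>z. H (- z)) holomorphic_on inside Pm"
      using holomorphic_on_compose_gen[OF _ H(1)] by (simp add: o_def)
    fix w assume w: "w \<in> inside Pm - ?P"
    then have "- w \<in> {z. 0 < Im z} - ?P" using inside_m_subset uminus_soliton_poles[of w] by auto
    from H(2)[OF this] show "W w $ 1 = waveN x \<psi> N w \<and> W w $ 2 = H (- w)"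
      using w M[of w] inside_m_cases[of w] unfolding W_def low by (simp add: mult.commute)
  qed
qed

end

section \<open>First moments at infinity, convergence of Z and of the potentials\<close>

lemma tendsto_riemann_moment_at_infinity:
  "((\<lambda>z. z * riemann_sum a b N (\<lambda>t. f t / (z - \<i> * of_real t))) \<longlongrightarrow> riemann_sum a b N f) at_infinity"
proof -
  have lim: "((\<lambda>z. z * (c * (d / (z - q)))) \<longlongrightarrow> c * d) at_infinity" for c d q :: complex
  proof -
    have "filterlim (\<lambda>z::complex. - q + z) at_infinity at_infinity"
      by (rule tendsto_add_filterlim_at_infinity[OF tendsto_const filterlim_ident])
    then have "((\<lambda>z. q / (- q + z)) \<longlongrightarrow> 0) at_infinity" by (rule tendsto_divide_0[OF tendsto_const])
    then have "((\<lambda>z. c * d * (1 + q / (- q + z))) \<longlongrightarrow> c * d * (1 + 0)) at_infinity"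
      by (intro tendsto_mult tendsto_add tendsto_const)
    then have "((\<lambda>z. c * d * (1 + q / (- q + z))) \<longlongrightarrow> c * d) at_infinity" by simp
    then show ?thesis
    proof (rule Lim_transform_eventually)
      show "eventually (\<lambda>z. c * d * (1 + q / (- q + z)) = z * (c * (d / (z - q)))) at_infinity"
        unfolding eventually_at_infinity
      proof (intro exI[of _ "norm q + 1"] allI impI)
        fix z :: complex assume "norm q + 1 \<le> norm z"
        then have "z - q \<noteq> 0" by auto
        then have "1 + q / (z - q) = z / (z - q)" by (simp add: field_simps)
        then show "c * d * (1 + q / (- q + z)) = z * (c * (d / (z - q)))" by (simp add: mult_ac)
      qed
    qed
  qed
  show ?thesis unfolding riemann_sum_def sum_distrib_left by (intro tendsto_sum lim)
qed

lemma Lim_first_moment: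
  fixes F :: "complex \<Rightarrow> complex^2"
  assumes "eventually (\<lambda>z. F z $ 1 = 1 + \<i> * G z) at_infinity" "((\<lambda>z. z * G z) \<longlongrightarrow> m) at_infinity"
  shows "Lim at_infinity (\<lambda>z. z / \<i> * (F z $ 1 - 1)) = m"
proof (rule tendsto_Lim)
  show "((\<lambda>z. z / \<i> * (F z $ 1 - 1)) \<longlongrightarrow> m) at_infinity"
    by (rule Lim_transform_eventually[OF assms(2)]) (rule eventually_mono[OF assms(1)], simp add: field_simps)
qed (simp add: trivial_limit_at_infinity)

context soliton_contours
begin

text \<open>Only the limiting problem is assumed of \<open>Z\<close>, so the conclusion holds for
  every symmetric solution; this generality is what later yields uniqueness.\<close>

lemma soliton_Z_convergence:
  fixes M :: "nat \<Rightarrow> complex \<Rightarrow> complex^2"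
  assumes M: "\<And>N. 1 \<le> N \<Longrightarrow> soliton_rhp a b r1 N x (M N)"
    and Z: "symmetric_limit_rhp a b r1 \<gamma>p \<gamma>m x Z" and z: "z \<in> - (Pp \<union> Pm)"
  shows "(\<lambda>N. soliton_Z a b r1 \<gamma>p \<gamma>m N x (M N) z) \<longlonglongrightarrow> Z z"
proof -
  let ?U = "upper_seg a b" and ?L = "lower_seg a b" and ?e = "\<lambda>z. exp (2 * \<i> * z * of_real x)"
  let ?\<rho> = "\<lambda>t. of_real (R t * exp (- 2 * t * x)) :: complex"
  obtain \<phi> where \<phi>: "continuous_on {a..b} \<phi>"
    and eq: "\<forall>s\<in>{a..b}. \<phi> s + integral {a..b} (\<lambda>t. ?\<rho> t * \<phi> t / of_real (s + t)) = 1"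
    and out: "\<forall>z\<in>outside Pp \<inter> outside Pm. Z z $ 1 = wave x \<phi> z \<and> Z z $ 2 = wave x \<phi> (- z)"
    and p2: "\<forall>z\<in>inside Pp. Z z $ 2 = wave x \<phi> (- z)" and m1: "\<forall>z\<in>inside Pm. Z z $ 1 = wave x \<phi> z"
    and p1: "\<forall>z\<in>inside Pp - ?U. Z z $ 1 = wave x \<phi> z - ?e z * cauchy_R z * wave x \<phi> (- z)"
    and m2: "\<forall>z\<in>inside Pm - ?L. Z z $ 2 = wave x \<phi> (- z) - ?e (- z) * cauchy_R (- z) * wave x \<phi> z"
    using limit_problem_representation[OF Z] by (elim exE conjE)
  have "\<forall>N\<in>{1..}. \<exists>\<psi>. (\<forall>s\<in>{a..b}. \<psi> s + riemann_sum a b N (\<lambda>t. ?\<rho> t * \<psi> t / of_real (s + t)) = 1)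
     \<and> (\<forall>z. z \<notin> soliton_poles a b N \<longrightarrow> M N z $ 1 = waveN x \<psi> N z \<and> M N z $ 2 = waveN x \<psi> N (- z))"
  proof
    fix N :: nat assume "N \<in> {1..}"
    then have N: "1 \<le> N" by simp
    show "\<exists>\<psi>. (\<forall>s\<in>{a..b}. \<psi> s + riemann_sum a b N (\<lambda>t. ?\<rho> t * \<psi> t / of_real (s + t)) = 1)
     \<and> (\<forall>z. z \<notin> soliton_poles a b N \<longrightarrow> M N z $ 1 = waveN x \<psi> N z \<and> M N z $ 2 = waveN x \<psi> N (- z))"
      using soliton_representation[OF a_pos ab N M[OF N] r1_upper] unfolding waveN_def .
  qed
  from bchoice[OF this] obtain \<psi> where all: "\<forall>N\<in>{1..}. (\<forall>s\<in>{a..b}. \<psi> N s + riemann_sum a b N (\<lambda>t. ?\<rho> t * \<psi> N t / of_real (s + t)) = 1)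
     \<and> (\<forall>z. z \<notin> soliton_poles a b N \<longrightarrow> M N z $ 1 = waveN x (\<psi> N) N z \<and> M N z $ 2 = waveN x (\<psi> N) N (- z))"
    by (elim exE)
  have \<psi>: "\<psi> N s + riemann_sum a b N (\<lambda>t. ?\<rho> t * \<psi> N t / of_real (s + t)) = 1" if "1 \<le> N" "s \<in> {a..b}" for N s
    using all that by simp
  have MN: "M N z $ 1 = waveN x (\<psi> N) N z \<and> M N z $ 2 = waveN x (\<psi> N) N (- z)"
    if "1 \<le> N" "z \<notin> soliton_poles a b N" for N z
    using all that by simp
  have "\<forall>N\<in>{1..}. \<exists>H. H holomorphic_on {z. 0 < Im z} \<and> (\<forall>z\<in>{z. 0 < Im z} - soliton_poles a b N.
      H z = waveN x (\<psi> N) N z - ?e z * cauchy_RN N z * waveN x (\<psi> N) N (- z))"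
    by (intro ballI dressed_soliton_extension \<psi>) auto
  from bchoice[OF this] obtain H where all_H: "\<forall>N\<in>{1..}. H N holomorphic_on {z. 0 < Im z} \<and> (\<forall>z\<in>{z. 0 < Im z} - soliton_poles a b N.
      H N z = waveN x (\<psi> N) N z - ?e z * cauchy_RN N z * waveN x (\<psi> N) N (- z))"
    by (elim exE)
  have H: "H N holomorphic_on {z. 0 < Im z}"
    "\<And>z. z \<in> {z. 0 < Im z} - soliton_poles a b N \<Longrightarrow>
      H N z = waveN x (\<psi> N) N z - ?e z * cauchy_RN N z * waveN x (\<psi> N) N (- z)" if "1 \<le> N" for N
    using bspec[OF all_H, of N] that by simp_all
  have lim: "uniform_limit {a..b} \<psi> \<phi> sequentially"
  proof (rule nystrom_uniform_limit[OF a_pos ab_le, where \<rho> = "\<lambda>t. R t * exp (- 2 * t * x)"])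
    show "continuous_on {a..b} (\<lambda>t. R t * exp (- 2 * t * x))" by (intro continuous_intros continuous_R)
  qed (use R_nonneg \<phi> eq \<psi> in auto)
  have wlim: "(\<lambda>N. waveN x (\<psi> N) N z) \<longlonglongrightarrow> wave x \<phi> z" if "z \<notin> ?U" for z
    using uniform_limit_waveN[of "{z}" "\<lambda>z. z", OF _ _ _ \<phi> lim, of x] that by (simp add: uniform_limit_singleton)
  have HU: "{z. 0 < Im z} - ?U \<subseteq> {z. 0 < Im z} - soliton_poles a b N" for N
    using soliton_poles_subset[OF ab_le, of N] lower_subset by auto
  have Zhol: "(\<lambda>z. Z z $ i) holomorphic_on - (Pp \<union> Pm)" for i
    using Z unfolding symmetric_limit_rhp_def limit_rhp_def row_holomorphic_on_def by blast
  have vals: "z \<in> outside Pp \<inter> outside Pm \<Longrightarrow> soliton_Z a b r1 \<gamma>p \<gamma>m N x (M N) z = vector [waveN x (\<psi> N) N z, waveN x (\<psi> N) N (- z)]"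
    "z \<in> inside Pp \<Longrightarrow> soliton_Z a b r1 \<gamma>p \<gamma>m N x (M N) z = vector [H N z, waveN x (\<psi> N) N (- z)]"
    "z \<in> inside Pm \<Longrightarrow> soliton_Z a b r1 \<gamma>p \<gamma>m N x (M N) z = vector [waveN x (\<psi> N) N z, H N (- z)]" if N: "1 \<le> N" for N
    by (rule soliton_Z_values[OF N MN[OF N] H(1)[OF N] H(2)[OF N]], assumption+)+
  have ev: "eventually (\<lambda>N::nat. 1 \<le> N) sequentially" by (rule eventually_ge_at_top)
  consider "z \<in> inside Pp" | "z \<in> inside Pm" | "z \<in> outside Pp \<inter> outside Pm"
    using z unfolding regions_cover by blast
  then show ?thesis
  proof cases
    case 1
    have "(\<lambda>N. H N z) \<longlonglongrightarrow> Z z $ 1"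
    proof (rule dressed_convergence[where HN = H and H = "\<lambda>z. Z z $ 1" and x = x, OF open_regions(1) gp(5) inside_p_subset \<phi> lim])
      show "H N holomorphic_on inside Pp" if "1 \<le> N" for N
        by (rule holomorphic_on_subset[OF H(1)[OF that] inside_p_subset])
      show "H N z = waveN x (\<psi> N) N z - ?e z * cauchy_RN N z * waveN x (\<psi> N) N (- z)"
        if "1 \<le> N" "z \<in> inside Pp - ?U" for N z
        by (rule H(2)[OF that(1)]) (use that(2) inside_p_subset HU[of N] in blast)
      show "(\<lambda>z. Z z $ 1) holomorphic_on inside Pp"
        by (rule holomorphic_on_subset[OF Zhol]) (use regions_cover in blast)
      show "Z z $ 1 = wave x \<phi> z - ?e z * cauchy_R z * wave x \<phi> (- z)" if "z \<in> inside Pp - ?U" for z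
        using p1 that by (rule bspec)
    qed (rule 1)
    moreover have "(\<lambda>N. waveN x (\<psi> N) N (- z)) \<longlonglongrightarrow> Z z $ 2"
    proof -
      have "- z \<notin> ?U" using inside_p_cases[OF 1] lower_seg_iff[OF ab_le, of z] by simp
      then show ?thesis using wlim[of "- z"] p2 1 by simp
    qed
    ultimately have "(\<lambda>N. vector [H N z, waveN x (\<psi> N) N (- z)] :: complex^2) \<longlonglongrightarrow> vector [Z z $ 1, Z z $ 2]"
      by (rule tendsto_vector_2)
    moreover have "vector [Z z $ 1, Z z $ 2] = Z z" unfolding vec_eq_iff forall_2 by simp
    ultimately have L: "(\<lambda>N. vector [H N z, waveN x (\<psi> N) N (- z)] :: complex^2) \<longlonglongrightarrow> Z z" by simp
    show ?thesis
      by (rule Lim_transform_eventually[OF L]) (rule eventually_mono[OF ev], simp add: vals(2) 1)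
  next
    case 2
    \<comment> \<open>The reflection \<open>w \<mapsto> - w\<close> turns the inside of the lower
      curve into a neighbourhood of the upper segment, where the convergence of the dressed
      functions is available.\<close>
    define f where "f w = Z (- w) $ 2" for w
    have neg: "uminus ` inside Pm = {w. - w \<in> inside Pm}" by (force simp: image_iff)
    have "(\<lambda>N. H N (- z)) \<longlonglongrightarrow> f (- z)"
    proof (rule dressed_convergence[where HN = H and H = f and x = x, OF _ _ _ \<phi> lim])
      show "open (uminus ` inside Pm)" by (rule open_negations[OF open_regions(3)])
      show U: "?U \<subseteq> uminus ` inside Pm"
        unfolding neg using gm(5) lower_seg_iff[OF ab_le] by (auto simp: subset_iff)
      show sub: "uminus ` inside Pm \<subseteq> {z. 0 < Im z}" using inside_m_subset by auto
      show "H N holomorphic_on uminus ` inside Pm" if "1 \<le> N" for N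
        by (rule holomorphic_on_subset[OF H(1)[OF that] sub])
      show "H N z = waveN x (\<psi> N) N z - ?e z * cauchy_RN N z * waveN x (\<psi> N) N (- z)"
        if "1 \<le> N" "z \<in> uminus ` inside Pm - ?U" for N z
        by (rule H(2)[OF that(1)]) (use that(2) sub HU[of N] in blast)
      have "(\<lambda>z. Z z $ 2) holomorphic_on inside Pm"
        by (rule holomorphic_on_subset[OF Zhol]) (use regions_cover in blast)
      moreover have "uminus holomorphic_on uminus ` inside Pm" by (rule holomorphic_on_minus[OF holomorphic_on_ident])
      ultimately show "f holomorphic_on uminus ` inside Pm"
        unfolding f_def using holomorphic_on_compose_gen[of uminus "uminus ` inside Pm" "\<lambda>z. Z z $ 2" "inside Pm"]
        by (simp add: o_def image_image)
      show "f w = wave x \<phi> w - ?e w * cauchy_R w * wave x \<phi> (- w)" if "w \<in> uminus ` inside Pm - ?U" for w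
      proof -
        have "- w \<in> inside Pm - ?L" using that lower_seg_iff[OF ab_le, of "- w"] by auto
        from bspec[OF m2 this] show ?thesis by (simp add: f_def)
      qed
      show "- z \<in> uminus ` inside Pm" using 2 by blast
    qed
    then have "(\<lambda>N. H N (- z)) \<longlonglongrightarrow> Z z $ 2" by (simp add: f_def)
    moreover have "(\<lambda>N. waveN x (\<psi> N) N z) \<longlonglongrightarrow> Z z $ 1"
      using wlim[of z] m1 2 inside_m_cases[OF 2] by simp
    ultimately have "(\<lambda>N. vector [waveN x (\<psi> N) N z, H N (- z)] :: complex^2) \<longlonglongrightarrow> vector [Z z $ 1, Z z $ 2]"
      by (intro tendsto_vector_2)
    moreover have "vector [Z z $ 1, Z z $ 2] = Z z" unfolding vec_eq_iff forall_2 by simp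
    ultimately have L: "(\<lambda>N. vector [waveN x (\<psi> N) N z, H N (- z)] :: complex^2) \<longlonglongrightarrow> Z z" by simp
    show ?thesis
      by (rule Lim_transform_eventually[OF L]) (rule eventually_mono[OF ev], simp add: vals(3) 2)
  next
    case 3
    have "z \<notin> ?U" "- z \<notin> ?U" using outside_cases[OF 3] lower_seg_iff[OF ab_le, of z] by auto
    then have "(\<lambda>N. vector [waveN x (\<psi> N) N z, waveN x (\<psi> N) N (- z)] :: complex^2) \<longlonglongrightarrow> vector [wave x \<phi> z, wave x \<phi> (- z)]"
      by (intro tendsto_vector_2 wlim)
    moreover have "vector [wave x \<phi> z, wave x \<phi> (- z)] = Z z" using bspec[OF out 3] unfolding vec_eq_iff forall_2 by simp
    ultimately have L: "(\<lambda>N. vector [waveN x (\<psi> N) N z, waveN x (\<psi> N) N (- z)] :: complex^2) \<longlonglongrightarrow> Z z" by simp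
    have "vector [waveN x (\<psi> N) N z, waveN x (\<psi> N) N (- z)] = soliton_Z a b r1 \<gamma>p \<gamma>m N x (M N) z" if "1 \<le> N" for N
      by (rule vals(1)[OF that 3, symmetric])
    then show ?thesis
      by (intro Lim_transform_eventually[OF L]) (rule eventually_mono[OF ev])
  qed
qed

text \<open>The potentials are derivatives in the position, so the functions \<open>\<phi> x\<close>
  and \<open>\<psi> N x\<close> are chosen for all positions at once and the derivative is taken of
  the resulting masses.\<close>

lemma potential_convergence:
  fixes M :: "nat \<Rightarrow> real \<Rightarrow> complex \<Rightarrow> complex^2" and X :: "real \<Rightarrow> complex \<Rightarrow> complex^2"
  assumes M: "\<And>N x. 1 \<le> N \<Longrightarrow> soliton_rhp a b r1 N x (M N x)"
    and X: "\<And>x. soliton_gas_rhp a b r1 x (X x)"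
  shows "(\<lambda>N. potential (M N) x) \<longlonglongrightarrow> potential X x"
proof -
  let ?\<rho> = "\<lambda>x t. of_real (R t * exp (- 2 * t * x)) :: complex"
  have "\<forall>x. \<exists>\<phi>. continuous_on {a..b} \<phi> \<and> (\<forall>s\<in>{a..b}. \<phi> s + integral {a..b} (\<lambda>t. ?\<rho> x t * \<phi> t / of_real (s + t)) = 1)
     \<and> (\<forall>z\<in>outside Pp \<inter> outside Pm. X x z $ 1 = wave x \<phi> z)"
  proof
    fix x
    \<comment> \<open>The representation is proved for the limiting problem; the dressed
      \<open>Z\<close> agrees with \<open>X\<close> outside the curves, hence near infinity, where
      the mass is read off.\<close>
    obtain Z where Z: "symmetric_limit_rhp a b r1 \<gamma>p \<gamma>m x Z" "\<forall>z\<in>outside Pp \<inter> outside Pm. Z z = X x z"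
      using gas_solution_of_limit_problem[OF X[of x]] by (elim exE conjE)
    obtain \<phi> where "continuous_on {a..b} \<phi>"
      "\<forall>s\<in>{a..b}. \<phi> s + integral {a..b} (\<lambda>t. ?\<rho> x t * \<phi> t / of_real (s + t)) = 1"
      "\<forall>z\<in>outside Pp \<inter> outside Pm. Z z $ 1 = wave x \<phi> z \<and> Z z $ 2 = wave x \<phi> (- z)"
      using limit_problem_representation[OF Z(1)] by (elim exE conjE)
    with Z(2) show "\<exists>\<phi>. continuous_on {a..b} \<phi> \<and> (\<forall>s\<in>{a..b}. \<phi> s + integral {a..b} (\<lambda>t. ?\<rho> x t * \<phi> t / of_real (s + t)) = 1)
     \<and> (\<forall>z\<in>outside Pp \<inter> outside Pm. X x z $ 1 = wave x \<phi> z)" by (intro exI[of _ \<phi>]) simp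
  qed
  from choice[OF this] obtain \<phi> where all_\<phi>: "\<forall>x. continuous_on {a..b} (\<phi> x) \<and> (\<forall>s\<in>{a..b}. \<phi> x s + integral {a..b} (\<lambda>t. ?\<rho> x t * \<phi> x t / of_real (s + t)) = 1)
     \<and> (\<forall>z\<in>outside Pp \<inter> outside Pm. X x z $ 1 = wave x (\<phi> x) z)"
    by (elim exE)
  have \<phi>: "continuous_on {a..b} (\<phi> x)"
    "\<And>s. s \<in> {a..b} \<Longrightarrow> \<phi> x s + integral {a..b} (\<lambda>t. ?\<rho> x t * \<phi> x t / of_real (s + t)) = 1"
    "\<And>z. z \<in> outside Pp \<inter> outside Pm \<Longrightarrow> X x z $ 1 = wave x (\<phi> x) z" for x
    using spec[OF all_\<phi>, of x] by simp_all
  have "\<forall>N x. \<exists>\<psi>. 1 \<le> N \<longrightarrow> (\<forall>s\<in>{a..b}. \<psi> s + riemann_sum a b N (\<lambda>t. ?\<rho> x t * \<psi> t / of_real (s + t)) = 1)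
     \<and> (\<forall>z. z \<notin> soliton_poles a b N \<longrightarrow> M N x z $ 1 = waveN x \<psi> N z \<and> M N x z $ 2 = waveN x \<psi> N (- z))"
  proof (intro allI)
    fix N :: nat and x
    show "\<exists>\<psi>. 1 \<le> N \<longrightarrow> (\<forall>s\<in>{a..b}. \<psi> s + riemann_sum a b N (\<lambda>t. ?\<rho> x t * \<psi> t / of_real (s + t)) = 1)
     \<and> (\<forall>z. z \<notin> soliton_poles a b N \<longrightarrow> M N x z $ 1 = waveN x \<psi> N z \<and> M N x z $ 2 = waveN x \<psi> N (- z))"
    proof (cases "1 \<le> N")
      case True
      have "\<exists>\<psi>. (\<forall>s\<in>{a..b}. \<psi> s + riemann_sum a b N (\<lambda>t. ?\<rho> x t * \<psi> t / of_real (s + t)) = 1)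
     \<and> (\<forall>z. z \<notin> soliton_poles a b N \<longrightarrow> M N x z $ 1 = waveN x \<psi> N z \<and> M N x z $ 2 = waveN x \<psi> N (- z))"
        using soliton_representation[OF a_pos ab True M[OF True, of x] r1_upper] unfolding waveN_def .
      then show ?thesis by (simp only: True simp_thms)
    qed simp
  qed
  then have "\<exists>\<psi>. \<forall>N x. 1 \<le> N \<longrightarrow> (\<forall>s\<in>{a..b}. \<psi> N x s + riemann_sum a b N (\<lambda>t. ?\<rho> x t * \<psi> N x t / of_real (s + t)) = 1)
     \<and> (\<forall>z. z \<notin> soliton_poles a b N \<longrightarrow> M N x z $ 1 = waveN x (\<psi> N x) N z \<and> M N x z $ 2 = waveN x (\<psi> N x) N (- z))"
    by (simp only: choice_iff)
  then obtain \<psi> where all_\<psi>: "\<forall>N x. 1 \<le> N \<longrightarrow> (\<forall>s\<in>{a..b}. \<psi> N x s + riemann_sum a b N (\<lambda>t. ?\<rho> x t * \<psi> N x t / of_real (s + t)) = 1)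
     \<and> (\<forall>z. z \<notin> soliton_poles a b N \<longrightarrow> M N x z $ 1 = waveN x (\<psi> N x) N z \<and> M N x z $ 2 = waveN x (\<psi> N x) N (- z))"
    by (elim exE)
  have \<psi>: "\<psi> N x s + riemann_sum a b N (\<lambda>t. ?\<rho> x t * \<psi> N x t / of_real (s + t)) = 1" if "1 \<le> N" "s \<in> {a..b}" for N x s
    using all_\<psi> that by simp
  have MN: "M N x z $ 1 = waveN x (\<psi> N x) N z" if "1 \<le> N" "z \<notin> soliton_poles a b N" for N x z
    using all_\<psi> that by simp
  have "\<exists>D d. (\<forall>N\<ge>1. ((\<lambda>y. riemann_sum a b N (\<lambda>t. ?\<rho> y t * \<psi> N y t)) has_vector_derivative D N) (at x))
     \<and> ((\<lambda>y. integral {a..b} (\<lambda>t. ?\<rho> y t * \<phi> y t)) has_vector_derivative d) (at x) \<and> D \<longlonglongrightarrow> d"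
    by (rule nystrom_mass_derivative[OF a_pos ab_le continuous_R R_nonneg \<psi> \<phi>(1,2)])
  then obtain D d where D: "\<forall>N\<ge>1. ((\<lambda>y. riemann_sum a b N (\<lambda>t. ?\<rho> y t * \<psi> N y t)) has_vector_derivative D N) (at x)"
    and d: "((\<lambda>y. integral {a..b} (\<lambda>t. ?\<rho> y t * \<phi> y t)) has_vector_derivative d) (at x)" and Dd: "D \<longlonglongrightarrow> d"
    by (elim exE conjE)
  have far: "\<exists>B. \<forall>z. B \<le> norm z \<longrightarrow> z \<notin> T" if "bounded T" for T :: "complex set"
  proof -
    obtain B where "\<forall>z\<in>T. norm z \<le> B" using \<open>bounded T\<close> unfolding bounded_iff by blast
    then show ?thesis by (intro exI[of _ "B + 1"]) force
  qed
  have "Lim at_infinity (\<lambda>z. z / \<i> * (X y z $ 1 - 1)) = integral {a..b} (\<lambda>t. ?\<rho> y t * \<phi> y t)" for y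
  proof (rule Lim_first_moment)
    show "((\<lambda>z. z * integral {a..b} (\<lambda>t. ?\<rho> y t * \<phi> y t / (z - \<i> * of_real t))) \<longlongrightarrow> integral {a..b} (\<lambda>t. ?\<rho> y t * \<phi> y t)) at_infinity"
      by (rule tendsto_cauchy_integral_moment_at_infinity[OF continuous_on_mult[OF continuous_density \<phi>(1)]]) (use a_pos ab in auto)
    obtain B where B: "\<forall>z. B \<le> norm z \<longrightarrow> z \<notin> - outside Pp \<union> - outside Pm" using far[OF bounded_not_outside] by blast
    show "eventually (\<lambda>z. X y z $ 1 = 1 + \<i> * integral {a..b} (\<lambda>t. ?\<rho> y t * \<phi> y t / (z - \<i> * of_real t))) at_infinity"
      unfolding eventually_at_infinity wave_def[symmetric] using B \<phi>(3) by (intro exI[of _ B]) blast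
  qed
  then have "potential X x = 2 * d"
    unfolding potential_def using d by (simp add: vector_derivative_at)
  moreover have "potential (M N) x = 2 * D N" if N: "1 \<le> N" for N
  proof -
    have "Lim at_infinity (\<lambda>z. z / \<i> * (M N y z $ 1 - 1)) = riemann_sum a b N (\<lambda>t. ?\<rho> y t * \<psi> N y t)" for y
    proof (rule Lim_first_moment[OF _ tendsto_riemann_moment_at_infinity])
      obtain B where B: "\<forall>z. B \<le> norm z \<longrightarrow> z \<notin> soliton_poles a b N"
        using far[OF finite_imp_bounded[OF finite_soliton_poles]] by blast
      show "eventually (\<lambda>z. M N y z $ 1 = 1 + \<i> * riemann_sum a b N (\<lambda>t. ?\<rho> y t * \<psi> N y t / (z - \<i> * of_real t))) at_infinity"
        unfolding eventually_at_infinity waveN_def[symmetric] using B MN[OF N] by (intro exI[of _ B]) blast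
    qed
    then show ?thesis unfolding potential_def using D N by (simp add: vector_derivative_at)
  qed
  \<comment> \<open>The soliton problem is assumed only for \<open>N \<ge> 1\<close>, so the
    identity holds from index 1 on.\<close>
  then have "eventually (\<lambda>N. 2 * D N = potential (M N) x) sequentially"
    by (intro eventually_sequentiallyI[of 1]) simp
  ultimately show ?thesis
    using Lim_transform_eventually[OF tendsto_mult[OF tendsto_const Dd]] by metis
qed

end

theorem lemma2p4:
  fixes \<eta>1 \<eta>2 B :: real
    and r1 :: "complex \<Rightarrow> complex"
    and \<gamma>p \<gamma>m :: "real \<Rightarrow> complex"
    and M :: "nat \<Rightarrow> real \<Rightarrow> complex \<Rightarrow> complex^2"
    and X :: "real \<Rightarrow> complex \<Rightarrow> complex^2"
  assumes eta: "0 < \<eta>1" "\<eta>1 < \<eta>2"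
    and r1_analytic: "r1 analytic_on (upper_seg \<eta>1 \<eta>2 \<union> lower_seg \<eta>1 \<eta>2)"
    and r1_sym: "\<And>z. z \<in> upper_seg \<eta>1 \<eta>2 \<union> lower_seg \<eta>1 \<eta>2 \<Longrightarrow> r1 (cnj z) = r1 z"
    and r1_pos: "\<And>z. z \<in> upper_seg \<eta>1 \<eta>2 \<union> lower_seg \<eta>1 \<eta>2 \<Longrightarrow> r1 z \<in> \<real> \<and> 0 < Re (r1 z)"
    and gp: "valid_path \<gamma>p" "simple_path \<gamma>p" "pathfinish \<gamma>p = pathstart \<gamma>p"
      "path_image \<gamma>p \<subseteq> {z. 0 < Im z}"
      "upper_seg \<eta>1 \<eta>2 \<subseteq> inside (path_image \<gamma>p)"
      "\<And>z. z \<in> inside (path_image \<gamma>p) \<Longrightarrow> winding_number \<gamma>p z = 1"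
    and gm: "valid_path \<gamma>m" "simple_path \<gamma>m" "pathfinish \<gamma>m = pathstart \<gamma>m"
      "path_image \<gamma>m \<subseteq> {z. Im z < 0}"
      "lower_seg \<eta>1 \<eta>2 \<subseteq> inside (path_image \<gamma>m)"
      "\<And>z. z \<in> inside (path_image \<gamma>m) \<Longrightarrow> winding_number \<gamma>m z = - 1"
    and M: "\<And>N x. 1 \<le> N \<Longrightarrow> soliton_rhp \<eta>1 \<eta>2 r1 N x (M N x)"
    and X: "\<And>x. soliton_gas_rhp \<eta>1 \<eta>2 r1 x (X x)"
    and B: "0 < B"
  shows "\<forall>x. \<bar>x\<bar> < B \<longrightarrow>
    (\<exists>Z. symmetric_limit_rhp \<eta>1 \<eta>2 r1 \<gamma>p \<gamma>m x Z \<and>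
         (\<forall>Z'. symmetric_limit_rhp \<eta>1 \<eta>2 r1 \<gamma>p \<gamma>m x Z' \<longrightarrow>
            (\<forall>z\<in>- (path_image \<gamma>p \<union> path_image \<gamma>m). Z' z = Z z)) \<and>
         (\<forall>z\<in>- (path_image \<gamma>p \<union> path_image \<gamma>m).
            (\<lambda>N. soliton_Z \<eta>1 \<eta>2 r1 \<gamma>p \<gamma>m N x (M N x) z) \<longlonglongrightarrow> Z z)) \<and>
    (\<lambda>N. potential (M N) x) \<longlonglongrightarrow> potential X x"
proof -
  have real: "r1 (\<i> * of_real t) = of_real (Re (r1 (\<i> * of_real t)))" "0 < Re (r1 (\<i> * of_real t))"
    if "t \<in> {\<eta>1..\<eta>2}" for t
    using r1_pos[of "\<i> * of_real t"] ii_in_upper_seg[OF that] by (auto simp: of_real_Re)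
  \<comment> \<open>The density is the real part of \<open>r1\<close> over \<open>pi\<close> because
    the norming constants carry the factor \<open>1 / pi\<close>.\<close>
  interpret soliton_contours \<eta>1 \<eta>2 r1 "\<lambda>t. Re (r1 (\<i> * of_real t)) / pi" \<gamma>p \<gamma>m
  proof unfold_locales
    show "r1 analytic_on upper_seg \<eta>1 \<eta>2" by (rule analytic_on_subset[OF r1_analytic]) simp
    fix t assume t: "t \<in> {\<eta>1..\<eta>2}"
    show up: "r1 (\<i> * of_real t) = of_real (pi * (Re (r1 (\<i> * of_real t)) / pi))" using real(1)[OF t] by simp
    have "r1 (cnj (\<i> * of_real t)) = r1 (\<i> * of_real t)" by (rule r1_sym) (use ii_in_upper_seg[OF t] in simp)
    then have "r1 (- (\<i> * of_real t)) = r1 (\<i> * of_real t)" by simp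
    then show "r1 (- (\<i> * of_real t)) = of_real (pi * (Re (r1 (\<i> * of_real t)) / pi))" using up by (rule trans)
    show "0 \<le> Re (r1 (\<i> * of_real t)) / pi" using real(2)[OF t] by simp
  qed (use eta gp gm in auto)
  have conv: "(\<lambda>N. soliton_Z \<eta>1 \<eta>2 r1 \<gamma>p \<gamma>m N x (M N x) z) \<longlonglongrightarrow> Z z"
    if "symmetric_limit_rhp \<eta>1 \<eta>2 r1 \<gamma>p \<gamma>m x Z" "z \<in> - (path_image \<gamma>p \<union> path_image \<gamma>m)" for x Z z
    by (rule soliton_Z_convergence[OF M that])
  show ?thesis
  proof (intro allI impI conjI)
    fix x
    obtain Z where Z: "symmetric_limit_rhp \<eta>1 \<eta>2 r1 \<gamma>p \<gamma>m x Z"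
      using gas_solution_of_limit_problem[OF X[of x]] by (elim exE conjE)
    show "\<exists>Z. symmetric_limit_rhp \<eta>1 \<eta>2 r1 \<gamma>p \<gamma>m x Z \<and>
         (\<forall>Z'. symmetric_limit_rhp \<eta>1 \<eta>2 r1 \<gamma>p \<gamma>m x Z' \<longrightarrow>
            (\<forall>z\<in>- (path_image \<gamma>p \<union> path_image \<gamma>m). Z' z = Z z)) \<and>
         (\<forall>z\<in>- (path_image \<gamma>p \<union> path_image \<gamma>m).
            (\<lambda>N. soliton_Z \<eta>1 \<eta>2 r1 \<gamma>p \<gamma>m N x (M N x) z) \<longlonglongrightarrow> Z z)"
    proof (rule exI[of _ Z], intro conjI allI impI ballI Z)
      fix Z' z assume "symmetric_limit_rhp \<eta>1 \<eta>2 r1 \<gamma>p \<gamma>m x Z'" "z \<in> - (path_image \<gamma>p \<union> path_image \<gamma>m)"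
      \<comment> \<open>Both solutions are the limit at \<open>z\<close> of one and the same
        sequence.\<close>
      then show "Z' z = Z z" using conv Z LIMSEQ_unique by blast
    qed (rule conv[OF Z])
    show "(\<lambda>N. potential (M N) x) \<longlonglongrightarrow> potential X x"
      by (rule potential_convergence[OF M X])
  qed
qed

end
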